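(* Let $a,b,c,d,e,f,h$ be nonzero complex numbers, $s=\dfrac{a^3q^3}{bcdef}$, and consider the three-term recurrence $X_{n+1}-a_nX_n+b_nX_{n-1}=0$ with coefficients $a_n,b_n$ given in the context. With all products over $p\in\{b,c,d,e,f\}$ unless indicated otherwise, put $$X^{(1)}_n=\frac{(\frac{sq^{2n-1}}{h^2},\frac{aq^{n+1}}{h})_\infty}{(\frac{sq^{n-1}}{h},\frac{sq^{n-1}}{ah})_\infty\prod_p(\frac{aq^{n+1}}{ph})_\infty}\,\Phi\Bigl(a;b,c,d,e,f,\tfrac{sq^{n-1}}{h},hq^{-n};q\Bigr),$$ $$X^{(2)}_n=\frac{(\frac{sq^{2n-1}}{h^2},\frac{sq^{n}}{ah})_\infty}{(\frac{q^{n+1}}{h},\frac{aq^{n}}{h})_\infty\prod_p(\frac{psq^{n-1}}{ah})_\infty}\,\Phi\Bigl(\tfrac qa;\tfrac qb,\tfrac qc,\tfrac qd,\tfrac qe,\tfrac qf,\tfrac{hq^{-n+2}}{s},\tfrac{q^{n+1}}{h};q\Bigr),$$ $$X^{(3)}_n=\Bigl(\frac{s}{aq}\Bigr)^n\frac{(\frac{sq^n}{ah},\frac{sq^{2n}}{h^2},\frac{sq^{2n-1}}{h^2})_\infty}{(\frac{sq^{n-1}}{h},\frac{q^{n+1}}{h},\frac{s^2q^{2n-1}}{ah^2})_\infty}\prod_p\frac{(\frac{sq^n}{ph})_\infty}{(\frac{aq^{n+1}}{ph},\frac{psq^{n-1}}{ah})_\infty}\,\Phi\Bigl(\tfrac{s^2q^{2n-2}}{ah^2};\tfrac{s}{aq},\tfrac{bsq^{n-1}}{ah},\tfrac{csq^{n-1}}{ah},\tfrac{dsq^{n-1}}{ah},\tfrac{esq^{n-1}}{ah},\tfrac{fsq^{n-1}}{ah},\tfrac{sq^{n-1}}{h};q\Bigr),$$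 $$X^{(4)}_n=\Bigl(\frac{aq^2}{s}\Bigr)^n\frac{(\frac{s^2q^{2n-3}}{ah^2})_\infty}{(\frac{sq^{n-1}}{ah})_\infty\prod_p(\frac{sq^{n-1}}{ph})_\infty}\,\Phi\Bigl(\tfrac{ah^2q^{-2n+3}}{s^2};\tfrac{aq^2}{s},\tfrac{ahq^{-n+2}}{bs},\tfrac{ahq^{-n+2}}{cs},\tfrac{ahq^{-n+2}}{ds},\tfrac{ahq^{-n+2}}{es},\tfrac{ahq^{-n+2}}{fs},\tfrac{hq^{-n+2}}{s};q\Bigr),$$ $$X^{(5)}_n=\Bigl(\frac{aq^2}{s}\Bigr)^n\frac{(\frac{sq^{2n-1}}{h^2},\frac{sq^{2n}}{h^2},\frac{aq^{n+1}}{h})_\infty}{(\frac{aq^{2n+2}}{h^2},\frac{sq^{n-1}}{h},\frac{q^{n+1}}{h})_\infty}\prod_p\frac{(\frac{pq^{n+1}}{h})_\infty}{(\frac{psq^{n-1}}{ah},\frac{aq^{n+1}}{ph})_\infty}\,\Phi\Bigl(\tfrac{aq^{2n+1}}{h^2};\tfrac{aq^2}{s},\tfrac{aq^{n+1}}{bh},\tfrac{aq^{n+1}}{ch},\tfrac{aq^{n+1}}{dh},\tfrac{aq^{n+1}}{eh},\tfrac{aq^{n+1}}{fh},\tfrac{q^{n+1}}{h};q\Bigr),$$ $$X^{(6)}_n=\Bigl(\frac{s}{aq}\Bigr)^n\frac{(\frac{aq^{2n}}{h^2})_\infty}{(\frac{aq^n}{h})_\infty\prod_p(\frac{pq^n}{h})_\infty}\,\Phi\Bigl(\tfrac{h^2q^{-2n}}{a};\tfrac{s}{aq},\tfrac{bhq^{-n}}{a},\tfrac{chq^{-n}}{a},\tfrac{dhq^{-n}}{a},\tfrac{ehq^{-n}}{a},\tfrac{fhq^{-n}}{a},hq^{-n};q\Bigr),$$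 and for each $r\in\{b,c,d,e,f\}$ with $\{p_1,p_2,p_3,p_4\}$ the remaining four of these letters, $$X^{(7),[r]}_n=\frac{(\frac{sq^{2n-1}}{h^2},\frac{rq^{n+1}}{h})_\infty}{(\frac{rsq^{n-1}}{ah},\frac{sq^{n-1}}{rh},\frac{q^{n+1}}{h})_\infty\prod_{i}(\frac{aq^{n+1}}{p_ih})_\infty}\,\Phi\Bigl(\tfrac{r^2}{a};r,\tfrac{rp_1}{a},\tfrac{rp_2}{a},\tfrac{rp_3}{a},\tfrac{rp_4}{a},\tfrac{rsq^{n-1}}{ah},\tfrac{rhq^{-n}}{a};q\Bigr),$$ $$X^{(8),[r]}_n=\frac{(\frac{sq^{2n-1}}{h^2},\frac{sq^{n}}{rh})_\infty}{(\frac{sq^{n-1}}{h},\frac{aq^{n+1}}{rh},\frac{rq^n}{h})_\infty\prod_i(\frac{p_isq^{n-1}}{ah})_\infty}\,\Phi\Bigl(\tfrac{aq}{r^2};\tfrac qr,\tfrac{aq}{rp_1},\tfrac{aq}{rp_2},\tfrac{aq}{rp_3},\tfrac{aq}{rp_4},\tfrac{ahq^{-n+2}}{rs},\tfrac{aq^{n+1}}{rh};q\Bigr).$$ Then each of these sequences, for every choice of the distinguished parameter of the $\Phi$ occurring in it (the same position for all $n$), is a solution of the recurrence. Among them, the following fifty-six are pairwise linearly independent: the seven choices of distinguished parameter in $X^{(1)}$; the seven choices in $X^{(2)}$; the six choices other than $sq^{n-1}/h$ in $X^{(3)}$; the six choices other than $hq^{-n+2}/s$ in $X^{(4)}$; the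 five choices $aq^{n+1}/(ph)$ in $X^{(5)}$; the five choices $phq^{-n}/a$ in $X^{(6)}$ ($p\in\{b,c,d,e,f\}$); and, for each of the ten unordered pairs $\{r,p\}\subset\{b,c,d,e,f\}$, $X^{(7),[r]}$ with distinguished parameter $rp/a$ and $X^{(8),[r]}$ with distinguished parameter $aq/(rp)$ (interchanging $r$ and $p$ changes these only by a factor independent of $n$).
   Context: Throughout $q\in\mathbb C$, $0<|q|<1$; $(x)_0=1$, $(x)_k=\prod_{j=0}^{k-1}(1-xq^j)$, $(x)_\infty=\prod_{j\ge 0}(1-xq^j)$, and $(x_1,\dots,x_r)_k=\prod_i (x_i)_k$ for $k\in\mathbb{Z}_{\ge0}\cup\{\infty\}$. Products over letters are with multiplicity. The balanced very-well-poised series is $${}_{10}W_9(a;p_1,\dots,p_7;q)=\sum_{k=0}^\infty \frac{1-aq^{2k}}{1-a}\,\frac{(a,p_1,\dots,p_7)_k}{(q,aq/p_1,\dots,aq/p_7)_k}\,q^k,\qquad p_1p_2\cdots p_7=a^3q^2 .$$ For a distinguished position $i$ (distinguished parameter $p=p_i$), $$\Phi^{(p)}(a;p_1,\dots,p_7;q)={}_{10}W_9(a;p_1,\dots,p_7;q)+\frac{(aq,\,p_i/a)_\infty}{(p_i^2q/a,\,a/p_i)_\infty}\prod_{j\ne i}\frac{(p_j,\;p_iq/p_j)_\infty}{(aq/p_j,\;p_ip_j/a)_\infty}\;{}_{10}W_9\Bigl(\tfrac{p_i^2}{a};\,p_i,\bigl(\tfrac{p_ip_j}{a}\bigr)_{j\ne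 i};q\Bigr),$$ and $\Phi$ without superscript denotes any one of these seven functions. The recurrence coefficients are $$a_n=A_n+B_n+\frac{sq^{2n-1}}{ah^2}\,\frac{(1-\frac{s}{aq^2})(1-b)(1-c)(1-d)(1-e)(1-f)}{(1-\frac{aq^{n+1}}{h})(1-\frac{sq^{n-2}}{ah})},\qquad b_n=A_{n-1}B_n,$$ $$A_n=\frac{(1-\frac{sq^{n-1}}{h})(1-\frac{sq^{n-1}}{ah})\prod_{p\in\{b,c,d,e,f\}}(1-\frac{aq^{n+1}}{ph})}{(1-\frac{sq^{2n}}{h^2})(1-\frac{sq^{2n-1}}{h^2})(1-\frac{aq^{n+1}}{h})},\qquad B_n=\frac{q(1-\frac{q^n}{h})(1-\frac{aq^n}{h})\prod_{p\in\{b,c,d,e,f\}}(1-\frac{psq^{n-2}}{ah})}{(1-\frac{sq^{2n-1}}{h^2})(1-\frac{sq^{2n-2}}{h^2})(1-\frac{sq^{n-2}}{ah})}.$$ Standing assumption: the parameters are generic; in particular no zero denominators (singularities) occur. *)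

theory Defs
  imports "HOL-Analysis.Analysis"
begin

section \<open>Shifted factorials and the series\<close>

definition qpoch :: "complex \<Rightarrow> complex \<Rightarrow> nat \<Rightarrow> complex" where
  "qpoch q x k = (\<Prod>j<k. 1 - x * q ^ j)"

definition qpoch_inf :: "complex \<Rightarrow> complex \<Rightarrow> complex" where
  "qpoch_inf q x = (\<Prod>j. 1 - x * q ^ j)"

definition qpochs :: "complex \<Rightarrow> complex list \<Rightarrow> nat \<Rightarrow> complex" where
  "qpochs q xs k = (\<Prod>x\<leftarrow>xs. qpoch q x k)"

definition qpochs_inf :: "complex \<Rightarrow> complex list \<Rightarrow> complex" where
  "qpochs_inf q xs = (\<Prod>x\<leftarrow>xs. qpoch_inf q x)"

text \<open>
  The very-well-poised series. The balancing condition on the seven parameters is not built in: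
  it holds identically for all the parameter lists used below. The terms have ratio tending
  to \<open>q\<close>, so the series converges as soon as no denominator vanishes.
\<close>

definition W109 :: "complex \<Rightarrow> complex \<Rightarrow> complex list \<Rightarrow> complex" where
  "W109 q a ps =
     (\<Sum>k. (1 - a * q ^ (2 * k)) / (1 - a) *
          (qpochs q (a # ps) k / qpochs q (q # map (\<lambda>p. a * q / p) ps) k) * q ^ k)"

definition W109_regular :: "complex \<Rightarrow> complex \<Rightarrow> complex list \<Rightarrow> bool" where
  "W109_regular q a ps \<longleftrightarrow>
     1 - a \<noteq> 0 \<and> (\<forall>k. qpochs q (q # map (\<lambda>p. a * q / p) ps) k \<noteq> 0)"

text \<open>
  Parameters are numbered from \<open>0\<close>; \<open>i\<close> is the position of the distinguished one. In the parameter
  list of the second series the entry \<open>p\<^sub>i\<close> is kept at position \<open>i\<close>.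
\<close>

definition partner_params :: "nat \<Rightarrow> complex \<Rightarrow> complex list \<Rightarrow> complex list" where
  "partner_params i a ps =
     map (\<lambda>j. if j = i then ps ! i else ps ! i * ps ! j / a) [0..<length ps]"

definition Phi_denominator :: "complex \<Rightarrow> nat \<Rightarrow> complex \<Rightarrow> complex list \<Rightarrow> complex" where
  "Phi_denominator q i a ps =
     qpochs_inf q [(ps ! i)\<^sup>2 * q / a, a / ps ! i] *
     (\<Prod>j\<in>{..<length ps} - {i}. qpochs_inf q [a * q / ps ! j, ps ! i * ps ! j / a])"

definition Phi :: "complex \<Rightarrow> nat \<Rightarrow> complex \<Rightarrow> complex list \<Rightarrow> complex" where
  "Phi q i a ps =
     W109 q a ps +
     qpochs_inf q [a * q, ps ! i / a] *
     (\<Prod>j\<in>{..<length ps} - {i}. qpochs_inf q [ps ! j, ps ! i * q / ps ! j]) /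
     Phi_denominator q i a ps *
     W109 q ((ps ! i)\<^sup>2 / a) (partner_params i a ps)"

definition Phi_regular :: "complex \<Rightarrow> nat \<Rightarrow> complex \<Rightarrow> complex list \<Rightarrow> bool" where
  "Phi_regular q i a ps \<longleftrightarrow>
     W109_regular q a ps \<and> Phi_denominator q i a ps \<noteq> 0 \<and>
     W109_regular q ((ps ! i)\<^sup>2 / a) (partner_params i a ps)"


section \<open>The recurrence\<close>

text \<open>Throughout, \<open>bs\<close> is the list \<open>[b, c, d, e, f]\<close>.\<close>

definition s_of :: "complex \<Rightarrow> complex \<Rightarrow> complex list \<Rightarrow> complex" where
  "s_of q a bs = a ^ 3 * q ^ 3 / prod_list bs"

definition rec_A :: "complex \<Rightarrow> complex \<Rightarrow> complex list \<Rightarrow> complex \<Rightarrow> int \<Rightarrow> complex" where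
  "rec_A q a bs h n = (let s = s_of q a bs in
     (1 - s * q powi (n - 1) / h) * (1 - s * q powi (n - 1) / (a * h)) *
     (\<Prod>p\<leftarrow>bs. 1 - a * q powi (n + 1) / (p * h)) /
     ((1 - s * q powi (2 * n) / h\<^sup>2) * (1 - s * q powi (2 * n - 1) / h\<^sup>2) *
      (1 - a * q powi (n + 1) / h)))"

definition rec_B :: "complex \<Rightarrow> complex \<Rightarrow> complex list \<Rightarrow> complex \<Rightarrow> int \<Rightarrow> complex" where
  "rec_B q a bs h n = (let s = s_of q a bs in
     q * (1 - q powi n / h) * (1 - a * q powi n / h) *
     (\<Prod>p\<leftarrow>bs. 1 - p * s * q powi (n - 2) / (a * h)) /
     ((1 - s * q powi (2 * n - 1) / h\<^sup>2) * (1 - s * q powi (2 * n - 2) / h\<^sup>2) *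
      (1 - s * q powi (n - 2) / (a * h))))"

definition coeff_a :: "complex \<Rightarrow> complex \<Rightarrow> complex list \<Rightarrow> complex \<Rightarrow> int \<Rightarrow> complex" where
  "coeff_a q a bs h n = (let s = s_of q a bs in
     rec_A q a bs h n + rec_B q a bs h n +
     s * q powi (2 * n - 1) / (a * h\<^sup>2) *
     ((1 - s / (a * q\<^sup>2)) * (\<Prod>p\<leftarrow>bs. 1 - p) /
      ((1 - a * q powi (n + 1) / h) * (1 - s * q powi (n - 2) / (a * h)))))"

definition coeff_b :: "complex \<Rightarrow> complex \<Rightarrow> complex list \<Rightarrow> complex \<Rightarrow> int \<Rightarrow> complex" where
  "coeff_b q a bs h n = rec_A q a bs h (n - 1) * rec_B q a bs h n"

definition coeffs_regular :: "complex \<Rightarrow> complex \<Rightarrow> complex list \<Rightarrow> complex \<Rightarrow> bool" where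
  "coeffs_regular q a bs h \<longleftrightarrow> (let s = s_of q a bs in
     \<forall>n::int. 1 - s * q powi n / h\<^sup>2 \<noteq> 0 \<and> 1 - a * q powi n / h \<noteq> 0 \<and> 1 - s * q powi n / (a * h) \<noteq> 0)"

definition solves_recurrence ::
    "complex \<Rightarrow> complex \<Rightarrow> complex list \<Rightarrow> complex \<Rightarrow> (int \<Rightarrow> complex) \<Rightarrow> bool" where
  "solves_recurrence q a bs h X \<longleftrightarrow>
     (\<forall>n. X (n + 1) - coeff_a q a bs h n * X n + coeff_b q a bs h n * X (n - 1) = 0)"

definition lin_indep2 :: "(int \<Rightarrow> complex) \<Rightarrow> (int \<Rightarrow> complex) \<Rightarrow> bool" where
  "lin_indep2 X Y \<longleftrightarrow> (\<forall>\<alpha> \<beta>. (\<forall>n. \<alpha> * X n + \<beta> * Y n = 0) \<longrightarrow> \<alpha> = 0 \<and> \<beta> = 0)"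


section \<open>The solutions\<close>

text \<open>\<open>X7 i\<close> and \<open>X8 i\<close> belong to the letter \<open>r = bs ! i\<close>, \<open>i < 5\<close>.\<close>

datatype family = X1 | X2 | X3 | X4 | X5 | X6 | X7 nat | X8 nat

definition families :: "family set" where
  "families = {X1, X2, X3, X4, X5, X6} \<union> X7 ` {..<5} \<union> X8 ` {..<5}"

definition others :: "nat \<Rightarrow> complex list \<Rightarrow> complex list" where
  "others i bs = map ((!) bs) (filter (\<lambda>j. j \<noteq> i) [0..<length bs])"

text \<open>
  \<open>family_data q a bs h S n = (g, us, vs, A, ps)\<close> encodes that the \<open>n\<close>-th term of the sequence is
  \<open>g\<close> times the quotient of \<open>(us)\<^sub>\<infinity>\<close> by \<open>(vs)\<^sub>\<infinity>\<close> times \<open>\<Phi>(A; ps; q)\<close>.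
  The seven parameters of \<open>\<Phi>\<close> in the families \<open>X7 i\<close> and \<open>X8 i\<close> are ordered so that, for \<open>j \<noteq> i\<close>,
  the parameter \<open>r p / a\<close>, respectively \<open>a q / (r p)\<close>, with \<open>p = bs ! j\<close> stands at position \<open>j\<close>;
  the parameter \<open>r\<close>, respectively \<open>q / r\<close>, stands at position \<open>i\<close>.
\<close>

fun family_data ::
    "complex \<Rightarrow> complex \<Rightarrow> complex list \<Rightarrow> complex \<Rightarrow> family \<Rightarrow> int \<Rightarrow>
     complex \<times> complex list \<times> complex list \<times> complex \<times> complex list" where
  "family_data q a bs h X1 n = (let s = s_of q a bs in
     (1,
      [s * q powi (2 * n - 1) / h\<^sup>2, a * q powi (n + 1) / h],
      [s * q powi (n - 1) / h, s * q powi (n - 1) / (a * h)] @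
        map (\<lambda>p. a * q powi (n + 1) / (p * h)) bs,
      a,
      bs @ [s * q powi (n - 1) / h, h * q powi (- n)]))"
| "family_data q a bs h X2 n = (let s = s_of q a bs in
     (1,
      [s * q powi (2 * n - 1) / h\<^sup>2, s * q powi n / (a * h)],
      [q powi (n + 1) / h, a * q powi n / h] @ map (\<lambda>p. p * s * q powi (n - 1) / (a * h)) bs,
      q / a,
      map (\<lambda>p. q / p) bs @ [h * q powi (- n + 2) / s, q powi (n + 1) / h]))"
| "family_data q a bs h X3 n = (let s = s_of q a bs in
     ((s / (a * q)) powi n,
      [s * q powi n / (a * h), s * q powi (2 * n) / h\<^sup>2, s * q powi (2 * n - 1) / h\<^sup>2] @
        map (\<lambda>p. s * q powi n / (p * h)) bs,
      [s * q powi (n - 1) / h, q powi (n + 1) / h, s\<^sup>2 * q powi (2 * n - 1) / (a * h\<^sup>2)] @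
        map (\<lambda>p. a * q powi (n + 1) / (p * h)) bs @
        map (\<lambda>p. p * s * q powi (n - 1) / (a * h)) bs,
      s\<^sup>2 * q powi (2 * n - 2) / (a * h\<^sup>2),
      [s / (a * q)] @ map (\<lambda>p. p * s * q powi (n - 1) / (a * h)) bs @ [s * q powi (n - 1) / h]))"
| "family_data q a bs h X4 n = (let s = s_of q a bs in
     ((a * q\<^sup>2 / s) powi n,
      [s\<^sup>2 * q powi (2 * n - 3) / (a * h\<^sup>2)],
      [s * q powi (n - 1) / (a * h)] @ map (\<lambda>p. s * q powi (n - 1) / (p * h)) bs,
      a * h\<^sup>2 * q powi (- 2 * n + 3) / s\<^sup>2,
      [a * q\<^sup>2 / s] @ map (\<lambda>p. a * h * q powi (- n + 2) / (p * s)) bs @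
        [h * q powi (- n + 2) / s]))"
| "family_data q a bs h X5 n = (let s = s_of q a bs in
     ((a * q\<^sup>2 / s) powi n,
      [s * q powi (2 * n - 1) / h\<^sup>2, s * q powi (2 * n) / h\<^sup>2, a * q powi (n + 1) / h] @
        map (\<lambda>p. p * q powi (n + 1) / h) bs,
      [a * q powi (2 * n + 2) / h\<^sup>2, s * q powi (n - 1) / h, q powi (n + 1) / h] @
        map (\<lambda>p. p * s * q powi (n - 1) / (a * h)) bs @
        map (\<lambda>p. a * q powi (n + 1) / (p * h)) bs,
      a * q powi (2 * n + 1) / h\<^sup>2,
      [a * q\<^sup>2 / s] @ map (\<lambda>p. a * q powi (n + 1) / (p * h)) bs @ [q powi (n + 1) / h]))"
| "family_data q a bs h X6 n = (let s = s_of q a bs in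
     ((s / (a * q)) powi n,
      [a * q powi (2 * n) / h\<^sup>2],
      [a * q powi n / h] @ map (\<lambda>p. p * q powi n / h) bs,
      h\<^sup>2 * q powi (- 2 * n) / a,
      [s / (a * q)] @ map (\<lambda>p. p * h * q powi (- n) / a) bs @ [h * q powi (- n)]))"
| "family_data q a bs h (X7 i) n = (let s = s_of q a bs; r = bs ! i in
     (1,
      [s * q powi (2 * n - 1) / h\<^sup>2, r * q powi (n + 1) / h],
      [r * s * q powi (n - 1) / (a * h), s * q powi (n - 1) / (r * h), q powi (n + 1) / h] @
        map (\<lambda>p. a * q powi (n + 1) / (p * h)) (others i bs),
      r\<^sup>2 / a,
      map (\<lambda>j. if j = i then r else r * bs ! j / a) [0..<length bs] @
        [r * s * q powi (n - 1) / (a * h), r * h * q powi (- n) / a]))"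
| "family_data q a bs h (X8 i) n = (let s = s_of q a bs; r = bs ! i in
     (1,
      [s * q powi (2 * n - 1) / h\<^sup>2, s * q powi n / (r * h)],
      [s * q powi (n - 1) / h, a * q powi (n + 1) / (r * h), r * q powi n / h] @
        map (\<lambda>p. p * s * q powi (n - 1) / (a * h)) (others i bs),
      a * q / r\<^sup>2,
      map (\<lambda>j. if j = i then q / r else a * q / (r * bs ! j)) [0..<length bs] @
        [a * h * q powi (- n + 2) / (r * s), a * q powi (n + 1) / (r * h)]))"

definition X_seq ::
    "complex \<Rightarrow> complex \<Rightarrow> complex list \<Rightarrow> complex \<Rightarrow> family \<Rightarrow> nat \<Rightarrow> int \<Rightarrow> complex" where
  "X_seq q a bs h S i n = (case family_data q a bs h S n of (g, us, vs, A, ps) \<Rightarrow>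
     g * (qpochs_inf q us / qpochs_inf q vs) * Phi q i A ps)"

definition X_regular ::
    "complex \<Rightarrow> complex \<Rightarrow> complex list \<Rightarrow> complex \<Rightarrow> family \<Rightarrow> nat \<Rightarrow> int \<Rightarrow> bool" where
  "X_regular q a bs h S i n \<longleftrightarrow> (case family_data q a bs h S n of (g, us, vs, A, ps) \<Rightarrow>
     qpochs_inf q vs \<noteq> 0 \<and> Phi_regular q i A ps)"

text \<open>No zero denominator occurs in the recurrence or in any of the sequences.\<close>

definition nonsingular :: "complex \<Rightarrow> complex \<Rightarrow> complex list \<Rightarrow> complex \<Rightarrow> bool" where
  "nonsingular q a bs h \<longleftrightarrow>
     coeffs_regular q a bs h \<and> (\<forall>S\<in>families. \<forall>i<7. \<forall>n. X_regular q a bs h S i n)"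

text \<open>
  A pair \<open>(S, i)\<close> is the family \<open>S\<close> with the parameter at position \<open>i\<close> distinguished.
  An unordered pair of letters is represented by its positions \<open>i < j\<close> in \<open>bs\<close>.
\<close>

definition fifty_six :: "(family \<times> nat) set" where
  "fifty_six =
     {X1} \<times> {..<7} \<union> {X2} \<times> {..<7} \<union> {X3} \<times> {..<6} \<union> {X4} \<times> {..<6} \<union>
     {X5} \<times> {1..5} \<union> {X6} \<times> {1..5} \<union>
     {(X7 i, j) | i j. i < j \<and> j < 5} \<union> {(X8 i, j) | i j. i < j \<and> j < 5}"


section \<open>Genericity\<close>

definition torus :: "(complex ^ 7) set" where
  "torus = {x. \<forall>i. x $ i \<noteq> 0}"

text \<open>
  A continuous function that is holomorphic in each variable separately is a holomorphic function
  of several variables. As \<open>torus\<close> is connected, the zero set of a holomorphic function on it that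
  does not vanish identically is a proper analytic subset; a property holds generically if it holds
  off such a set.
\<close>

definition holomorphic_on_torus :: "(complex ^ 7 \<Rightarrow> complex) \<Rightarrow> bool" where
  "holomorphic_on_torus F \<longleftrightarrow> continuous_on torus F \<and>
     (\<forall>x\<in>torus. \<forall>i. (\<lambda>z. F (\<chi> j. if j = i then z else x $ j)) holomorphic_on - {0})"

definition generically ::
    "(complex \<Rightarrow> complex \<Rightarrow> complex \<Rightarrow> complex \<Rightarrow> complex \<Rightarrow> complex \<Rightarrow> complex \<Rightarrow> bool) \<Rightarrow> bool" where
  "generically P \<longleftrightarrow> (\<exists>F. holomorphic_on_torus F \<and> (\<exists>x\<in>torus. F x \<noteq> 0) \<and>
     (\<forall>x\<in>torus. F x \<noteq> 0 \<longrightarrow> P (x $ 1) (x $ 2) (x $ 3) (x $ 4) (x $ 5) (x $ 6) (x $ 7)))"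

end

theory Submission
  imports Defs "HOL-Complex_Analysis.Conformal_Mappings"
begin

text \<open>
  Attach to the parameters the octet \<open>t\<close> with \<open>t\<^sub>p = p / a\<close> for the five letters,
  \<open>t\<^sub>5 = s q\<^bsup>n-1\<^esup> / (a h)\<close>, \<open>t\<^sub>6 = h q\<^bsup>-n\<^esup> / a\<close> and \<open>t\<^sub>7 = 1\<close>, so that \<open>a\<^sup>4 \<Prod>t = q\<^sup>2\<close>. Every \<open>\<Phi>\<close> is, up to a
  factor, a difference \<open>S\<^sub>T - S\<^sub>V\<close> of sums \<open>S\<^sub>T = \<Sum>\<^sub>k f(t\<^sub>T q\<^sup>k)\<close> of one function \<open>f\<close>, belonging either to
  the octet or to its dual, obtained by \<open>a \<mapsto> q / a\<close> and \<open>t \<mapsto> 1 / t\<close>. Raising \<open>n\<close> multiplies \<open>t\<^sub>5\<close> by \<open>q\<close> and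
  divides \<open>t\<^sub>6\<close> by \<open>q\<close>. A telescoping relation between three neighbouring functions \<open>f\<close> yields an
  inhomogeneous contiguous relation for \<open>S\<^sub>T\<close> whose right-hand side does not depend on \<open>T\<close>; the differences
  therefore satisfy the homogeneous recurrence.

  For independence, the determinant of two solutions at neighbouring \<open>n\<close> becomes holomorphic
  on the torus after multiplication by the denominators. Where \<open>a t\<^sub>A t\<^sub>B = 1\<close>, the sums \<open>S\<^sub>A\<close> and \<open>S\<^sub>B\<close> have a
  pole and their numerators reduce to one term; at suitable such points only one of the two
  products in the determinant survives. The exception is the comparison of \<open>S\<^sub>m - S\<^sub>m\<^sub>'\<close> with a dual difference
  at two further coordinates independent of \<open>n\<close>: if that determinant vanished identically, interchanging letters
  would make \<open>S\<^sub>m - S\<^sub>m\<^sub>'\<close> and \<open>S\<^sub>w - S\<^sub>m\<^sub>'\<close> dependent.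
\<close>

section \<open>Infinite shifted factorials\<close>

text \<open>Eight coordinates have 28 unordered pairs, and two classes of 28 differences make the
  fifty-six solutions. The contiguous relation comes down to a polynomial identity which, divided by
  \<open>x * (1 - a * x\<^sup>2)\<close>, is \<open>x\<^sup>2\<close> times a quadratic in
  \<open>1 / x + a * x\<close>; three points therefore fix its coefficients. The third point
  \<open>t\<^sub>7 = 1\<close> returns literally the three summands of the given
  \<open>a\<^sub>n\<close>, but hides the symmetry in the coordinates that do not move. Since the
  dual octet must obey the same recurrence, the middle coefficient is first rewritten symmetrically.
  A second obstacle: every family carries infinite products of its own. They agree with one gauge
  factor up to a constant, because the quotients are, apart from elementary factors, theta functions
  whose multipliers under \<open>q\<close>-shifts cancel. For independence, a nonterminating series
  is hard to show nonzero at a given point; hence the recourse to poles. Within a class the gauge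
  factor drops out of the determinant; across the classes two different ones remain, and the zeros
  of their quotients must be weighed against the poles.\<close>

locale q_base =
  fixes q :: complex
  assumes q_nz: "q \<noteq> 0" and q_lt1: "norm q < 1"
begin

abbreviation qi :: "complex \<Rightarrow> complex" where "qi \<equiv> qpoch_inf q"

lemma summable_norm_q_power: "summable (\<lambda>k. norm q ^ k)"
  using q_lt1 by (simp add: summable_geometric)

lemma qi_convergent: "convergent_prod (\<lambda>j. 1 - x * q ^ j)"
proof (rule abs_convergent_prod_imp_convergent_prod)
  have "summable (\<lambda>j. norm x * norm q ^ j)"
    by (intro summable_mult summable_norm_q_power)
  hence "summable (\<lambda>j. norm ((1 - x * q ^ j) - 1))"
    by (simp add: norm_mult norm_power)
  thus "abs_convergent_prod (\<lambda>j. 1 - x * q ^ j)"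
    by (subst abs_convergent_prod_conv_summable)
qed

lemma qpoch_tendsto_qi: "qpoch q x \<longlonglongrightarrow> qi x"
proof -
  have "(\<lambda>n. \<Prod>j\<le>n. 1 - x * q ^ j) \<longlonglongrightarrow> qi x"
    unfolding qpoch_inf_def by (rule convergent_prod_LIMSEQ[OF qi_convergent])
  hence "(\<lambda>n. qpoch q x (Suc n)) \<longlonglongrightarrow> qi x"
    by (simp add: qpoch_def lessThan_Suc_atMost)
  thus ?thesis by (rule LIMSEQ_imp_Suc)
qed

lemma qpoch_Suc_left: "qpoch q x (Suc k) = (1 - x) * qpoch q (x * q) k"
  by (simp add: qpoch_def prod.lessThan_Suc_shift mult.assoc del: prod.lessThan_Suc)

lemma qpoch_add: "qpoch q x (m + k) = qpoch q x m * qpoch q (x * q ^ m) k"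
proof (induction m arbitrary: x)
  case 0
  then show ?case by (simp add: qpoch_def)
next
  case (Suc m)
  show ?case by (simp only: add_Suc qpoch_Suc_left Suc) (simp add: mult.assoc)
qed

lemma qi_split: "qi x = qpoch q x k * qi (x * q ^ k)"
proof (rule LIMSEQ_unique)
  show "(\<lambda>n. qpoch q x (n + k)) \<longlonglongrightarrow> qi x"
    using qpoch_tendsto_qi by (rule LIMSEQ_ignore_initial_segment)
  have "(\<lambda>n. qpoch q x k * qpoch q (x * q ^ k) n) \<longlonglongrightarrow> qpoch q x k * qi (x * q ^ k)"
    by (intro tendsto_intros qpoch_tendsto_qi)
  thus "(\<lambda>n. qpoch q x (n + k)) \<longlonglongrightarrow> qpoch q x k * qi (x * q ^ k)"
    by (simp add: qpoch_add[symmetric] add.commute)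
qed

lemma qi_step: "qi x = (1 - x) * qi (q * x)"
  using qi_split[of x 1] by (simp add: qpoch_def mult.commute)

lemma qi_eq_0_iff: "qi x = 0 \<longleftrightarrow> (\<exists>j. x * q ^ j = 1)"
proof -
  have "qi x = 0 \<longleftrightarrow> 0 \<in> range (\<lambda>j. 1 - x * q ^ j)"
    unfolding qpoch_inf_def
    by (rule has_prod_eq_0_iff[OF convergent_prod_has_prod[OF qi_convergent[of x]]])
  also have "\<dots> \<longleftrightarrow> (\<exists>j. 0 = 1 - x * q ^ j)" by (simp only: image_iff UNIV_I bex_simps Bex_def simp_thms)
  also have "\<dots> \<longleftrightarrow> (\<exists>j. x * q ^ j = 1)" by (intro iff_exI) (auto simp: algebra_simps)
  finally show ?thesis .
qed

lemma qi_0 [simp]: "qi 0 = 1"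
  by (simp add: qpoch_inf_def)

lemma qi_1 [simp]: "qi 1 = 0"
  by (subst qi_eq_0_iff) (auto intro: exI[of _ 0])

lemma q_power_neq_1: "k \<noteq> 0 \<Longrightarrow> q ^ k \<noteq> 1"
proof
  assume "k \<noteq> 0" "q ^ k = 1"
  have "norm q ^ k < 1 ^ k" using q_lt1 \<open>k \<noteq> 0\<close> by (intro power_strict_mono) auto
  moreover have "norm q ^ k = 1" using arg_cong[OF \<open>q ^ k = 1\<close>, of norm] by (simp add: norm_power)
  ultimately show False by simp
qed

lemma qi_q [simp]: "qi q \<noteq> 0"
  by (subst qi_eq_0_iff) (use q_power_neq_1[of "Suc _"] in auto)

text \<open>Only the nonpositive powers of \<open>q\<close> are zeros of \<open>qi\<close>.
  Excluding all integer powers gives a condition that survives every shift by a power of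
  \<open>q\<close>.\<close>

lemma qi_nz: "(\<And>n::int. x \<noteq> q powi n) \<Longrightarrow> qi x \<noteq> 0"
  unfolding qi_eq_0_iff
proof
  assume *: "\<And>n::int. x \<noteq> q powi n" and "\<exists>j. x * q ^ j = 1"
  then obtain j where "x * q ^ j = 1" by auto
  hence "x = q powi (- int j)" using q_nz by (simp add: power_int_minus field_simps)
  thus False using * by blast
qed

lemma qpoch_nz: "(\<And>n::int. x \<noteq> q powi n) \<Longrightarrow> qpoch q x k \<noteq> 0"
  using qi_nz[of x] qi_split[of x k] by auto

section \<open>Bounds and holomorphy of the infinite product\<close>

definition qbound :: "real \<Rightarrow> real" where "qbound r = exp (r / (1 - norm q))"

text \<open>Each factor is estimated by \<open>1 + y \<le> exp y\<close>, and the exponents form a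
  geometric series. The bound does not depend on \<open>k\<close>, so it passes to
  \<open>qi\<close>.\<close>

lemma norm_qpoch_le: "norm (qpoch q x k) \<le> qbound (norm x)"
proof -
  have "norm (qpoch q x k) = (\<Prod>j<k. norm (1 - x * q ^ j))"
    by (simp add: qpoch_def prod_norm)
  also have "\<dots> \<le> (\<Prod>j<k. exp (norm x * norm q ^ j))"
  proof (rule prod_mono, safe)
    fix j
    have "norm (1 - x * q ^ j) \<le> 1 + norm x * norm q ^ j"
      by (metis norm_mult norm_one norm_power norm_triangle_ineq4)
    also have "\<dots> \<le> exp (norm x * norm q ^ j)" by (rule exp_ge_add_one_self)
    finally show "norm (1 - x * q ^ j) \<le> exp (norm x * norm q ^ j)" .
  qed auto
  also have "\<dots> = exp (\<Sum>j<k. norm x * norm q ^ j)" by (simp add: exp_sum)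
  also have "(\<Sum>j<k. norm x * norm q ^ j) = norm x * (\<Sum>j<k. norm q ^ j)"
    by (simp add: sum_distrib_left)
  also have "(\<Sum>j<k. norm q ^ j) \<le> (\<Sum>j. norm q ^ j)"
    by (rule sum_le_suminf[OF summable_norm_q_power]) auto
  also have "\<dots> = 1 / (1 - norm q)" using q_lt1 by (simp add: suminf_geometric)
  finally show ?thesis by (simp add: qbound_def mult_left_mono)
qed

lemma norm_qi_le: "norm (qi x) \<le> qbound (norm x)"
  by (rule tendsto_upperbound[OF tendsto_norm[OF qpoch_tendsto_qi]])
     (auto intro!: always_eventually norm_qpoch_le)

lemma qbound_mono: "r \<le> s \<Longrightarrow> qbound r \<le> qbound s"
  using q_lt1 by (simp add: qbound_def divide_right_mono)

lemma qbound_nonneg [simp]: "qbound r \<ge> 0" "qbound r > 0"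
  by (simp_all add: qbound_def)

text \<open>The general criterion for products yields some uniform limit on the compact set;
  comparison with the pointwise limit identifies it as \<open>qi\<close>, which is thereby
  entire.\<close>

lemma uniform_limit_qpoch:
  assumes "compact A"
  shows "uniform_limit A (\<lambda>n x. qpoch q x n) qi sequentially"
proof -
  obtain B where B: "\<And>x. x \<in> A \<Longrightarrow> norm x \<le> B"
    using compact_imp_bounded[OF assms] by (auto simp: bounded_iff)
  have "uniformly_convergent_on A (\<lambda>N x. \<Prod>n<N. 1 - x * q ^ n)"
  proof (rule uniformly_convergent_on_prod'[OF _ assms])
    have "uniform_limit A (\<lambda>N x. \<Sum>n<N. norm (1 - x * q ^ n - 1)) (\<lambda>x. \<Sum>n. norm (1 - x * q ^ n - 1)) sequentially"
    proof (rule Weierstrass_m_test)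
      show "norm (norm (1 - x * q ^ n - 1)) \<le> B * norm q ^ n" if "x \<in> A" for n x
        using B[OF that] by (simp add: norm_mult norm_power mult_right_mono)
      show "summable (\<lambda>n. B * norm q ^ n)" by (intro summable_mult summable_norm_q_power)
    qed
    thus "uniformly_convergent_on A (\<lambda>N x. \<Sum>n<N. norm (1 - x * q ^ n - 1))"
      by (auto simp: uniformly_convergent_on_def)
  qed (auto intro!: continuous_intros)
  then obtain l where l: "uniform_limit A (\<lambda>n x. qpoch q x n) l sequentially"
    by (auto simp: uniformly_convergent_on_def qpoch_def)
  have "l x = qi x" if "x \<in> A" for x
    by (rule LIMSEQ_unique[OF tendsto_uniform_limitI[OF l that] qpoch_tendsto_qi])
  thus ?thesis using l by (subst uniform_limit_cong'[where g = "\<lambda>n x. qpoch q x n" and i = l]) auto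
qed

lemma qpoch_holomorphic: "(\<lambda>x. qpoch q x k) holomorphic_on A"
  unfolding qpoch_def by (intro holomorphic_intros)

lemma qi_holomorphic: "qi holomorphic_on A"
proof -
  have "qi holomorphic_on UNIV"
  proof (rule holomorphic_uniform_sequence[where f = "\<lambda>n x. qpoch q x n"])
    show "\<exists>d>0. cball x d \<subseteq> UNIV \<and> uniform_limit (cball x d) (\<lambda>n x. qpoch q x n) qi sequentially" for x
      by (intro exI[of _ 1]) (auto intro: uniform_limit_qpoch)
  qed (auto intro: qpoch_holomorphic)
  thus ?thesis by (rule holomorphic_on_subset) auto
qed

lemma continuous_qi [continuous_intros]: "continuous_on A f \<Longrightarrow> continuous_on A (\<lambda>x. qi (f x))"
  by (rule continuous_on_compose2[OF holomorphic_on_imp_continuous_on[OF qi_holomorphic[of UNIV]]]) auto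

lemma tendsto_q_power: "(\<lambda>k. q ^ k) \<longlonglongrightarrow> 0"
  using q_lt1 by (rule LIMSEQ_power_zero)

lemma tendsto_qi_1: "(\<lambda>k. qi (x * q ^ k)) \<longlonglongrightarrow> 1"
proof -
  have "isCont qi 0"
    using continuous_qi[of UNIV "\<lambda>x. x"] by (simp add: continuous_on_eq_continuous_at)
  moreover have "(\<lambda>k. x * q ^ k) \<longlonglongrightarrow> 0"
    using tendsto_mult_right_zero[OF tendsto_q_power] by simp
  ultimately have "(\<lambda>k. qi (x * q ^ k)) \<longlonglongrightarrow> qi 0"
    by (rule isCont_tendsto_compose)
  thus ?thesis by simp
qed

section \<open>The modified Jacobi theta function and its zeros\<close>

definition qtheta :: "complex \<Rightarrow> complex" where "qtheta x = qi x * qi (q / x)"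

lemma qtheta_step: "x \<noteq> 0 \<Longrightarrow> qtheta (q * x) = - qtheta x / x"
proof -
  assume x: "x \<noteq> 0"
  have "qtheta (q * x) = qi (q * x) * qi (1 / x)" using q_nz by (simp add: qtheta_def)
  also have "qi (1 / x) = (1 - 1 / x) * qi (q / x)" using qi_step[of "1 / x"] by simp
  also have "(1 - 1 / x) = - (1 - x) / x" using x by (simp add: field_simps)
  also have "qi (q * x) * (- (1 - x) / x * qi (q / x)) = - (((1 - x) * qi (q * x)) * qi (q / x)) / x"
    by (simp only: times_divide_eq_left times_divide_eq_right minus_mult_left minus_mult_right mult.assoc mult.left_commute)
  also have "(1 - x) * qi (q * x) = qi x" by (rule qi_step[symmetric])
  finally show ?thesis by (simp add: qtheta_def)
qed

lemma qtheta_nz: "(\<And>n::int. x \<noteq> q powi n) \<Longrightarrow> qtheta x \<noteq> 0"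
proof -
  assume *: "\<And>n::int. x \<noteq> q powi n"
  have "q / x \<noteq> q powi n" for n :: int
  proof
    assume "q / x = q powi n"
    hence "x = q powi (1 - n)" using q_nz by (cases "x = 0") (auto simp: power_int_diff field_simps)
    thus False using * by blast
  qed
  thus ?thesis using * by (simp add: qtheta_def qi_nz)
qed

text \<open>The zeros are all integer powers of \<open>q\<close>: \<open>qi x\<close> contributes
  the nonpositive ones and \<open>qi (q / x)\<close> the positive ones. One theta factor thus
  encodes infinitely many genericity conditions.\<close>

lemma qtheta_nzD:
  assumes x: "x \<noteq> 0" "qtheta x \<noteq> 0"
  shows "x \<noteq> q powi n"
proof
  assume n: "x = q powi n"
  have "qi x = 0 \<or> qi (q / x) = 0"
  proof (cases "n \<le> 0")
    case True
    have "x * q ^ nat (- n) = q powi n * q powi (- n)"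
      using n True by (simp add: power_int_def)
    also have "\<dots> = 1" using q_nz by (simp add: power_int_minus)
    finally show ?thesis by (auto simp: qi_eq_0_iff)
  next
    case False
    have "q / x * q ^ nat (n - 1) = q / q powi n * q powi (n - 1)"
      using n False by (simp add: power_int_def)
    also have "\<dots> = 1" using q_nz by (simp add: power_int_diff)
    finally show ?thesis by (auto simp: qi_eq_0_iff)
  qed
  thus False using x by (auto simp: qtheta_def)
qed

end

section \<open>Octets and their series\<close>

text \<open>Coordinates 0 to 4 belong to the letters; of the coordinates only 5 and 6 move with \<open>n\<close>.\<close>

definition mids :: "nat set" where "mids = {0, 1, 2, 3, 4, 7}"

lemma finite_mids [simp]: "finite mids" by (simp add: mids_def)

definition movers :: "nat \<Rightarrow> nat \<Rightarrow> bool" where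
  "movers p p' \<longleftrightarrow> (p = 5 \<and> p' = 6) \<or> (p = 6 \<and> p' = 5)"

lemma movers_octet: "movers p p' \<Longrightarrow> {..<8} = insert p (insert p' mids)"
  "movers p p' \<Longrightarrow> p \<notin> mids" "movers p p' \<Longrightarrow> p' \<notin> mids" "movers p p' \<Longrightarrow> p \<noteq> p'"
  "movers p p' \<Longrightarrow> p < 8" "movers p p' \<Longrightarrow> p' < 8"
  by (auto simp: movers_def mids_def)

lemma movers_commute: "movers p p' \<Longrightarrow> movers p' p" by (auto simp: movers_def)

lemma mids_less: "m \<in> mids \<Longrightarrow> m < 8" by (auto simp: mids_def)

lemma prod_octet: "movers p p' \<Longrightarrow> (\<Prod>U<8. f U) = f p * f p' * (\<Prod>m\<in>mids. f m)" for f :: "nat \<Rightarrow> 'a::comm_monoid_mult"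
  using movers_octet(2-4)[of p p'] by (simp add: movers_octet(1)[of p p'] mult.assoc)

context q_base
begin

text \<open>Stable under shifts and under duality, so it is imposed once, at \<open>n = 0\<close>.
  The products include \<open>U = V\<close> because \<open>a * (t U)\<^sup>2\<close> is the leading
  parameter of a series. For nonzero parameters it proves equivalent to
  \<open>nonsingular\<close>.\<close>

definition gen :: "complex \<Rightarrow> (nat \<Rightarrow> complex) \<Rightarrow> bool" where
  "gen a t \<longleftrightarrow> a \<noteq> 0 \<and> (\<forall>U<8. t U \<noteq> 0) \<and>
     (\<forall>U<8. \<forall>V<8. \<forall>n::int. a * t U * t V \<noteq> q powi n) \<and>
     (\<forall>U<8. \<forall>V<8. \<forall>n::int. U \<noteq> V \<longrightarrow> t U / t V \<noteq> q powi n)"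

lemma genD:
  assumes "gen a t"
  shows "a \<noteq> 0" "U < 8 \<Longrightarrow> t U \<noteq> 0" "U < 8 \<Longrightarrow> V < 8 \<Longrightarrow> a * t U * t V \<noteq> q powi n"
    "U < 8 \<Longrightarrow> V < 8 \<Longrightarrow> U \<noteq> V \<Longrightarrow> t U / t V \<noteq> q powi n"
  using assms by (auto simp: gen_def)

lemma notin_powers_shift:
  assumes "\<And>n::int. x \<noteq> q powi n" and "y = x * q powi m"
  shows "y \<noteq> q powi n"
proof
  assume "y = q powi n"
  hence "x = q powi (n - m)" using assms q_nz by (simp add: power_int_diff field_simps)
  thus False using assms by blast
qed

definition shift :: "nat \<Rightarrow> nat \<Rightarrow> int \<Rightarrow> (nat \<Rightarrow> complex) \<Rightarrow> nat \<Rightarrow> complex" where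
  "shift p p' n t = t(p := t p * q powi n, p' := t p' * q powi (- n))"

lemma shift_simps [simp]:
  "p \<noteq> p' \<Longrightarrow> shift p p' n t p = t p * q powi n"
  "shift p p' n t p' = t p' * q powi (- n)"
  "U \<noteq> p \<Longrightarrow> U \<noteq> p' \<Longrightarrow> shift p p' n t U = t U"
  by (auto simp: shift_def)

lemma shift_mid: "movers p p' \<Longrightarrow> m \<in> mids \<Longrightarrow> shift p p' n t m = t m"
  by (auto simp: shift_def movers_def mids_def)

lemma shift_shift: "p \<noteq> p' \<Longrightarrow> shift p p' m (shift p p' n t) = shift p p' (n + m) t"
  using q_nz by (auto simp: shift_def fun_eq_iff power_int_add power_int_diff power_int_minus divide_simps)

lemma shift_0 [simp]: "shift p p' 0 t = t"
  by (auto simp: shift_def)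

lemma shift_swap: "p \<noteq> p' \<Longrightarrow> shift p p' n t = shift p' p (- n) t"
  by (auto simp: shift_def fun_eq_iff)

lemma shift_cases: "\<exists>k::int. shift p p' n t U = t U * q powi k"
  by (cases "U = p'"; cases "U = p") (auto simp: shift_def intro: exI[of _ "0::int"])

lemma gen_shift:
  assumes "gen a t" shows "gen a (shift p p' n t)"
  unfolding gen_def
proof (intro conjI allI impI)
  show "a \<noteq> 0" using assms by (simp add: gen_def)
next
  fix U :: nat assume "U < 8"
  thus "shift p p' n t U \<noteq> 0" using assms q_nz by (auto simp: shift_def gen_def)
next
  fix U V :: nat and m :: int assume UV: "U < 8" "V < 8"
  obtain k l where kl: "shift p p' n t U = t U * q powi k" "shift p p' n t V = t V * q powi l"
    using shift_cases by metis
  show "a * shift p p' n t U * shift p p' n t V \<noteq> q powi m"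
    by (rule notin_powers_shift[OF genD(3)[OF assms UV], of _ "k + l"])
       (use q_nz in \<open>simp add: kl power_int_add\<close>)
  show "shift p p' n t U / shift p p' n t V \<noteq> q powi m" if "U \<noteq> V"
    by (rule notin_powers_shift[OF genD(4)[OF assms UV that], of _ "k - l"])
       (use q_nz in \<open>simp add: kl power_int_diff\<close>)
qed

text \<open>The function whose values at \<open>t T * q ^ k\<close> are the terms of the
  very-well-poised series with leading parameter \<open>a * (t T)\<^sup>2\<close>. Letting
  \<open>U\<close> run over all eight coordinates makes it independent of \<open>T\<close>: the
  factor \<open>U = T\<close> supplies the quotient of the leading parameter's factorial by
  \<open>(q)\<^sub>k\<close>.\<close>

definition fterm :: "complex \<Rightarrow> (nat \<Rightarrow> complex) \<Rightarrow> complex \<Rightarrow> complex" where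
  "fterm a t x = x * (1 - a * x\<^sup>2) * (\<Prod>U<8. qi (q * x / t U) / qi (a * x * t U))"

definition den :: "complex \<Rightarrow> (nat \<Rightarrow> complex) \<Rightarrow> nat \<Rightarrow> complex" where
  "den a t T = (\<Prod>U<8. qi (a * t T * t U))"

text \<open>The terms multiplied by \<open>den\<close>: infinite products in the denominator become
  finite ones in the numerator, so the sum makes sense also where \<open>fsum\<close> has a
  pole.\<close>

definition hterm :: "complex \<Rightarrow> (nat \<Rightarrow> complex) \<Rightarrow> nat \<Rightarrow> nat \<Rightarrow> complex" where
  "hterm a t T k = t T * q ^ k * (1 - a * (t T * q ^ k)\<^sup>2) *
     (\<Prod>U<8. qi (q * (t T * q ^ k) / t U) * qpoch q (a * t T * t U) k)"

definition hsum :: "complex \<Rightarrow> (nat \<Rightarrow> complex) \<Rightarrow> nat \<Rightarrow> complex" where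
  "hsum a t T = (\<Sum>k. hterm a t T k)"

definition fsum :: "complex \<Rightarrow> (nat \<Rightarrow> complex) \<Rightarrow> nat \<Rightarrow> complex" where
  "fsum a t T = (\<Sum>k. fterm a t (t T * q ^ k))"

definition hbound :: "complex \<Rightarrow> (nat \<Rightarrow> complex) \<Rightarrow> nat \<Rightarrow> real" where
  "hbound a t T = norm (t T) * (1 + norm a * norm (t T) ^ 2) *
     (\<Prod>U<8. qbound (norm (t T / t U)) * qbound (norm (a * t T * t U)))"

text \<open>An explicit majorant instead of mere summability: \<open>hbound\<close> is continuous in
  the parameters, which later gives locally uniform convergence on the torus.\<close>

lemma norm_hterm_le: "norm (hterm a t T k) \<le> norm q ^ k * hbound a t T"
proof -
  have qk: "norm (q ^ k) \<le> 1" "norm q ^ k \<le> 1" using q_lt1 by (simp_all add: norm_power power_le_one)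
  have "norm (1 - a * (t T * q ^ k)\<^sup>2) \<le> 1 + norm (a * (t T * q ^ k)\<^sup>2)"
    by (metis norm_one norm_triangle_ineq4)
  also have "norm (a * (t T * q ^ k)\<^sup>2) = norm a * norm (t T) ^ 2 * (norm q ^ k) ^ 2"
    by (simp add: norm_mult norm_power power_mult_distrib)
  also have "\<dots> \<le> norm a * norm (t T) ^ 2 * 1"
    using q_lt1 by (intro mult_left_mono power_le_one) auto
  finally have A: "norm (1 - a * (t T * q ^ k)\<^sup>2) \<le> 1 + norm a * norm (t T) ^ 2" by simp
  have B: "norm (\<Prod>U<8. qi (q * (t T * q ^ k) / t U) * qpoch q (a * t T * t U) k)
      \<le> (\<Prod>U<8. qbound (norm (t T / t U)) * qbound (norm (a * t T * t U)))"
    unfolding prod_norm[symmetric]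
  proof (rule prod_mono, safe)
    fix U :: nat
    have "norm (q * (t T * q ^ k) / t U) = norm q ^ Suc k * norm (t T / t U)"
      by (simp add: norm_mult norm_divide norm_power)
    also have "\<dots> \<le> 1 * norm (t T / t U)"
      using q_lt1 by (intro mult_right_mono power_le_one) (auto intro: less_imp_le)
    finally have "norm (qi (q * (t T * q ^ k) / t U)) \<le> qbound (norm (t T / t U))"
      using norm_qi_le qbound_mono by (metis mult_1 order_trans)
    thus "norm (qi (q * (t T * q ^ k) / t U) * qpoch q (a * t T * t U) k)
        \<le> qbound (norm (t T / t U)) * qbound (norm (a * t T * t U))"
      unfolding norm_mult[of "qi _"] by (intro mult_mono norm_qpoch_le) auto
  qed auto
  have "norm (hterm a t T k) \<le> (norm (t T) * norm q ^ k) * (1 + norm a * norm (t T) ^ 2) *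
     (\<Prod>U<8. qbound (norm (t T / t U)) * qbound (norm (a * t T * t U)))"
    unfolding hterm_def norm_mult[of "_ * _" "prod _ _"] norm_mult[of "_ * _" "1 - _"]
      norm_mult[of "t T" "q ^ k"] norm_power
    by (intro mult_mono A B order.refl) (auto intro!: mult_nonneg_nonneg add_nonneg_nonneg prod_nonneg)
  thus ?thesis by (simp add: hbound_def mult_ac)
qed

lemma summable_hterm: "summable (hterm a t T)"
proof (rule summable_comparison_test'[where N = 0])
  show "summable (\<lambda>k. norm q ^ k * hbound a t T)" by (intro summable_mult2 summable_norm_q_power)
qed (rule norm_hterm_le)

lemma den_nz:
  assumes "gen a t" "T < 8" shows "den a t T \<noteq> 0"
  unfolding den_def using genD(3)[OF assms(1,2)] by (auto intro!: qi_nz)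

lemma fterm_den:
  assumes "gen a t" "T < 8"
  shows "fterm a t (t T * q ^ k) = hterm a t T k / den a t T"
proof -
  have "qi (q * (t T * q ^ k) / t U) / qi (a * (t T * q ^ k) * t U) =
     qi (q * (t T * q ^ k) / t U) * qpoch q (a * t T * t U) k / qi (a * t T * t U)" if "U < 8" for U
  proof -
    have "a * (t T * q ^ k) * t U = (a * t T * t U) * q ^ k" by (simp add: mult_ac)
    moreover have "qpoch q (a * t T * t U) k \<noteq> 0"
      using genD(3)[OF assms that] by (rule qpoch_nz)
    ultimately show ?thesis using qi_split[of "a * t T * t U" k] by (simp only: mult.commute[of "qpoch q _ k"]) simp
  qed
  thus ?thesis unfolding fterm_def hterm_def den_def by (simp add: prod_dividef)
qed

lemma fterm_sums:
  assumes "gen a t" "T < 8"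
  shows "(\<lambda>k. fterm a t (t T * q ^ k)) sums fsum a t T"
  unfolding fsum_def fterm_den[OF assms] by (intro summable_sums summable_divide summable_hterm)

lemma fsum_den:
  assumes "gen a t" "T < 8"
  shows "fsum a t T = hsum a t T / den a t T"
  unfolding fsum_def fterm_den[OF assms] hsum_def by (rule suminf_divide[OF summable_hterm])

text \<open>Before the start of its progression the function vanishes, so progressions with
  different starts can be summed from a common earlier point.\<close>

lemma fterm_eq_0:
  assumes "U < 8" "t U \<noteq> 0" "x * q ^ Suc k = t U"
  shows "fterm a t x = 0"
proof -
  have "qi (q * x / t U) = 0"
    unfolding qi_eq_0_iff using assms by (intro exI[of _ k]) (simp add: field_simps)
  thus ?thesis unfolding fterm_def using assms by auto
qed

section \<open>The contiguous relation\<close>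

text \<open>Once the right-hand side \<open>lam\<close> is fixed, the polynomial identity forces
  \<open>rho\<close> at \<open>x = t p' / q\<close> and \<open>gam\<close> at
  \<open>x = t p / q\<close>, since only one term of the left side survives at each of these
  points.\<close>

definition rho :: "complex \<Rightarrow> (nat \<Rightarrow> complex) \<Rightarrow> nat \<Rightarrow> nat \<Rightarrow> complex" where
  "rho a t p p' = a * t p * t p' / q * (\<Prod>m\<in>mids. 1 - q / (a * t p' * t m)) /
     ((1 - t p / t p') * (1 - q * t p / t p'))"

definition gam :: "complex \<Rightarrow> (nat \<Rightarrow> complex) \<Rightarrow> nat \<Rightarrow> nat \<Rightarrow> complex" where
  "gam a t p p' = q\<^sup>2 / (a * t p * t p') * (\<Prod>m\<in>mids. 1 - a * t m * t p / q) /
     ((1 - t p / t p') * (1 - t p / (q * t p')))"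

definition lam :: "complex \<Rightarrow> (nat \<Rightarrow> complex) \<Rightarrow> nat \<Rightarrow> nat \<Rightarrow> complex" where
  "lam a t p p' = (q - a * t p * t p') / (a * t p')"

text \<open>The value forced at \<open>x = t 7\<close>. For \<open>t 7 = 1\<close> its three
  summands are \<open>A\<^sub>n\<close>, \<open>B\<^sub>n\<close> and the remaining summand of
  \<open>a\<^sub>n\<close>.\<close>

definition bet :: "complex \<Rightarrow> (nat \<Rightarrow> complex) \<Rightarrow> nat \<Rightarrow> nat \<Rightarrow> complex" where
  "bet a t p p' =
     (let x = t 7 in
      rho a t p p' * ((1 - x / t p) * (1 - a * x * t p)) / ((1 - q * x / t p') * (1 - a * x * t p' / q)) +
      gam a t p p' * ((1 - x / t p') * (1 - a * x * t p')) / ((1 - q * x / t p) * (1 - a * x * t p / q)) -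
      lam a t p p' * (\<Prod>m\<in>mids - {7}. 1 - a * x * t m) / (x * ((1 - q * x / t p) * (1 - q * x / t p'))))"

text \<open>Multiplied by a common quotient of infinite products, the polynomial identity reads
  \<open>G (q * x) - G x\<close>. The sum telescopes to the limit of \<open>G\<close> at 0, which is
  \<open>l\<close>, because \<open>G\<close> vanishes at the starting point of each of the eight
  progressions.\<close>

lemma contiguous_aux:
  assumes E: "\<And>x. x * (1 - a * x\<^sup>2) *
     (r * ((1 - x / t p) * (1 - a * x * t p) * (1 - q * x / t p) * (1 - a * x * t p / q)) -
      b * ((1 - q * x / t p) * (1 - a * x * t p / q) * (1 - q * x / t p') * (1 - a * x * t p' / q)) +
      g * ((1 - x / t p') * (1 - a * x * t p') * (1 - q * x / t p') * (1 - a * x * t p' / q))) =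
     l * ((\<Prod>m\<in>mids. 1 - a * x * t m) * (1 - a * x * t p / q) * (1 - a * x * t p' / q) -
          (\<Prod>m\<in>mids. 1 - x / t m) * (1 - q * x / t p) * (1 - q * x / t p'))"
    and gen: "gen a t" and pp: "movers p p'" and T: "T < 8"
  shows "r * fsum a (shift p p' 1 t) T - b * fsum a t T + g * fsum a (shift p p' (-1) t) T = l"
proof -
  note [simp] = q_nz movers_octet(4)[OF pp]
  have p8: "p < 8" "p' < 8" using pp by (auto dest: movers_octet)
  have nz [simp]: "t p \<noteq> 0" "t p' \<noteq> 0" "a \<noteq> 0" using genD[OF gen] p8 by auto
  define G where "G = (\<lambda>x. l * (\<Prod>m\<in>mids. qi (x / t m) / qi (a * x * t m)) *
     (qi (q * x / t p) * qi (q * x / t p') / (qi (a * x * t p / q) * qi (a * x * t p' / q))))"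
  have point: "r * fterm a (shift p p' 1 t) x - b * fterm a t x + g * fterm a (shift p p' (-1) t) x
      = G (q * x) - G x" if x: "\<And>U n. U < 8 \<Longrightarrow> a * x * t U \<noteq> q powi n" for x
  proof -
    define M where "M = (\<Prod>m\<in>mids. qi (q * x / t m) / qi (a * x * t m))"
    \<comment> \<open>The common factor of the three neighbouring functions and of
      \<open>G x\<close> and \<open>G (q * x)\<close>; the cofactors are the polynomials in the
      assumption \<open>E\<close>.\<close>
    define C where "C = M * (qi (q * (q * x / t p)) * qi (q * (q * x / t p')) / (qi (a * x * t p / q) * qi (a * x * t p' / q)))"
    have pm: "fterm a s x = x * (1 - a * x\<^sup>2) * (qi (q * x / s p) / qi (a * x * s p) * (qi (q * x / s p') / qi (a * x * s p')) * M)"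
      if "\<And>m. m \<in> mids \<Longrightarrow> s m = t m" for s
      unfolding fterm_def prod_octet[OF pp] M_def using that by simp
    have sm: "shift p p' n t m = t m" if "m \<in> mids" for m n
      using that movers_octet[OF pp] by (intro shift_simps) auto
    have ex: "a * x * t U \<noteq> 1" "a * x * t U / q \<noteq> 1" if "U < 8" for U
      using x[OF that, of 0] x[OF that, of 1] by (auto simp: field_simps)
    have d: "qi (a * x * t U / q) = (1 - a * x * t U / q) * ((1 - a * x * t U) * qi (q * (a * x * t U)))"
      if "U < 8" for U
      using qi_step[of "a * x * t U / q"] qi_step[of "a * x * t U"] by simp
    have d': "qi (a * x * t U) = (1 - a * x * t U) * qi (q * (a * x * t U))" for U
      by (rule qi_step)
    have n1: "qi (x / t U) = (1 - x / t U) * ((1 - q * x / t U) * qi (q * (q * x / t U)))"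
      "qi (q * x / t U) = (1 - q * x / t U) * qi (q * (q * x / t U))" for U
      using qi_step[of "x / t U"] qi_step[of "q * x / t U"] by simp_all
    have nzq: "qi (q * (a * x * t U)) \<noteq> 0" if "U < 8" for U
      by (rule qi_nz, rule notin_powers_shift[OF x[OF that], of _ 1]) simp
    have nzs: "1 - a * x * t U \<noteq> 0" "1 - a * x * t U / q \<noteq> 0" if "U < 8" for U
      using ex[OF that] by auto
    have f0: "fterm a t x = x * (1 - a * x\<^sup>2) * C * ((1 - q * x / t p) * (1 - a * x * t p / q) * (1 - q * x / t p') * (1 - a * x * t p' / q))"
      unfolding pm[OF refl] C_def d[OF p8(1)] d[OF p8(2)] d' n1(2)
      using nzs[OF p8(1)] nzs[OF p8(2)] nzq[OF p8(1)] nzq[OF p8(2)] by (simp add: divide_simps)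
    have frac: "X * ((A * (B * N1)) / Y * (N2 / D2) * M) = X * (M * (N1 * N2 / ((e2 * (e1 * Y)) * D2))) * (A * e1 * B * e2)"
      and frac': "X * (N2 / D2 * ((A * (B * N1)) / Y) * M) = X * (M * (N2 * N1 / (D2 * (e2 * (e1 * Y))))) * (A * e1 * B * e2)"
      if "e1 \<noteq> 0" "e2 \<noteq> 0" for X A B N1 N2 Y D2 e1 e2 M :: complex
      using that by simp_all
    have f1: "fterm a (shift p p' 1 t) x = x * (1 - a * x\<^sup>2) * C * ((1 - x / t p) * (1 - a * x * t p) * (1 - q * x / t p) * (1 - a * x * t p / q))"
    proof -
      have e: "q * x / (t p * q) = x / t p" "q * x / (t p' * inverse q) = q * (q * x / t p')"
        "a * x * (t p * q) = q * (a * x * t p)" "a * x * (t p' * inverse q) = a * x * t p' / q"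
        by (simp_all add: field_simps)
      have *: "fterm a (shift p p' 1 t) x = x * (1 - a * x\<^sup>2) * (qi (x / t p) / qi (q * (a * x * t p)) * (qi (q * (q * x / t p')) / qi (a * x * t p' / q)) * M)"
        by (subst pm[of "shift p p' 1 t", OF sm]) (auto simp: power_int_minus e)
      show ?thesis unfolding * C_def d[OF p8(1)] n1(1) by (rule frac[OF nzs[OF p8(1)]])
    qed
    have f2: "fterm a (shift p p' (-1) t) x = x * (1 - a * x\<^sup>2) * C * ((1 - x / t p') * (1 - a * x * t p') * (1 - q * x / t p') * (1 - a * x * t p' / q))"
    proof -
      have e: "q * x / (t p' * q) = x / t p'" "q * x / (t p * inverse q) = q * (q * x / t p)"
        "a * x * (t p' * q) = q * (a * x * t p')" "a * x * (t p * inverse q) = a * x * t p / q"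
        by (simp_all add: field_simps)
      have *: "fterm a (shift p p' (-1) t) x = x * (1 - a * x\<^sup>2) * (qi (q * (q * x / t p)) / qi (a * x * t p / q) * (qi (x / t p') / qi (q * (a * x * t p'))) * M)"
        by (subst pm[of "shift p p' (-1) t", OF sm]) (auto simp: power_int_minus e)
      show ?thesis unfolding * C_def d[OF p8(2)] n1(1) by (subst frac'[OF nzs[OF p8(2)]]) (rule refl)
    qed
    have G1: "G x = l * C * ((\<Prod>m\<in>mids. 1 - x / t m) * (1 - q * x / t p) * (1 - q * x / t p'))"
    proof -
      have "(\<Prod>m\<in>mids. qi (x / t m) / qi (a * x * t m)) = (\<Prod>m\<in>mids. (1 - x / t m) * (qi (q * x / t m) / qi (a * x * t m)))"
        by (intro prod.cong refl) (simp add: qi_step[of "x / t _"])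
      hence "(\<Prod>m\<in>mids. qi (x / t m) / qi (a * x * t m)) = (\<Prod>m\<in>mids. 1 - x / t m) * M"
        by (simp only: prod.distrib M_def)
      thus ?thesis unfolding G_def C_def n1(2) by (simp add: mult_ac)
    qed
    have G2: "G (q * x) = l * C * ((\<Prod>m\<in>mids. 1 - a * x * t m) * (1 - a * x * t p / q) * (1 - a * x * t p' / q))"
    proof -
      have "(\<Prod>m\<in>mids. qi (q * x / t m) / qi (a * (q * x) * t m)) = (\<Prod>m\<in>mids. (1 - a * x * t m) * (qi (q * x / t m) / qi (a * x * t m)))"
      proof (intro prod.cong refl)
        fix m assume "m \<in> mids"
        hence "m < 8" by (rule mids_less)
        have e: "a * (q * x) * t m = q * (a * x * t m)" by (simp only: mult_ac)
        show "qi (q * x / t m) / qi (a * (q * x) * t m) = (1 - a * x * t m) * (qi (q * x / t m) / qi (a * x * t m))"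
          unfolding e d'[of m] using nzs[OF \<open>m < 8\<close>] by simp
      qed
      hence 1: "(\<Prod>m\<in>mids. qi (q * x / t m) / qi (a * (q * x) * t m)) = (\<Prod>m\<in>mids. 1 - a * x * t m) * M"
        by (simp only: prod.distrib M_def)
      have 2: "qi (a * (q * x) * t U / q) = qi (a * x * t U)" for U by (simp add: mult_ac)
      have 3: "qi (a * x * t U / q) = (1 - a * x * t U / q) * qi (a * x * t U)" for U
        using qi_step[of "a * x * t U / q"] by simp
      have 4: "qi (a * x * t U) \<noteq> 0" if "U < 8" for U using x[OF that] by (rule qi_nz)
      show ?thesis unfolding G_def C_def 1 2 3
        using nzs[OF p8(1)] nzs[OF p8(2)] 4[OF p8(1)] 4[OF p8(2)] by (simp add: divide_simps)
    qed
    have "r * fterm a (shift p p' 1 t) x - b * fterm a t x + g * fterm a (shift p p' (-1) t) x =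
      C * (x * (1 - a * x\<^sup>2) *
     (r * ((1 - x / t p) * (1 - a * x * t p) * (1 - q * x / t p) * (1 - a * x * t p / q)) -
      b * ((1 - q * x / t p) * (1 - a * x * t p / q) * (1 - q * x / t p') * (1 - a * x * t p' / q)) +
      g * ((1 - x / t p') * (1 - a * x * t p') * (1 - q * x / t p') * (1 - a * x * t p' / q))))"
      unfolding f0 f1 f2 by (simp only: ring_distribs mult_ac)
    also have "\<dots> = G (q * x) - G x"
      unfolding E G1 G2 by (simp only: ring_distribs mult_ac)
    finally show ?thesis .
  qed
  \<comment> \<open>For a mover the three neighbouring progressions start at \<open>t T / q\<close>,
    \<open>t T\<close> and \<open>t T * q\<close>. The earliest start serves all three, since the
    extra terms are zero; below, \<open>k\<close> counts these extra terms.\<close>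
  define \<tau> where "\<tau> = (if T \<in> mids then t T else t T / q)"
  have \<tau>_mid: "\<tau> = t T" if "T \<in> mids" using that by (simp add: \<tau>_def)
  have \<tau>_p: "\<tau> * q = t T" if "T \<notin> mids" using that by (simp add: \<tau>_def)
  have Tc: "T \<in> mids \<or> T = p \<or> T = p'" using T movers_octet(1)[OF pp] by auto
  have sums: "(\<lambda>j. fterm a (shift p p' n t) (\<tau> * q ^ j)) sums fsum a (shift p p' n t) T"
    if n: "n \<in> {-1, 0, 1}" for n
  proof -
    have g: "gen a (shift p p' n t)" by (rule gen_shift[OF gen])
    note S = fterm_sums[OF g T]
    define k where "k = (if T \<in> mids then 0 else if T = p then nat (n + 1) else nat (1 - n))"
    have sT: "shift p p' n t T = \<tau> * q ^ k"
      using n Tc movers_octet(2,3)[OF pp]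
      by (auto simp: k_def shift_mid[OF pp] \<tau>_def power_int_minus power2_eq_square numeral_eq_Suc field_simps)
    have "(\<lambda>j. fterm a (shift p p' n t) (\<tau> * q ^ (j + k))) sums fsum a (shift p p' n t) T"
      using S by (simp add: sT power_add mult_ac)
    moreover have "fterm a (shift p p' n t) (\<tau> * q ^ j) = 0" if "j < k" for j
    proof (rule fterm_eq_0[OF T])
      show "shift p p' n t T \<noteq> 0" using genD(2)[OF g T] .
      show "\<tau> * q ^ j * q ^ Suc (k - Suc j) = shift p p' n t T"
        using that by (simp add: sT power_add[symmetric] mult.assoc del: power_Suc)
    qed
    hence "(\<Sum>j<k. fterm a (shift p p' n t) (\<tau> * q ^ j)) = 0" by simp
    ultimately show ?thesis using sums_iff_shift[of "\<lambda>j. fterm a (shift p p' n t) (\<tau> * q ^ j)" k] by simp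
  qed
  have "(\<lambda>j. r * fterm a (shift p p' 1 t) (\<tau> * q ^ j) - b * fterm a (shift p p' 0 t) (\<tau> * q ^ j)
      + g * fterm a (shift p p' (-1) t) (\<tau> * q ^ j)) sums
    (r * fsum a (shift p p' 1 t) T - b * fsum a (shift p p' 0 t) T + g * fsum a (shift p p' (-1) t) T)"
    by (intro sums_add sums_diff sums_mult sums) auto
  moreover have "r * fterm a (shift p p' 1 t) (\<tau> * q ^ j) - b * fterm a (shift p p' 0 t) (\<tau> * q ^ j)
      + g * fterm a (shift p p' (-1) t) (\<tau> * q ^ j) = G (\<tau> * q ^ Suc j) - G (\<tau> * q ^ j)" for j
  proof -
    have "a * (\<tau> * q ^ j) * t U \<noteq> q powi n" if U: "U < 8" for U n
      by (rule notin_powers_shift[OF genD(3)[OF gen T U], of _ "if T \<in> mids then int j else int j - 1"])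
         (simp add: \<tau>_def power_int_diff)
    from point[OF this] show ?thesis by (simp add: mult_ac)
  qed
  ultimately have "(\<lambda>j. G (\<tau> * q ^ Suc j) - G (\<tau> * q ^ j)) sums
    (r * fsum a (shift p p' 1 t) T - b * fsum a t T + g * fsum a (shift p p' (-1) t) T)" by simp
  moreover have "(\<lambda>j. G (\<tau> * q ^ Suc j) - G (\<tau> * q ^ j)) sums (l - G (\<tau> * q ^ 0))"
  proof (rule telescope_sums)
    have 1: "(\<lambda>j. qi (c * (\<tau> * q ^ j))) \<longlonglongrightarrow> 1" for c
      using tendsto_qi_1[of "c * \<tau>"] by (simp add: mult_ac)
    have 2: "(\<lambda>j. qi (\<tau> * q ^ j / c)) \<longlonglongrightarrow> 1" for c
      using 1[of "1 / c"] by simp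
    have 3: "(\<lambda>j. qi (a * (\<tau> * q ^ j) * c)) \<longlonglongrightarrow> 1" for c
      using 1[of "a * c"] by (simp add: mult_ac)
    have 4: "(\<lambda>j. qi (a * (\<tau> * q ^ j) * c / q)) \<longlonglongrightarrow> 1" for c
      using 1[of "a * c / q"] by (simp add: mult_ac)
    have 5: "(\<lambda>j. qi (q * (\<tau> * q ^ j) / c)) \<longlonglongrightarrow> 1" for c
      using 1[of "q / c"] by (simp add: mult_ac)
    have "(\<lambda>j. G (\<tau> * q ^ j)) \<longlonglongrightarrow> l * (\<Prod>m\<in>mids. 1 / 1) * (1 * 1 / (1 * 1))"
      unfolding G_def by (intro tendsto_intros 2 3 4 5) auto
    thus "(\<lambda>j. G (\<tau> * q ^ j)) \<longlonglongrightarrow> l" by simp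
  qed
  \<comment> \<open>For a fixed \<open>T\<close> the factor \<open>qi (\<tau> / t T)\<close> is
    \<open>qi 1\<close>; for a mover the factor \<open>qi (q * \<tau> / t T)\<close> is.\<close>
  moreover have "G (\<tau> * q ^ 0) = 0"
  proof (cases "T \<in> mids")
    case True
    hence "t T \<noteq> 0" using genD[OF gen] T by auto
    hence "(\<Prod>m\<in>mids. qi (\<tau> / t m) / qi (a * \<tau> * t m)) = 0"
      using True by (auto intro!: bexI[of _ T] simp: \<tau>_mid)
    thus ?thesis by (simp add: G_def)
  next
    case False
    hence "q * \<tau> = t T" using \<tau>_p by (simp add: mult.commute)
    thus ?thesis using Tc False by (auto simp: G_def)
  qed
  ultimately show ?thesis by (simp add: sums_iff)
qed

end

section \<open>The polynomial identity behind the contiguous relation\<close>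

lemma prod_homogeneous_expansion:
  fixes y :: "nat \<Rightarrow> complex"
  shows "\<exists>c. c 0 = 1 \<and> (\<forall>w x. (\<Prod>U<n. w - x * y U) = (\<Sum>k\<le>n. c k * x ^ k * w ^ (n - k)))"
proof (induction n)
  case 0
  show ?case by (intro exI[of _ "\<lambda>_. 1"]) auto
next
  case (Suc n)
  then obtain c where c: "c 0 = 1" "\<And>w x. (\<Prod>U<n. w - x * y U) = (\<Sum>k\<le>n. c k * x ^ k * w ^ (n - k))"
    by blast
  define c' where "c' = (\<lambda>k. (if k \<le> n then c k else 0) - (if k = 0 then 0 else c (k - 1) * y n))"
  have "(\<Prod>U<Suc n. w - x * y U) = (\<Sum>k\<le>Suc n. c' k * x ^ k * w ^ (Suc n - k))" for w x
  proof -
    have "(\<Sum>k\<le>Suc n. c' k * x ^ k * w ^ (Suc n - k)) =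
        (\<Sum>k\<le>Suc n. (if k \<le> n then c k else 0) * x ^ k * w ^ (Suc n - k)) -
        (\<Sum>k\<le>Suc n. (if k = 0 then 0 else c (k - 1) * y n) * x ^ k * w ^ (Suc n - k))"
      by (simp only: c'_def left_diff_distrib sum_subtractf)
    also have "(\<Sum>k\<le>Suc n. (if k \<le> n then c k else 0) * x ^ k * w ^ (Suc n - k)) =
        (\<Sum>k\<le>n. c k * x ^ k * w ^ (n - k)) * w"
      by (simp add: sum_distrib_left Suc_diff_le mult_ac)
    also have "(\<Sum>k\<le>Suc n. (if k = 0 then 0 else c (k - 1) * y n) * x ^ k * w ^ (Suc n - k)) =
        (\<Sum>k\<le>n. c k * x ^ k * w ^ (n - k)) * (x * y n)"
      by (subst sum.atMost_Suc_shift) (simp add: sum_distrib_left mult_ac)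
    finally show ?thesis by (simp add: c(2) algebra_simps)
  qed
  moreover have "c' 0 = 1" using c by (simp add: c'_def)
  ultimately show ?case by blast
qed

text \<open>Under the balancing condition the two products are exchanged by \<open>x \<mapsto> 1 / (a x)\<close>.\<close>

lemma balanced_difference:
  fixes y :: "nat \<Rightarrow> complex"
  assumes y: "(\<Prod>U<8. y U) = a ^ 4" and a: "a \<noteq> 0"
  shows "\<exists>g1 g2 g3. \<forall>x. (\<Prod>U<8. 1 - x * y U) - (\<Prod>U<8. 1 - a * x / y U) =
    x * (1 - a * x\<^sup>2) * (g1 * (1 + a * x\<^sup>2 + a\<^sup>2 * x ^ 4) + g2 * (x + a * x ^ 3) + g3 * x\<^sup>2)"
proof -
  \<comment> \<open>One coefficient sequence expands both products: the pair \<open>(1, x)\<close>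
    for \<open>(w, x)\<close> gives the first, and \<open>(a * x, 1)\<close> gives the second with
    the order of the coefficients reversed.\<close>
  obtain c where c0: "c 0 = 1" and c: "\<And>w x. (\<Prod>U<8. w - x * y U) = (\<Sum>k\<le>8. c k * x ^ k * w ^ (8 - k))"
    using prod_homogeneous_expansion[where n = 8 and y = y] by blast
  have ynz: "y U \<noteq> 0" if "U < 8" for U
    using y a that by (metis (no_types, lifting) finite_lessThan lessThan_iff power_not_zero prod_zero)
  \<comment> \<open>With \<open>c 0 = 1\<close> and \<open>c 8 = a ^ 4\<close> the extreme terms of
    the two expansions cancel in the difference; the terms of degree 4 are equal anyway.\<close>
  have "c 8 = (\<Prod>U<8. - y U)"
    using c[of 0 1] by (simp add: eval_nat_numeral)
  also have "\<dots> = a ^ 4" unfolding y[symmetric] by (simp add: eval_nat_numeral)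
  finally have c8: "c 8 = a ^ 4" .
  have "(\<Prod>U<8. 1 - x * y U) - (\<Prod>U<8. 1 - a * x / y U) =
    x * (1 - a * x\<^sup>2) * ((c 1 - c 7 / a ^ 3) * (1 + a * x\<^sup>2 + a\<^sup>2 * x ^ 4)
      + (c 2 - c 6 / a\<^sup>2) * (x + a * x ^ 3) + (c 3 - c 5 / a) * x\<^sup>2)" for x
  proof -
    have "(\<Prod>U<8. 1 - a * x / y U) = (\<Prod>U<8. (a * x - 1 * y U) / (- y U))"
      by (intro prod.cong) (auto simp: ynz field_simps)
    also have "\<dots> = (\<Prod>U<8. a * x - 1 * y U) / a ^ 4"
      unfolding prod_dividef y[symmetric] by (simp add: eval_nat_numeral)
    also have "\<dots> = (\<Sum>k\<le>8. c k * (a * x) ^ (8 - k)) / a ^ 4"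
      by (subst c) simp
    finally have R: "(\<Prod>U<8. 1 - a * x / y U) = (\<Sum>k\<le>8. c k * (a * x) ^ (8 - k)) / a ^ 4" .
    have L: "(\<Prod>U<8. 1 - x * y U) = (\<Sum>k\<le>8. c k * x ^ k)"
      by (subst c) simp
    have exp: "(\<Sum>k\<le>8. f k) = f 0 + f 1 + f 2 + f 3 + f 4 + f 5 + f 6 + f 7 + f 8" for f :: "nat \<Rightarrow> complex"
      by (simp add: eval_nat_numeral)
    show ?thesis unfolding R L exp using a
      by (simp add: c0 c8 field_simps power_mult_distrib) (simp add: algebra_simps eval_nat_numeral)
  qed
  thus ?thesis by blast
qed

lemma quadratic_eq_0:
  fixes A B C :: complex
  assumes "A * x\<^sup>2 + B * x + C = 0" "A * y\<^sup>2 + B * y + C = 0" "A * z\<^sup>2 + B * z + C = 0"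
    "x \<noteq> y" "x \<noteq> z" "y \<noteq> z"
  shows "A * w\<^sup>2 + B * w + C = 0"
proof -
  have "(x - y) * (A * (x + y) + B) = (A * x\<^sup>2 + B * x + C) - (A * y\<^sup>2 + B * y + C)"
    by (simp add: algebra_simps power2_eq_square)
  hence "(x - y) * (A * (x + y) + B) = 0" unfolding assms(1,2) by simp
  hence 1: "A * (x + y) + B = 0" using assms by simp
  have "(x - z) * (A * (x + z) + B) = (A * x\<^sup>2 + B * x + C) - (A * z\<^sup>2 + B * z + C)"
    by (simp add: algebra_simps power2_eq_square)
  hence "(x - z) * (A * (x + z) + B) = 0" unfolding assms(1,3) by simp
  hence 2: "A * (x + z) + B = 0" using assms by simp
  have "A * (y - z) = (A * (x + y) + B) - (A * (x + z) + B)" by (simp add: algebra_simps)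
  hence "A * (y - z) = 0" unfolding 1 2 by simp
  hence "A = 0" using assms by simp
  thus ?thesis using 1 assms(1) by simp
qed

context q_base
begin

definition balanced :: "complex \<Rightarrow> (nat \<Rightarrow> complex) \<Rightarrow> bool" where
  "balanced a t \<longleftrightarrow> a ^ 4 * (\<Prod>U<8. t U) = q\<^sup>2"

lemma balanced_shift: "movers p p' \<Longrightarrow> balanced a (shift p p' n t) = balanced a t"
  using q_nz by (simp add: balanced_def prod_octet shift_mid movers_octet power_int_minus field_simps)

text \<open>By \<open>balanced_difference\<close> the two sides differ by
  \<open>x ^ 3 * (1 - a * x\<^sup>2)\<close> times a quadratic in
  \<open>\<sigma> x = 1 / x + a * x\<close>, which is invariant under exchanging \<open>x\<close>
  with \<open>1 / (a * x)\<close>. The quadratic is zero because it vanishes at three points with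
  different values of \<open>\<sigma>\<close>; these are the points that define the
  coefficients.\<close>

lemma contiguous_polynomial_identity:
  assumes gen: "gen a t" and bal: "balanced a t" and pp: "movers p p'"
  shows "x * (1 - a * x\<^sup>2) *
     (rho a t p p' * ((1 - x / t p) * (1 - a * x * t p) * (1 - q * x / t p) * (1 - a * x * t p / q)) -
      bet a t p p' * ((1 - q * x / t p) * (1 - a * x * t p / q) * (1 - q * x / t p') * (1 - a * x * t p' / q)) +
      gam a t p p' * ((1 - x / t p') * (1 - a * x * t p') * (1 - q * x / t p') * (1 - a * x * t p' / q))) =
     lam a t p p' * ((\<Prod>m\<in>mids. 1 - a * x * t m) * (1 - a * x * t p / q) * (1 - a * x * t p' / q) -
          (\<Prod>m\<in>mids. 1 - x / t m) * (1 - q * x / t p) * (1 - q * x / t p'))"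
proof -
  have p8: "p < 8" "p' < 8" "p \<noteq> p'" "7 < (8::nat)" "p \<noteq> 7" "p' \<noteq> 7" using pp by (auto simp: movers_def)
  have nz [simp]: "t p \<noteq> 0" "t p' \<noteq> 0" "a \<noteq> 0" "q \<noteq> 0" "t 7 \<noteq> 0" using genD[OF gen] p8 q_nz by auto
  define z where "z = a * t p * t p'"
  define r b g l where "r = rho a t p p'" and "b = bet a t p p'" and "g = gam a t p p'" and "l = lam a t p p'"
  define Br where "Br = (\<lambda>x. (\<Prod>m\<in>mids. 1 - a * x * t m) * (1 - a * x * t p / q) * (1 - a * x * t p' / q) -
          (\<Prod>m\<in>mids. 1 - x / t m) * (1 - q * x / t p) * (1 - q * x / t p'))"
  define Lf where "Lf = (\<lambda>x. r * ((1 - x / t p) * (1 - a * x * t p) * (1 - q * x / t p) * (1 - a * x * t p / q)) -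
      b * ((1 - q * x / t p) * (1 - a * x * t p / q) * (1 - q * x / t p') * (1 - a * x * t p' / q)) +
      g * ((1 - x / t p') * (1 - a * x * t p') * (1 - q * x / t p') * (1 - a * x * t p' / q)))"
  \<comment> \<open>Dividing by \<open>q\<close> at the two movers converts the balancing condition,
    whose right side is \<open>q\<^sup>2\<close>, into the hypothesis of
    \<open>balanced_difference\<close>.\<close>
  define y where "y = (\<lambda>U. if U \<in> mids then a * t U else a * t U / q)"
  have ym: "y m = a * t m" if "m \<in> mids" for m using that by (simp add: y_def)
  have yp: "y p = a * t p / q" "y p' = a * t p' / q" using pp movers_octet[OF pp] by (auto simp: y_def)
  have card: "card mids = 6" by (simp add: mids_def)
  have pm: "(\<Prod>m\<in>mids. a * t m) = a ^ 6 * (\<Prod>m\<in>mids. t m)" by (simp add: prod.distrib card)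
  have "(\<Prod>U<8. y U) = a ^ 8 * (\<Prod>U<8. t U) / q\<^sup>2"
  proof -
    have "a ^ 8 = a ^ 6 * a\<^sup>2" by (simp flip: power_add)
    moreover have "(\<Prod>m\<in>mids. y m) = (\<Prod>m\<in>mids. a * t m)" by (intro prod.cong refl ym)
    ultimately show ?thesis unfolding prod_octet[OF pp] yp by (simp add: pm power2_eq_square)
  qed
  also have "\<dots> = a ^ 4 * (a ^ 4 * (\<Prod>U<8. t U)) / q\<^sup>2" by (simp flip: power_add mult.assoc)
  also have "\<dots> = a ^ 4" using bal by (simp add: balanced_def)
  finally have "(\<Prod>U<8. y U) = a ^ 4" .
  from balanced_difference[OF this nz(3)] obtain g1 g2 g3 where
    G: "\<And>x. (\<Prod>U<8. 1 - x * y U) - (\<Prod>U<8. 1 - a * x / y U) =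
    x * (1 - a * x\<^sup>2) * (g1 * (1 + a * x\<^sup>2 + a\<^sup>2 * x ^ 4) + g2 * (x + a * x ^ 3) + g3 * x\<^sup>2)" by blast
  have Br: "Br x = x * (1 - a * x\<^sup>2) * (g1 * (1 + a * x\<^sup>2 + a\<^sup>2 * x ^ 4) + g2 * (x + a * x ^ 3) + g3 * x\<^sup>2)" for x
    unfolding G[symmetric] prod_octet[OF pp] Br_def using nz by (simp add: ym yp mult_ac)
  define \<sigma> where "\<sigma> = (\<lambda>x. (1 + a * x\<^sup>2) / x)"
  define A where "A = r - b + g - l * g1"
  define B where "B = - r * (\<sigma> (t p) + \<sigma> (t p / q)) + b * (\<sigma> (t p / q) + \<sigma> (t p' / q)) - g * (\<sigma> (t p') + \<sigma> (t p' / q)) - l * g2"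
  define C where "C = r * \<sigma> (t p) * \<sigma> (t p / q) - b * \<sigma> (t p / q) * \<sigma> (t p' / q) + g * \<sigma> (t p') * \<sigma> (t p' / q) + l * (a * g1 - g3)"
  have lin: "(1 - x / s) * (1 - a * x * s) = x * (\<sigma> x - \<sigma> s)" if "x \<noteq> 0" "s \<noteq> 0" for x s
    using that by (simp add: \<sigma>_def field_simps power2_eq_square)
  have key: "Lf x * (x * (1 - a * x\<^sup>2)) - l * Br x = x * (1 - a * x\<^sup>2) * (x\<^sup>2 * (A * (\<sigma> x)\<^sup>2 + B * \<sigma> x + C))"
    if x: "x \<noteq> 0" for x
  proof -
    have l1: "(1 - q * x / t U) * (1 - a * x * t U / q) = x * (\<sigma> x - \<sigma> (t U / q))" if "t U \<noteq> 0" for U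
      using lin[OF x, of "t U / q"] that by (simp add: mult_ac)
    have Lf: "Lf x = x\<^sup>2 * (r * ((\<sigma> x - \<sigma> (t p)) * (\<sigma> x - \<sigma> (t p / q)))
       - b * ((\<sigma> x - \<sigma> (t p / q)) * (\<sigma> x - \<sigma> (t p' / q))) + g * ((\<sigma> x - \<sigma> (t p')) * (\<sigma> x - \<sigma> (t p' / q))))"
    proof -
      have "Lf x = r * (((1 - x / t p) * (1 - a * x * t p)) * ((1 - q * x / t p) * (1 - a * x * t p / q))) -
      b * (((1 - q * x / t p) * (1 - a * x * t p / q)) * ((1 - q * x / t p') * (1 - a * x * t p' / q))) +
      g * (((1 - x / t p') * (1 - a * x * t p')) * ((1 - q * x / t p') * (1 - a * x * t p' / q)))"
        by (simp only: Lf_def mult.assoc)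
      thus ?thesis by (simp only: l1[OF nz(1)] l1[OF nz(2)] lin[OF x nz(1)] lin[OF x nz(2)]) (simp add: algebra_simps power2_eq_square)
    qed
    have "g1 * (1 + a * x\<^sup>2 + a\<^sup>2 * x ^ 4) + g2 * (x + a * x ^ 3) + g3 * x\<^sup>2 = x\<^sup>2 * (g1 * ((\<sigma> x)\<^sup>2 - a) + g2 * \<sigma> x + g3)"
      using x by (simp add: \<sigma>_def field_simps power2_eq_square eval_nat_numeral)
    hence Br': "Br x = x * (1 - a * x\<^sup>2) * (x\<^sup>2 * (g1 * ((\<sigma> x)\<^sup>2 - a) + g2 * \<sigma> x + g3))"
      unfolding Br by simp
    show ?thesis unfolding Lf Br' A_def B_def C_def by (simp add: algebra_simps power2_eq_square)
  qed
  have zero: "A * (\<sigma> x)\<^sup>2 + B * \<sigma> x + C = 0"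
    if "x \<noteq> 0" "1 - a * x\<^sup>2 \<noteq> 0" "Lf x * (x * (1 - a * x\<^sup>2)) = l * Br x" for x
    using key[OF that(1)] that by simp
  have z1: "z \<noteq> q" "z \<noteq> q\<^sup>2" using genD(3)[OF gen p8(1,2), of 1] genD(3)[OF gen p8(1,2), of 2]
    by (auto simp: z_def)
  have u1: "t p \<noteq> t p'" "q * t p \<noteq> t p'" "t p \<noteq> q * t p'"
    using genD(4)[OF gen p8(1-3), of 0] genD(4)[OF gen p8(1-3), of "-1"] genD(4)[OF gen p8(1-3), of 1]
    by (auto simp: power_int_minus field_simps)
  have sq: "1 - a * (t U / q)\<^sup>2 \<noteq> 0" if "U < 8" for U
    using genD(3)[OF gen that that, of 2] by (auto simp: field_simps power2_eq_square)
  have sq7: "1 - a * (t 7)\<^sup>2 \<noteq> 0"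
    using genD(3)[OF gen p8(4) p8(4), of 0] by (auto simp: field_simps power2_eq_square)
  have \<sigma>_neq: "\<sigma> x \<noteq> \<sigma> y" if "x \<noteq> 0" "y \<noteq> 0" "x \<noteq> y" "a * x * y \<noteq> 1" for x y
  proof
    assume "\<sigma> x = \<sigma> y"
    hence "(x - y) * (a * x * y - 1) = 0"
      using that(1,2) by (simp add: \<sigma>_def field_simps power2_eq_square)
    thus False using that by simp
  qed
  have regroup: "L * (c * j) = l * B" if "L = X * k" "B = W * k * j" "X * c = l * W" for L X k B W c j
  proof -
    have "L * (c * j) = (X * c) * (k * j)" unfolding that(1) by (simp only: mult_ac)
    thus ?thesis unfolding that by (simp only: mult_ac)
  qed
  \<comment> \<open>At \<open>x = t p' / q\<close> every term with the factor
    \<open>1 - q * x / t p'\<close> disappears, on both sides; the remaining equation is the one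
    that determines \<open>rho\<close>. \<open>P2\<close> is the same for
    \<open>gam\<close>.\<close>
  have P1: "A * (\<sigma> (t p' / q))\<^sup>2 + B * \<sigma> (t p' / q) + C = 0"
  proof (rule zero[OF _ sq[OF p8(2)]])
    define W where "W = (\<Prod>m\<in>mids. 1 - a * (t p' / q) * t m)"
    have "(\<Prod>m\<in>mids. 1 - q / (a * t p' * t m)) = (\<Prod>m\<in>mids. (1 - a * (t p' / q) * t m) / (- (a * t p' / q) * t m))"
      using genD(2)[OF gen mids_less] by (intro prod.cong refl) (auto simp: field_simps)
    also have "\<dots> = W / ((a * t p' / q) ^ 6 * (\<Prod>m\<in>mids. t m))"
      unfolding prod_dividef W_def prod.distrib by (simp add: card)
    also have "(\<Prod>m\<in>mids. t m) = q\<^sup>2 / (a ^ 4 * t p * t p')"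
      using bal by (simp add: balanced_def prod_octet[OF pp] field_simps)
    finally have W: "(\<Prod>m\<in>mids. 1 - q / (a * t p' * t m)) = W / ((a * t p' / q) ^ 6 * (q\<^sup>2 / (a ^ 4 * t p * t p')))" .
    have r: "r * ((1 - t p' / (q * t p)) * (1 - z / q) * (1 - t p' / t p)) * (t p' / q) = l * W"
      unfolding r_def rho_def W l_def lam_def z_def using u1
      by (simp add: divide_simps) (simp add: algebra_simps eval_nat_numeral)
    have "Lf (t p' / q) = r * ((1 - t p' / (q * t p)) * (1 - z / q) * (1 - t p' / t p)) * (1 - z / q\<^sup>2)"
      unfolding Lf_def z_def by (simp add: field_simps power2_eq_square)
    moreover have "Br (t p' / q) = W * (1 - z / q\<^sup>2) * (1 - a * (t p' / q)\<^sup>2)"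
      unfolding Br_def W_def z_def by (simp add: field_simps power2_eq_square)
    ultimately show "Lf (t p' / q) * (t p' / q * (1 - a * (t p' / q)\<^sup>2)) = l * Br (t p' / q)"
      using r by (rule regroup)
  qed auto
  have P2: "A * (\<sigma> (t p / q))\<^sup>2 + B * \<sigma> (t p / q) + C = 0"
  proof (rule zero[OF _ sq[OF p8(1)]])
    define W where "W = (\<Prod>m\<in>mids. 1 - a * (t p / q) * t m)"
    have W: "(\<Prod>m\<in>mids. 1 - a * t m * t p / q) = W"
      unfolding W_def by (simp add: mult_ac)
    have r: "g * ((1 - t p / (q * t p')) * (1 - z / q) * (1 - t p / t p')) * (t p / q) = l * W"
      unfolding g_def gam_def W l_def lam_def z_def using u1
      by (simp add: divide_simps) (simp add: algebra_simps eval_nat_numeral)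
    have "Lf (t p / q) = g * ((1 - t p / (q * t p')) * (1 - z / q) * (1 - t p / t p')) * (1 - z / q\<^sup>2)"
      unfolding Lf_def z_def by (simp add: field_simps power2_eq_square)
    moreover have "Br (t p / q) = W * (1 - z / q\<^sup>2) * (1 - a * (t p / q)\<^sup>2)"
      unfolding Br_def W_def z_def by (simp add: field_simps power2_eq_square)
    ultimately show "Lf (t p / q) * (t p / q * (1 - a * (t p / q)\<^sup>2)) = l * Br (t p / q)"
      using r by (rule regroup)
  qed auto
  have ne: "q * t 7 \<noteq> t p" "q * t 7 \<noteq> t p'" "a * t 7 * t p \<noteq> q" "a * t 7 * t p' \<noteq> q"
    using genD(4)[OF gen p8(1,4,5), of 1] genD(4)[OF gen p8(2,4,6), of 1]
      genD(3)[OF gen p8(4,1), of 1] genD(3)[OF gen p8(4,2), of 1]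
    by (auto simp: field_simps)
  have P3: "A * (\<sigma> (t 7))\<^sup>2 + B * \<sigma> (t 7) + C = 0"
  proof (rule zero[OF _ sq7])
    have m7: "7 \<in> mids" by (simp add: mids_def)
    define V where "V = (\<Prod>m\<in>mids - {7}. 1 - a * t 7 * t m)"
    define c1 c2 c3 c4 where "c1 = 1 - q * t 7 / t p" and "c2 = 1 - a * t 7 * t p / q"
      and "c3 = 1 - q * t 7 / t p'" and "c4 = 1 - a * t 7 * t p' / q"
    define d1 d2 where "d1 = (1 - t 7 / t p) * (1 - a * t 7 * t p)" and "d2 = (1 - t 7 / t p') * (1 - a * t 7 * t p')"
    have c: "c1 \<noteq> 0" "c2 \<noteq> 0" "c3 \<noteq> 0" "c4 \<noteq> 0"
      using ne by (auto simp: c1_def c2_def c3_def c4_def field_simps)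
    have b: "b = r * d1 / (c3 * c4) + g * d2 / (c1 * c2) - l * V / (t 7 * (c1 * c3))"
      unfolding b_def bet_def Let_def r_def g_def l_def V_def c1_def c2_def c3_def c4_def d1_def d2_def ..
    have "Lf (t 7) = r * (d1 * c1 * c2) - b * (c1 * c2 * c3 * c4) + g * (d2 * c3 * c4)"
      by (simp only: Lf_def c1_def c2_def c3_def c4_def d1_def d2_def mult.assoc)
    also have "\<dots> = l * V * c2 * c4 / t 7"
      unfolding b using c by (simp add: field_simps)
    finally have "Lf (t 7) = l * V * c2 * c4 / t 7" .
    moreover have "Br (t 7) = (1 - a * (t 7)\<^sup>2) * V * c2 * c4"
    proof -
      have "(\<Prod>m\<in>mids. 1 - a * t 7 * t m) = (1 - a * t 7 * t 7) * V"
        unfolding V_def by (subst prod.remove[OF _ m7]) auto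
      moreover have "(\<Prod>m\<in>mids. 1 - t 7 / t m) = 0" using m7 by (auto intro!: bexI[of _ 7])
      ultimately show ?thesis unfolding Br_def c2_def c4_def by (simp add: power2_eq_square mult_ac)
    qed
    ultimately show "Lf (t 7) * (t 7 * (1 - a * (t 7)\<^sup>2)) = l * Br (t 7)" by simp
  qed auto
  have quad: "A * w\<^sup>2 + B * w + C = 0" for w
  proof (rule quadratic_eq_0[OF P1 P2 P3])
    show "\<sigma> (t p' / q) \<noteq> \<sigma> (t p / q)"
      using u1 z1 by (intro \<sigma>_neq) (auto simp: z_def field_simps power2_eq_square)
    show "\<sigma> (t p' / q) \<noteq> \<sigma> (t 7)" "\<sigma> (t p / q) \<noteq> \<sigma> (t 7)"
      by (rule \<sigma>_neq; use ne in \<open>auto simp: field_simps\<close>)+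
  qed
  have "Lf x * (x * (1 - a * x\<^sup>2)) = l * Br x"
  proof (cases "x = 0")
    case True
    thus ?thesis by (simp add: Br_def)
  next
    case False
    from key[OF this] quad[of "\<sigma> x"] show ?thesis by simp
  qed
  thus ?thesis unfolding Lf_def Br_def r_def b_def g_def l_def by (simp add: mult.commute)
qed

lemma contiguous:
  assumes "gen a t" "balanced a t" "movers p p'" "T < 8"
  shows "rho a t p p' * fsum a (shift p p' 1 t) T - bet a t p p' * fsum a t T
    + gam a t p p' * fsum a (shift p p' (-1) t) T = lam a t p p'"
  by (rule contiguous_aux[OF contiguous_polynomial_identity[OF assms(1-3)] assms(1,3,4)])

section \<open>The gauge factor and the three-term recurrence of an octet\<close>

definition mu :: "complex \<Rightarrow> (nat \<Rightarrow> complex) \<Rightarrow> nat \<Rightarrow> nat \<Rightarrow> int \<Rightarrow> complex" where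
  "mu a t p p' n = (a * t p * t p' / q) powi n * qi (shift p p' n t p / shift p p' n t p') /
     (\<Prod>m\<in>mids. qi (q / (a * shift p p' n t p' * t m)))"

text \<open>\<open>mu\<close> is an explicit solution of the first-order recurrence with multiplier
  \<open>rho\<close>. Multiplying by it normalises the leading coefficient of the three-term
  relation to 1, as in the given recurrence.\<close>

lemma mu_step:
  assumes gen: "gen a t" and pp: "movers p p'"
  shows "mu a t p p' (n + 1) = rho a (shift p p' n t) p p' * mu a t p p' n"
proof -
  define s where "s = shift p p' n t"
  have g: "gen a s" unfolding s_def by (rule gen_shift[OF gen])
  have p8: "p < 8" "p' < 8" "p \<noteq> p'" using pp by (auto simp: movers_def)
  note [simp] = genD(2)[OF g p8(1)] genD(2)[OF g p8(2)] genD(2)[OF gen p8(1)] genD(2)[OF gen p8(2)] genD(1)[OF gen] q_nz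
  have s1: "shift p p' (n + 1) t = shift p p' 1 s" using p8 by (simp add: s_def shift_shift)
  have sm: "s m = t m" if "m \<in> mids" for m using that pp by (simp add: s_def shift_mid)
  have z: "a * s p * s p' = a * t p * t p'" using p8 by (simp add: s_def power_int_minus)
  have u: "s p / s p' \<noteq> q powi k" for k by (rule genD(4)[OF g p8(1-3)])
  have u1: "s p / s p' \<noteq> 1" "q * s p / s p' \<noteq> 1" using u[of 0] u[of "-1"] by (auto simp: power_int_minus field_simps)
  have A: "qi (s p / s p') = (1 - s p / s p') * ((1 - q * s p / s p') * qi (shift p p' 1 s p / shift p p' 1 s p'))"
  proof -
    have "shift p p' 1 s p / shift p p' 1 s p' = q * (q * s p / s p')"
      using p8 by (simp add: power_int_minus field_simps)
    thus ?thesis using qi_step[of "s p / s p'"] qi_step[of "q * s p / s p'"] by simp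
  qed
  have B: "(\<Prod>m\<in>mids. qi (q / (a * s p' * t m))) =
     (\<Prod>m\<in>mids. 1 - q / (a * s p' * t m)) * (\<Prod>m\<in>mids. qi (q / (a * shift p p' 1 s p' * t m)))"
    unfolding prod.distrib[symmetric]
  proof (intro prod.cong refl)
    fix m
    have "q / (a * shift p p' 1 s p' * t m) = q * (q / (a * s p' * t m))" by (simp add: power_int_minus field_simps)
    thus "qi (q / (a * s p' * t m)) = (1 - q / (a * s p' * t m)) * qi (q / (a * shift p p' 1 s p' * t m))"
      using qi_step[of "q / (a * s p' * t m)"] by simp
  qed
  have "qi (q / (a * s p' * t m)) \<noteq> 0" if m: "m \<in> mids" for m
  proof (rule qi_nz)
    fix k show "q / (a * s p' * t m) \<noteq> q powi k"
      using genD(3)[OF g p8(2) mids_less[OF m], of "1 - k"] genD(2)[OF g mids_less[OF m]]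
      by (auto simp: sm[OF m] power_int_diff field_simps)
  qed
  hence nz: "(\<Prod>m\<in>mids. qi (q / (a * s p' * t m))) \<noteq> 0" by simp
  have rho: "rho a s p p' = a * t p * t p' / q * (\<Prod>m\<in>mids. 1 - q / (a * s p' * t m)) /
     ((1 - s p / s p') * (1 - q * s p / s p'))"
    unfolding rho_def z by (simp add: sm)
  have nz2: "(\<Prod>m\<in>mids. 1 - q / (a * s p' * t m)) \<noteq> 0" using nz unfolding B by auto
  have pw: "(a * t p * t p' / q) powi (n + 1) = (a * t p * t p' / q) powi n * (a * t p * t p' / q)"
    by (rule power_int_add_1) simp
  have frac: "W * k * X / D = k * P / (e * f) * (W * (e * (f * X)) / (P * D))"
    if "e \<noteq> 0" "f \<noteq> 0" "P \<noteq> 0" for W k X D e f P :: complex using that by simp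
  show ?thesis
    unfolding mu_def s1 s_def[symmetric] rho A B pw
    by (rule frac) (use u1 nz2 in auto)
qed

lemma octet_recurrence:
  assumes "gen a t" "balanced a t" "movers p p'" "T < 8" "V < 8"
  defines "Y \<equiv> \<lambda>n. mu a t p p' n * (fsum a (shift p p' n t) T - fsum a (shift p p' n t) V)"
  shows "Y (n + 1) - bet a (shift p p' n t) p p' * Y n +
    rho a (shift p p' (n - 1) t) p p' * gam a (shift p p' n t) p p' * Y (n - 1) = 0"
proof -
  define s where "s = shift p p' n t"
  have np: "p \<noteq> p'" using assms(3) by (auto simp: movers_def)
  have s: "shift p p' (n + 1) t = shift p p' 1 s" "shift p p' (n - 1) t = shift p p' (-1) s"
    using np by (simp_all add: s_def shift_shift)
  have g: "gen a s" "balanced a s" using assms by (simp_all add: s_def gen_shift balanced_shift)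
  have m: "mu a t p p' (n + 1) = rho a s p p' * mu a t p p' n"
    "mu a t p p' n = rho a (shift p p' (-1) s) p p' * mu a t p p' (n - 1)"
    using mu_step[OF assms(1,3), of n] mu_step[OF assms(1,3), of "n - 1"]
    unfolding s(2)[symmetric] by (simp_all only: s_def diff_add_cancel)
  have "Y (n + 1) - bet a s p p' * Y n + rho a (shift p p' (-1) s) p p' * gam a s p p' * Y (n - 1) =
    mu a t p p' n * ((rho a s p p' * fsum a (shift p p' 1 s) T - bet a s p p' * fsum a s T + gam a s p p' * fsum a (shift p p' (-1) s) T)
     - (rho a s p p' * fsum a (shift p p' 1 s) V - bet a s p p' * fsum a s V + gam a s p p' * fsum a (shift p p' (-1) s) V))"
    unfolding Y_def m(1) s s_def[symmetric] unfolding m(2) by (simp add: algebra_simps)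
  also have "\<dots> = 0" using contiguous[OF g assms(3,4)] contiguous[OF g assms(3,5)] by simp
  finally show ?thesis by (simp add: s s_def)
qed

end

text \<open>The symmetric functions of degrees 2, 3 and 4 cancel in the application, so they are left unspecified.\<close>

lemma six_factors:
  fixes y0 :: complex
  assumes "y0 \<noteq> 0" "y1 \<noteq> 0" "y2 \<noteq> 0" "y3 \<noteq> 0" "y4 \<noteq> 0" "y5 \<noteq> 0"
  shows "\<exists>e2 e3 e4. \<forall>w x. (w - x * y0) * (w - x * y1) * (w - x * y2) * (w - x * y3) * (w - x * y4) * (w - x * y5) =
    w ^ 6 - (y0 + y1 + y2 + y3 + y4 + y5) * (x * w ^ 5) + e2 * (x ^ 2 * w ^ 4) - e3 * (x ^ 3 * w ^ 3) + e4 * (x ^ 4 * w ^ 2)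
    - (y0 * y1 * y2 * y3 * y4 * y5) * (1 / y0 + 1 / y1 + 1 / y2 + 1 / y3 + 1 / y4 + 1 / y5) * (x ^ 5 * w)
    + (y0 * y1 * y2 * y3 * y4 * y5) * x ^ 6"
proof -
  define s1 s2 s3 where "s1 = y0 + y1 + y2" and "s2 = y0 * y1 + y0 * y2 + y1 * y2" and "s3 = y0 * y1 * y2"
  define r1 r2 r3 where "r1 = y3 + y4 + y5" and "r2 = y3 * y4 + y3 * y5 + y4 * y5" and "r3 = y3 * y4 * y5"
  have s: "(w - x * y0) * (w - x * y1) * (w - x * y2) = w ^ 3 - s1 * x * w ^ 2 + s2 * x ^ 2 * w - s3 * x ^ 3"
    and r: "(w - x * y3) * (w - x * y4) * (w - x * y5) = w ^ 3 - r1 * x * w ^ 2 + r2 * x ^ 2 * w - r3 * x ^ 3" for w x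
    unfolding s1_def s2_def s3_def r1_def r2_def r3_def by (simp_all add: algebra_simps eval_nat_numeral)
  have e5: "(y0 * y1 * y2 * y3 * y4 * y5) * (1 / y0 + 1 / y1 + 1 / y2 + 1 / y3 + 1 / y4 + 1 / y5) = s2 * r3 + s3 * r2"
    unfolding s1_def s2_def s3_def r1_def r2_def r3_def using assms by (simp add: field_simps)
  have e6: "y0 * y1 * y2 * y3 * y4 * y5 = s3 * r3" and e1: "y0 + y1 + y2 + y3 + y4 + y5 = s1 + r1"
    by (simp_all add: s3_def r3_def s1_def r1_def)
  have "(w - x * y0) * (w - x * y1) * (w - x * y2) * (w - x * y3) * (w - x * y4) * (w - x * y5) =
    w ^ 6 - (s1 + r1) * (x * w ^ 5) + (s2 + r2 + s1 * r1) * (x ^ 2 * w ^ 4) - (s3 + r3 + s1 * r2 + s2 * r1) * (x ^ 3 * w ^ 3)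
    + (s1 * r3 + s3 * r1 + s2 * r2) * (x ^ 4 * w ^ 2) - (s2 * r3 + s3 * r2) * (x ^ 5 * w) + s3 * r3 * x ^ 6" for w x
  proof -
    have "(w - x * y0) * (w - x * y1) * (w - x * y2) * (w - x * y3) * (w - x * y4) * (w - x * y5) =
      ((w - x * y0) * (w - x * y1) * (w - x * y2)) * ((w - x * y3) * (w - x * y4) * (w - x * y5))"
      by (simp only: mult.assoc)
    thus ?thesis unfolding s r by (simp add: algebra_simps eval_nat_numeral)
  qed
  thus ?thesis unfolding e5 e1 unfolding e6 by blast
qed

section \<open>Very-well-poised series in octet coordinates\<close>

definition is_idx :: "nat \<Rightarrow> nat list \<Rightarrow> bool" where
  "is_idx T idx \<longleftrightarrow> T < 8 \<and> distinct idx \<and> set idx = {..<8} - {T}"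

lemma is_idx_length: "is_idx T idx \<Longrightarrow> length idx = 7"
  using distinct_card[of idx] by (auto simp: is_idx_def)

lemma is_idx_nth: "is_idx T idx \<Longrightarrow> i < 7 \<Longrightarrow> idx ! i < 8 \<and> idx ! i \<noteq> T"
  using nth_mem[of i idx] is_idx_length[of T idx] by (auto simp: is_idx_def)

lemma is_idx_swap:
  assumes "is_idx T idx" "i < 7"
  shows "is_idx (idx ! i) (idx[i := T])"
proof -
  have l: "length idx = 7" by (rule is_idx_length[OF assms(1)])
  have "set (idx[i := T]) = insert T (set idx - {idx ! i})"
    using assms l by (intro set_update_distinct) (auto simp: is_idx_def)
  moreover have "distinct (idx[i := T])"
    using assms l by (intro distinct_list_update) (auto simp: is_idx_def)
  ultimately show ?thesis using is_idx_nth[OF assms] assms by (auto simp: is_idx_def)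
qed

lemma prod_list_idx:
  fixes g :: "nat \<Rightarrow> 'a::comm_monoid_mult"
  shows "is_idx T idx \<Longrightarrow> prod_list (map g idx) = (\<Prod>U\<in>{..<8} - {T}. g U)"
  by (auto simp: is_idx_def prod.distinct_set_conv_list[symmetric])

lemma bij_betw_idx:
  assumes "is_idx T idx" "i < 7"
  shows "bij_betw ((!) idx) ({..<7} - {i}) ({..<8} - {T, idx ! i})"
proof -
  have l: "length idx = 7" by (rule is_idx_length[OF assms(1)])
  have "bij_betw ((!) idx) {..<7} (set idx)"
    using assms l by (intro bij_betw_nth) (auto simp: is_idx_def)
  from bij_betw_DiffI[OF this, of "{i}" "{idx ! i}"]
  have "bij_betw ((!) idx) ({..<7} - {i}) (set idx - {idx ! i})"
    using assms l by auto
  moreover have "set idx - {idx ! i} = {..<8} - {T, idx ! i}" using assms by (auto simp: is_idx_def)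
  ultimately show ?thesis by simp
qed

context q_base
begin

definition dual :: "(nat \<Rightarrow> complex) \<Rightarrow> nat \<Rightarrow> complex" where "dual t U = 1 / t U"

definition opars :: "complex \<Rightarrow> (nat \<Rightarrow> complex) \<Rightarrow> nat \<Rightarrow> nat list \<Rightarrow> complex list" where
  "opars a t T idx = map (\<lambda>U. a * t T * t U) idx"

lemma fterm_nz:
  assumes "gen a t" "T < 8" shows "fterm a t (t T) \<noteq> 0"
proof -
  have "1 - a * (t T)\<^sup>2 \<noteq> 0" using genD(3)[OF assms assms(2), of 0] by (simp add: power2_eq_square mult.assoc)
  moreover have "qi (q * t T / t U) \<noteq> 0" if "U < 8" for U
  proof (cases "U = T")
    case True
    thus ?thesis using genD(2)[OF assms] by simp
  next
    case False
    show ?thesis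
      by (rule qi_nz, rule notin_powers_shift[OF genD(4)[OF assms that], of _ 1]) (use False in auto)
  qed
  moreover have "qi (a * t T * t U) \<noteq> 0" if "U < 8" for U
    using genD(3)[OF assms that] by (rule qi_nz)
  ultimately show ?thesis unfolding fterm_def using genD(2)[OF assms] by auto
qed

text \<open>The defining series has first term 1, so its terms are the values of
  \<open>fterm\<close> along the progression divided by the value at the start.\<close>

lemma W109_octet:
  assumes gen: "gen a t" and idx: "is_idx T idx"
  shows "W109 q (a * (t T)\<^sup>2) (opars a t T idx) = fsum a t T / fterm a t (t T)"
proof -
  have T: "T < 8" using idx by (simp add: is_idx_def)
  have split8: "(\<Prod>U<8. g U) = g T * (\<Prod>U\<in>{..<8} - {T}. g U)" for g :: "nat \<Rightarrow> complex"
    using T by (intro prod.remove) auto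
  note nz = genD[OF gen]
  have tT: "t T \<noteq> 0" using nz T by auto
  have fT: "fterm a t (t T) = hterm a t T 0 / den a t T" using fterm_den[OF gen T, of 0] by simp
  have h0: "hterm a t T 0 \<noteq> 0" using fterm_nz[OF gen T] fT by auto
  have qn: "qpoch q (q * t T / t U) k \<noteq> 0" if "U < 8" for U k
  proof (cases "U = T")
    case True
    thus ?thesis using tT qi_q qi_split[of q k] by auto
  next
    case False
    show ?thesis
      by (rule qpoch_nz, rule notin_powers_shift[OF nz(4)[OF T that], of _ 1]) (use False in auto)
  qed
  have "(1 - a * (t T)\<^sup>2 * q ^ (2 * k)) / (1 - a * (t T)\<^sup>2) *
          (qpochs q (a * (t T)\<^sup>2 # opars a t T idx) k /
           qpochs q (q # map (\<lambda>p. a * (t T)\<^sup>2 * q / p) (opars a t T idx)) k) * q ^ k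
      = fterm a t (t T * q ^ k) / fterm a t (t T)" for k
  proof -
    have A: "qpochs q (a * (t T)\<^sup>2 # opars a t T idx) k = (\<Prod>U<8. qpoch q (a * t T * t U) k)"
      unfolding qpochs_def opars_def split8
      by (simp add: o_def prod_list_idx[OF idx] power2_eq_square mult.assoc)
    have B: "qpochs q (q # map (\<lambda>p. a * (t T)\<^sup>2 * q / p) (opars a t T idx)) k = (\<Prod>U<8. qpoch q (q * t T / t U) k)"
    proof -
      have "a * (t T)\<^sup>2 * q / (a * t T * t U) = q * t T / t U" for U
        using nz(1) tT by (simp add: power2_eq_square)
      thus ?thesis unfolding qpochs_def opars_def split8
        using tT by (simp add: o_def prod_list_idx[OF idx])
    qed
    have "hterm a t T k / hterm a t T 0 = (t T * q ^ k / t T) * ((1 - a * (t T * q ^ k)\<^sup>2) / (1 - a * (t T)\<^sup>2)) *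
       (\<Prod>U<8. qi (q * (t T * q ^ k) / t U) * qpoch q (a * t T * t U) k / (qi (q * t T / t U)))"
      by (simp add: hterm_def prod_dividef qpoch_def)
    also have "(\<Prod>U<8. qi (q * (t T * q ^ k) / t U) * qpoch q (a * t T * t U) k / (qi (q * t T / t U))) =
       (\<Prod>U<8. qpoch q (a * t T * t U) k / qpoch q (q * t T / t U) k)"
    proof (intro prod.cong refl)
      fix U assume "U \<in> {..<8::nat}"
      hence U: "U < 8" by simp
      have "qi (q * (t T * q ^ 0) / t U) \<noteq> 0" using h0 U unfolding hterm_def by auto
      hence 1: "qi (q * t T / t U) \<noteq> 0" by simp
      have 2: "q * (t T * q ^ k) / t U = q * t T / t U * q ^ k" by simp
      show "qi (q * (t T * q ^ k) / t U) * qpoch q (a * t T * t U) k / (qi (q * t T / t U)) = qpoch q (a * t T * t U) k / qpoch q (q * t T / t U) k"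
        using 1 qn[OF U, of k] unfolding 2 qi_split[of "q * t T / t U" k] by simp
    qed
    finally have H: "hterm a t T k / hterm a t T 0 = q ^ k * ((1 - a * (t T)\<^sup>2 * q ^ (2 * k)) / (1 - a * (t T)\<^sup>2)) *
       (\<Prod>U<8. qpoch q (a * t T * t U) k / qpoch q (q * t T / t U) k)"
      using tT by (simp add: power_mult_distrib power_mult[symmetric] mult.commute mult.assoc)
    have "fterm a t (t T * q ^ k) / fterm a t (t T) = hterm a t T k / hterm a t T 0"
      unfolding fT fterm_den[OF gen T] using den_nz[OF gen T] by simp
    thus ?thesis unfolding H A B by (simp add: prod_dividef)
  qed
  hence "W109 q (a * (t T)\<^sup>2) (opars a t T idx) = (\<Sum>k. fterm a t (t T * q ^ k) / fterm a t (t T))"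
    unfolding W109_def by simp
  also have "\<dots> = fsum a t T / fterm a t (t T)"
    using fterm_sums[OF gen T] by (simp add: fsum_def suminf_divide sums_summable)
  finally show ?thesis .
qed

lemma opars_nth: "is_idx T idx \<Longrightarrow> i < 7 \<Longrightarrow> opars a t T idx ! i = a * t T * t (idx ! i)"
  by (simp add: opars_def is_idx_length)

text \<open>The distinguished parameter is \<open>a * t T * t V\<close> and the leading one
  \<open>a * (t T)\<^sup>2\<close>, where \<open>V = idx ! i\<close>. Hence the partner series
  belongs to the same octet, started at \<open>V\<close> instead of \<open>T\<close>; the entry kept
  in place is the one for \<open>T\<close>.\<close>

lemma partner_opars:
  assumes "is_idx T idx" "i < 7" "a \<noteq> 0" "\<And>U. U < 8 \<Longrightarrow> t U \<noteq> 0"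
  shows "partner_params i (a * (t T)\<^sup>2) (opars a t T idx) = opars a t (idx ! i) (idx[i := T])"
    and "(opars a t T idx ! i)\<^sup>2 / (a * (t T)\<^sup>2) = a * (t (idx ! i))\<^sup>2"
proof -
  have l: "length idx = 7" by (rule is_idx_length[OF assms(1)])
  have tT: "t T \<noteq> 0" using assms by (auto simp: is_idx_def)
  show "partner_params i (a * (t T)\<^sup>2) (opars a t T idx) = opars a t (idx ! i) (idx[i := T])"
    unfolding partner_params_def
    by (rule nth_equalityI) (use assms(2,3) l tT in \<open>auto simp: opars_def nth_list_update power2_eq_square\<close>)
  show "(opars a t T idx ! i)\<^sup>2 / (a * (t T)\<^sup>2) = a * (t (idx ! i))\<^sup>2"
    using assms(3) tT by (simp add: opars_nth[OF assms(1,2)] power2_eq_square)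
qed

lemma Phi_denominator_octet:
  assumes "is_idx T idx" "i < 7" "a \<noteq> 0" "\<And>U. U < 8 \<Longrightarrow> t U \<noteq> 0"
  shows "Phi_denominator q i (a * (t T)\<^sup>2) (opars a t T idx) =
    qi (q * (a * t (idx ! i) * t (idx ! i))) * qi (t T / t (idx ! i)) *
    (\<Prod>U\<in>{..<8} - {T, idx ! i}. qi (q * t T / t U) * qi (a * t (idx ! i) * t U))"
proof -
  let ?V = "idx ! i"
  have l: "length (opars a t T idx) = 7" using is_idx_length[OF assms(1)] by (simp add: opars_def)
  have nz: "t T \<noteq> 0" "t ?V \<noteq> 0" using assms is_idx_nth[OF assms(1,2)] by (auto simp: is_idx_def)
  have "(\<Prod>j\<in>{..<7} - {i}. qpochs_inf q [a * (t T)\<^sup>2 * q / (opars a t T idx ! j), opars a t T idx ! i * (opars a t T idx ! j) / (a * (t T)\<^sup>2)])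
    = (\<Prod>j\<in>{..<7} - {i}. qi (q * t T / t (idx ! j)) * qi (a * t ?V * t (idx ! j)))"
    using assms nz by (intro prod.cong refl) (simp add: opars_nth[OF assms(1)] qpochs_inf_def power2_eq_square mult.commute mult.assoc)
  also have "\<dots> = (\<Prod>U\<in>{..<8} - {T, ?V}. qi (q * t T / t U) * qi (a * t ?V * t U))"
    by (rule prod.reindex_bij_betw[OF bij_betw_idx[OF assms(1,2)]])
  finally show ?thesis
    unfolding Phi_denominator_def l opars_nth[OF assms(1,2)] using assms nz
    by (simp add: qpochs_inf_def opars_nth[OF assms(1,2)] power2_eq_square mult_ac)
qed

text \<open>\<open>\<Phi>\<close> is a Jackson integral: both series run over the values of one function at points of geometric progressions.\<close>

lemma Phi_octet:
  assumes gen: "gen a t" and idx: "is_idx T idx" and i: "i < 7"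
  shows "Phi q i (a * (t T)\<^sup>2) (opars a t T idx) = (fsum a t T - fsum a t (idx ! i)) / fterm a t (t T)"
proof -
  define V where "V = idx ! i"
  define R where "R = {..<8} - {T, V}"
  have T: "T < 8" and V: "V < 8" "V \<noteq> T" using idx is_idx_nth[OF idx i] by (auto simp: is_idx_def V_def)
  note nz = genD(1)[OF gen] genD(2)[OF gen]
  have l: "length (opars a t T idx) = 7" using is_idx_length[OF idx] by (simp add: opars_def)
  have [simp]: "t T \<noteq> 0" "t V \<noteq> 0" "a \<noteq> 0" using nz T V by auto
  have split: "(\<Prod>U<8. g U) = g T * g V * (\<Prod>U\<in>R. g U)" for g :: "nat \<Rightarrow> complex"
  proof -
    have 1: "{..<8} = insert T (insert V R)" and 2: "T \<notin> insert V R" "V \<notin> R" "finite R"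
      using T V by (auto simp: R_def)
    show ?thesis unfolding 1 using 2 by (simp add: mult.assoc)
  qed
  define N where "N = (\<Prod>U\<in>R. qi (a * t T * t U) * qi (q * t V / t U))"
  define M where "M = (\<Prod>U\<in>R. qi (q * t T / t U) * qi (a * t V * t U))"
  have num: "qpochs_inf q [a * (t T)\<^sup>2 * q, opars a t T idx ! i / (a * (t T)\<^sup>2)] *
     (\<Prod>j\<in>{..<length (opars a t T idx)} - {i}. qpochs_inf q [opars a t T idx ! j, opars a t T idx ! i * q / opars a t T idx ! j])
     = qi (q * (a * t T * t T)) * qi (t V / t T) * N"
  proof -
    have "(\<Prod>j\<in>{..<7} - {i}. qpochs_inf q [opars a t T idx ! j, opars a t T idx ! i * q / opars a t T idx ! j])
      = (\<Prod>j\<in>{..<7} - {i}. qi (a * t T * t (idx ! j)) * qi (q * t V / t (idx ! j)))"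
      by (intro prod.cong refl) (simp add: opars_nth[OF idx] i V_def[symmetric] qpochs_inf_def mult.commute)
    also have "\<dots> = N" unfolding N_def R_def V_def
      by (rule prod.reindex_bij_betw[OF bij_betw_idx[OF idx i]])
    finally show ?thesis unfolding l
      by (simp add: qpochs_inf_def opars_nth[OF idx i] V_def[symmetric] power2_eq_square mult_ac)
  qed
  have dn: "Phi_denominator q i (a * (t T)\<^sup>2) (opars a t T idx) = qi (q * (a * t V * t V)) * qi (t T / t V) * M"
    unfolding M_def R_def V_def using Phi_denominator_octet[OF idx i] nz by blast
  have e1: "qi (a * t U * t U) = (1 - a * t U * t U) * qi (q * (a * t U * t U))" for U by (rule qi_step)
  have e2: "qi (t V / t T) = (1 - t V / t T) * qi (q * t V / t T)" "qi (t T / t V) = (1 - t T / t V) * qi (q * t T / t V)"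
    using qi_step[of "t V / t T"] qi_step[of "t T / t V"] by simp_all
  have sq: "1 - a * t U * t U \<noteq> 0" if "U < 8" for U using genD(3)[OF gen that that, of 0] by simp
  have qs: "qi (q * (a * t U * t U)) \<noteq> 0" if "U < 8" for U
    using genD(3)[OF gen that that, THEN qi_nz] e1[of U] by auto
  have tn: "t T \<noteq> t V" using genD(4)[OF gen T V(1), of 0] V by auto
  have f: "fterm a t (t T) = t T / qi (q * (a * t T * t T)) * qi q * (qi (q * t T / t V) / qi (a * t T * t V)) *
       (\<Prod>U\<in>R. qi (q * t T / t U) / qi (a * t T * t U))"
    unfolding fterm_def split e1 using sq[OF T] qs[OF T] by (simp add: power2_eq_square mult.assoc)
  have g: "fterm a t (t V) = t V / qi (q * (a * t V * t V)) * qi q * (qi (q * t V / t T) / qi (a * t T * t V)) *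
       (\<Prod>U\<in>R. qi (q * t V / t U) / qi (a * t V * t U))"
    unfolding fterm_def split e1 using sq[OF V(1)] qs[OF V(1)]
    by (simp add: power2_eq_square mult_ac)
  have fT: "fterm a t (t T) \<noteq> 0" "fterm a t (t V) \<noteq> 0" using fterm_nz[OF gen] T V by auto
  have pr: "(\<Prod>U\<in>R. qi (q * t V / t U) / qi (a * t V * t U)) / (\<Prod>U\<in>R. qi (q * t T / t U) / qi (a * t T * t U)) = N / M"
    unfolding N_def M_def prod_dividef prod.distrib by (simp add: mult_ac)
  \<comment> \<open>The coefficient in front of the partner series is minus the quotient of the two
    first terms, which is why \<open>Phi\<close> becomes a difference. The sign arises from
    \<open>(1 - v) / (1 - 1 / v) = - v\<close> with \<open>v = t V / t T\<close>.\<close>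
  have coef: "qi (q * (a * t T * t T)) * qi (t V / t T) * N / (qi (q * (a * t V * t V)) * qi (t T / t V) * M)
     = - (fterm a t (t V) / fterm a t (t T))"
  proof -
    have nzq: "qi q \<noteq> 0" "qi (a * t T * t V) \<noteq> 0" using qi_q genD(3)[OF gen T V(1), THEN qi_nz] by auto
    have "fterm a t (t V) / fterm a t (t T) = (t V / t T) * (qi (q * (a * t T * t T)) / qi (q * (a * t V * t V))) *
        (qi (q * t V / t T) / qi (q * t T / t V)) * (N / M)"
      unfolding f g pr[symmetric] using nzq by (simp add: mult_ac)
    moreover have "qi (t V / t T) / qi (t T / t V) = - (t V / t T) * (qi (q * t V / t T) / qi (q * t T / t V))"
    proof -
      have "(1 - t V / t T) / (1 - t T / t V) = - (t V / t T)" using tn by (simp add: divide_simps) (simp add: algebra_simps)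
      moreover have "qi (t V / t T) / qi (t T / t V) = (1 - t V / t T) / (1 - t T / t V) * (qi (q * t V / t T) / qi (q * t T / t V))"
        unfolding e2 by simp
      ultimately show ?thesis by simp
    qed
    moreover have "qi (q * (a * t T * t T)) * qi (t V / t T) * N / (qi (q * (a * t V * t V)) * qi (t T / t V) * M) =
       (qi (q * (a * t T * t T)) / qi (q * (a * t V * t V))) * (qi (t V / t T) / qi (t T / t V)) * (N / M)" by simp
    ultimately show ?thesis by (simp add: mult_ac)
  qed
  have W2: "W109 q ((opars a t T idx ! i)\<^sup>2 / (a * (t T)\<^sup>2)) (partner_params i (a * (t T)\<^sup>2) (opars a t T idx)) = fsum a t V / fterm a t (t V)"
    using W109_octet[OF gen is_idx_swap[OF idx i]] partner_opars[OF idx i nz(1), of t] nz(2)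
    unfolding V_def by simp
  show ?thesis unfolding Phi_def num dn coef W2 W109_octet[OF gen idx] V_def[symmetric] using fT by (simp add: diff_divide_distrib)
qed

lemma W109_regular_octet_iff:
  assumes "is_idx T idx" "a \<noteq> 0" "\<And>U. U < 8 \<Longrightarrow> t U \<noteq> 0"
  shows "W109_regular q (a * (t T)\<^sup>2) (opars a t T idx) \<longleftrightarrow>
    1 - a * t T * t T \<noteq> 0 \<and> (\<forall>U<8. \<forall>k. qpoch q (q * t T / t U) k \<noteq> 0)"
proof -
  have tT: "t T \<noteq> 0" using assms by (auto simp: is_idx_def)
  have "qpochs q (q # map (\<lambda>p. a * (t T)\<^sup>2 * q / p) (opars a t T idx)) k = (\<Prod>U<8. qpoch q (q * t T / t U) k)" for k
  proof -
    have "a * (t T)\<^sup>2 * q / (a * t T * t U) = q * t T / t U" for U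
      using assms(2) tT by (simp add: power2_eq_square)
    moreover have "(\<Prod>U<8. g U) = g T * (\<Prod>U\<in>{..<8} - {T}. g U)" for g :: "nat \<Rightarrow> complex"
      using assms(1) by (intro prod.remove) (auto simp: is_idx_def)
    ultimately show ?thesis unfolding qpochs_def opars_def
      using tT by (simp add: o_def prod_list_idx[OF assms(1)])
  qed
  thus ?thesis unfolding W109_regular_def by (auto simp: power2_eq_square mult.assoc)
qed

lemma gen_imp_W109_regular:
  assumes "gen a t" "is_idx T idx"
  shows "W109_regular q (a * (t T)\<^sup>2) (opars a t T idx)"
proof -
  have T: "T < 8" using assms by (simp add: is_idx_def)
  have "qpoch q (q * t T / t U) k \<noteq> 0" if "U < 8" for U k
  proof (cases "U = T")
    case True
    thus ?thesis using genD(2)[OF assms(1) T] qi_q qi_split[of q k] by auto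
  next
    case False
    show ?thesis
      by (rule qpoch_nz, rule notin_powers_shift[OF genD(4)[OF assms(1) T that], of _ 1]) (use False in auto)
  qed
  thus ?thesis using genD(3)[OF assms(1) T T, of 0] genD[OF assms(1)]
    by (subst W109_regular_octet_iff[OF assms(2)]) auto
qed

lemma gen_imp_Phi_regular:
  assumes gen: "gen a t" and idx: "is_idx T idx" and i: "i < 7"
  shows "Phi_regular q i (a * (t T)\<^sup>2) (opars a t T idx)"
proof -
  define V where "V = idx ! i"
  have T: "T < 8" and V: "V < 8" "V \<noteq> T" using idx is_idx_nth[OF idx i] by (auto simp: is_idx_def V_def)
  have "qi (q * (a * t V * t V)) \<noteq> 0"
    by (rule qi_nz, rule notin_powers_shift[OF genD(3)[OF gen V(1) V(1)], of _ 1]) simp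
  moreover have "qi (t T / t V) \<noteq> 0"
    by (rule qi_nz) (use genD(4)[OF gen T V(1)] V in auto)
  moreover have "qi (q * t T / t U) \<noteq> 0" if "U \<in> {..<8} - {T, V}" for U
    by (rule qi_nz, rule notin_powers_shift[OF genD(4)[OF gen T], of U _ 1]) (use that in auto)
  moreover have "qi (a * t V * t U) \<noteq> 0" if "U \<in> {..<8} - {T, V}" for U
    by (rule qi_nz, rule genD(3)[OF gen V(1)]) (use that in auto)
  ultimately have "Phi_denominator q i (a * (t T)\<^sup>2) (opars a t T idx) \<noteq> 0"
    using genD(1,2)[OF gen] by (subst Phi_denominator_octet[OF idx i]) (auto simp: V_def)
  thus ?thesis unfolding Phi_regular_def
    using gen_imp_W109_regular[OF gen idx] gen_imp_W109_regular[OF gen is_idx_swap[OF idx i]]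
      partner_opars[OF idx i genD(1)[OF gen], of t] genD(2)[OF gen] by auto
qed

text \<open>The way back from regularity to \<open>gen\<close>. The infinite products in these
  denominators exclude nonpositive powers of \<open>q\<close> only; the positive ones are excluded
  by the same lemma for the dual octet.\<close>

lemma Phi_regular_octetD:
  assumes idx: "is_idx T idx" and nz: "a \<noteq> 0" "\<And>U. U < 8 \<Longrightarrow> t U \<noteq> 0"
    and reg: "\<And>i. i < 7 \<Longrightarrow> Phi_regular q i (a * (t T)\<^sup>2) (opars a t T idx)"
  shows "a * t T * t T \<noteq> 1"
    and "V < 8 \<Longrightarrow> V \<noteq> T \<Longrightarrow> qi (q * (a * t V * t V)) \<noteq> 0"
    and "V < 8 \<Longrightarrow> V \<noteq> T \<Longrightarrow> qi (t T / t V) \<noteq> 0"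
    and "V < 8 \<Longrightarrow> V \<noteq> T \<Longrightarrow> U < 8 \<Longrightarrow> U \<noteq> T \<Longrightarrow> U \<noteq> V \<Longrightarrow> qi (a * t V * t U) \<noteq> 0"
proof -
  have "W109_regular q (a * (t T)\<^sup>2) (opars a t T idx)" using reg[of 0] by (simp add: Phi_regular_def)
  thus "a * t T * t T \<noteq> 1" using W109_regular_octet_iff[OF idx nz(1), of t] nz(2) by auto
next
  fix V assume V: "V < 8" "V \<noteq> T"
  hence "V \<in> set idx" using idx by (auto simp: is_idx_def)
  then obtain i where i: "i < 7" "idx ! i = V" by (metis in_set_conv_nth is_idx_length[OF idx])
  have "Phi_denominator q i (a * (t T)\<^sup>2) (opars a t T idx) \<noteq> 0" using reg[OF i(1)] by (simp add: Phi_regular_def)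
  hence *: "qi (q * (a * t V * t V)) * qi (t T / t V) *
    (\<Prod>U\<in>{..<8} - {T, V}. qi (q * t T / t U) * qi (a * t V * t U)) \<noteq> 0"
    using Phi_denominator_octet[OF idx i(1) nz(1), of t] nz(2) i by simp
  thus "qi (q * (a * t V * t V)) \<noteq> 0" "qi (t T / t V) \<noteq> 0" by auto
  show "qi (a * t V * t U) \<noteq> 0" if "U < 8" "U \<noteq> T" "U \<noteq> V" using * that by auto
qed

section \<open>Duality\<close>

lemma gen_dual: "gen a t \<Longrightarrow> gen (q / a) (dual t)"
  unfolding gen_def
proof (elim conjE, intro conjI allI impI)
  assume a: "a \<noteq> 0" and t: "\<forall>U<8. t U \<noteq> 0"
    and *: "\<forall>U<8. \<forall>V<8. \<forall>n. a * t U * t V \<noteq> q powi n" "\<forall>U<8. \<forall>V<8. \<forall>n. U \<noteq> V \<longrightarrow> t U / t V \<noteq> q powi n"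
  show "q / a \<noteq> 0" using a q_nz by simp
  fix U :: nat assume U: "U < 8"
  thus "dual t U \<noteq> 0" using t by (simp add: dual_def)
  fix V :: nat and n :: int assume V: "V < 8"
  show "q / a * dual t U * dual t V \<noteq> q powi n"
    using *(1)[rule_format, OF U V, of "1 - n"] a t U V q_nz by (auto simp: dual_def power_int_diff field_simps)
  show "dual t U / dual t V \<noteq> q powi n" if "U \<noteq> V"
    using *(2)[rule_format, OF V U, of n] that a t U V q_nz by (auto simp: dual_def)
qed

lemma dual_shift: "movers p p' \<Longrightarrow> dual (shift p p' n t) = shift p' p n (dual t)"
  by (auto simp: dual_def shift_def fun_eq_iff movers_def power_int_minus field_simps)

lemma balanced_dual: "gen a t \<Longrightarrow> balanced a t \<Longrightarrow> balanced (q / a) (dual t)"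
proof -
  assume g: "gen a t" and b: "balanced a t"
  have "(\<Prod>U<8. dual t U) = 1 / (\<Prod>U<8. t U)" by (simp add: dual_def prod_dividef)
  moreover have "(\<Prod>U<8. t U) = q\<^sup>2 / a ^ 4" using b genD(1)[OF g] by (simp add: balanced_def field_simps)
  ultimately show ?thesis using q_nz genD(1)[OF g] by (simp add: balanced_def power_divide) (simp add: field_simps flip: power_add)
qed

lemma prod_mids: "(\<Prod>m\<in>mids. f m) = f 0 * f 1 * f 2 * f 3 * f 4 * f 7" for f :: "nat \<Rightarrow> complex"
  by (simp add: mids_def mult.assoc)

lemma sum_mids: "(\<Sum>m\<in>mids. f m) = f 0 + f 1 + f 2 + f 3 + f 4 + f 7" for f :: "nat \<Rightarrow> complex"
  by (simp add: mids_def)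

text \<open>Compares the coefficients of \<open>x\<close> on both sides of the polynomial identity.\<close>

lemma bet_formula:
  assumes gen: "gen a t" and bal: "balanced a t" and pp: "movers p p'"
  shows "bet a t p p' = rho a t p p' + gam a t p p' +
    lam a t p p' * (a * (\<Sum>m\<in>mids. t m) + a * (t p + t p') / q - (\<Sum>m\<in>mids. 1 / t m) - q / t p - q / t p')"
proof -
  note E = contiguous_polynomial_identity[OF gen bal pp]
  define r b g l where "r = rho a t p p'" and "b = bet a t p p'" and "g = gam a t p p'" and "l = lam a t p p'"
  define L where "L = (\<lambda>x. x * (1 - a * x\<^sup>2) *
     (r * ((1 - x / t p) * (1 - a * x * t p) * (1 - q * x / t p) * (1 - a * x * t p / q)) -
      b * ((1 - q * x / t p) * (1 - a * x * t p / q) * (1 - q * x / t p') * (1 - a * x * t p' / q)) +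
      g * ((1 - x / t p') * (1 - a * x * t p') * (1 - q * x / t p') * (1 - a * x * t p' / q))))"
  define R where "R = (\<lambda>x. l * ((\<Prod>m\<in>mids. 1 - a * x * t m) * (1 - a * x * t p / q) * (1 - a * x * t p' / q) -
          (\<Prod>m\<in>mids. 1 - x / t m) * (1 - q * x / t p) * (1 - q * x / t p')))"
  have LR: "L = R" unfolding L_def R_def r_def b_def g_def l_def using E by (intro ext)
  have 1: "(L has_field_derivative (r - b + g)) (at 0)"
    unfolding L_def divide_inverse by (rule derivative_eq_intros refl | simp)+
  have 2: "(R has_field_derivative
     - l * (a * (\<Sum>m\<in>mids. t m) + a * (t p + t p') / q - (\<Sum>m\<in>mids. 1 / t m) - q / t p - q / t p')) (at 0)"
    unfolding R_def prod_mids sum_mids divide_inverse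
    by (rule derivative_eq_intros refl | simp)+ (simp add: algebra_simps)
  have "r - b + g = - l * (a * (\<Sum>m\<in>mids. t m) + a * (t p + t p') / q - (\<Sum>m\<in>mids. 1 / t m) - q / t p - q / t p')"
    using DERIV_unique[OF 1] 2 unfolding LR by blast
  moreover have "b = r + g + l * X" if "r - b + g = - l * X" for X
  proof -
    have "b = r + g - (r - b + g)" by simp
    thus ?thesis unfolding that by simp
  qed
  ultimately show ?thesis unfolding r_def b_def g_def l_def by blast
qed

text \<open>Needed so that octet and dual give the same recurrence. \<open>bet_formula\<close> is
  symmetric in the six fixed coordinates, so the difference of the two sides is linear in their
  elementary symmetric functions, the full product \<open>e6\<close> being fixed by the balancing
  condition. Each coefficient is a rational expression in \<open>al\<close>, \<open>be\<close>,
  \<open>a\<close> and \<open>q\<close> that vanishes identically.\<close>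

lemma bet_dual:
  assumes gen: "gen a t" and bal: "balanced a t" and pp: "movers p p'"
  shows "bet (q / a) (dual t) p' p = bet a t p p'"
proof -
  have p8: "p < 8" "p' < 8" "p \<noteq> p'" using pp by (auto simp: movers_def)
  have nz [simp]: "t p \<noteq> 0" "t p' \<noteq> 0" "a \<noteq> 0" "q \<noteq> 0" using genD[OF gen] p8 q_nz by auto
  have tm [simp]: "t m \<noteq> 0" if "m \<in> mids" for m using genD(2)[OF gen mids_less[OF that]] .
  have tms [simp]: "t 0 \<noteq> 0" "t (Suc 0) \<noteq> 0" "t 2 \<noteq> 0" "t 3 \<noteq> 0" "t 4 \<noteq> 0" "t 7 \<noteq> 0" using genD(2)[OF gen] by auto
  define al be where "al = a * t p" and "be = a * t p'"
  have ab [simp]: "al \<noteq> 0" "be \<noteq> 0" by (auto simp: al_def be_def)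
  have tp: "t p = al / a" "t p' = be / a" by (simp_all add: al_def be_def)
  have u1: "t p \<noteq> t p'" "q * t p \<noteq> t p'" "t p \<noteq> q * t p'"
    using genD(4)[OF gen p8(1-3), of 0] genD(4)[OF gen p8(1-3), of "-1"] genD(4)[OF gen p8(1-3), of 1]
    by (auto simp: power_int_minus field_simps)
  have u: "al \<noteq> be" "be \<noteq> al" "be \<noteq> q * al" "q * al \<noteq> be" "al \<noteq> q * be" "q * be \<noteq> al"
    using u1 by (auto simp: al_def be_def mult.left_commute)
  define e1 e6 i1 where "e1 = (\<Sum>m\<in>mids. t m)" and "e6 = (\<Prod>m\<in>mids. t m)" and "i1 = (\<Sum>m\<in>mids. 1 / t m)"
  have e6: "e6 = q\<^sup>2 / (a\<^sup>2 * al * be)"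
    using bal unfolding balanced_def prod_octet[OF pp] e6_def[symmetric] tp
    by (simp add: field_simps eval_nat_numeral)
  obtain e2 e3 e4 where E: "\<And>w x. (\<Prod>m\<in>mids. w - x * t m) = w ^ 6 - e1 * (x * w ^ 5) + e2 * (x ^ 2 * w ^ 4)
      - e3 * (x ^ 3 * w ^ 3) + e4 * (x ^ 4 * w ^ 2) - e6 * i1 * (x ^ 5 * w) + e6 * x ^ 6"
    using six_factors[of "t 0" "t 1" "t 2" "t 3" "t 4" "t 7"]
    unfolding e1_def e6_def i1_def prod_mids sum_mids by auto
  have inv: "(\<Prod>m\<in>mids. 1 - w / t m) = (\<Prod>m\<in>mids. w - 1 * t m) / e6" for w
  proof -
    have "(\<Prod>m\<in>mids. 1 - w / t m) = (\<Prod>m\<in>mids. (w - 1 * t m) / (- t m))"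
      by (intro prod.cong refl) (simp add: field_simps)
    also have "\<dots> = (\<Prod>m\<in>mids. w - 1 * t m) / e6" unfolding prod_dividef e6_def by (simp add: prod_mids)
    finally show ?thesis .
  qed
  define D1 D2 where "D1 = 1 / ((1 - al / be) * (1 - q * al / be))" and "D2 = 1 / ((1 - al / be) * (1 - al / (q * be)))"
  define z where "z = al * be / a"
  have z: "a * t p * t p' = z" by (simp add: z_def tp)
  have r1: "rho a t p p' = z / q * ((\<Prod>m\<in>mids. q / be - 1 * t m) / e6) * D1"
    unfolding rho_def z D1_def inv[symmetric] by (simp add: tp)
  have g1: "gam a t p p' = q\<^sup>2 / z * (\<Prod>m\<in>mids. 1 - al / q * t m) * D2"
    unfolding gam_def z D2_def by (simp add: tp mult_ac)
  have l1: "lam a t p p' = (q - z) / be" unfolding lam_def z by (simp add: tp)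
  have r2: "rho (q / a) (dual t) p' p = 1 / z * (\<Prod>m\<in>mids. 1 - al * t m) * D1"
  proof -
    have "(\<Prod>m\<in>mids. 1 - q / (q / a * dual t p * dual t m)) = (\<Prod>m\<in>mids. 1 - al * t m)"
      by (intro prod.cong refl) (simp add: dual_def tp)
    thus ?thesis unfolding rho_def D1_def z_def by (simp add: dual_def tp)
  qed
  have g2: "gam (q / a) (dual t) p' p = q * z * ((\<Prod>m\<in>mids. 1 / be - 1 * t m) / e6) * D2"
  proof -
    have "(\<Prod>m\<in>mids. 1 - q / a * dual t m * dual t p' / q) = (\<Prod>m\<in>mids. 1 - 1 / be / t m)"
      by (intro prod.cong refl) (simp add: dual_def tp field_simps)
    thus ?thesis unfolding gam_def D2_def z_def inv by (simp add: dual_def tp power2_eq_square mult_ac)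
  qed
  have l2: "lam (q / a) (dual t) p' p = (1 - 1 / z) * al"
    unfolding lam_def z_def by (simp add: dual_def tp field_simps)
  note b1 = bet_formula[OF gen bal pp]
  note b2 = bet_formula[OF gen_dual[OF gen] balanced_dual[OF gen bal] movers_commute[OF pp]]
  have s2: "(\<Sum>m\<in>mids. dual t m) = i1" "(\<Sum>m\<in>mids. 1 / dual t m) = e1" by (simp_all add: dual_def i1_def e1_def)
  \<comment> \<open>\<open>K0\<close> to \<open>K5\<close> are the coefficients of \<open>1\<close>,
    \<open>e1\<close>, \<open>e2\<close>, \<open>e3\<close>, \<open>e4\<close> and
    \<open>i1\<close>, up to sign; the fifth elementary symmetric function appears as
    \<open>e6 * i1\<close>.\<close>
  have K0: "z / q * ((q / be) ^ 6 / e6 + 1) * D1 + q\<^sup>2 / z * (1 + e6 * (al / q) ^ 6) * D2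
     - 1 / z * (1 + e6 * al ^ 6) * D1 - q * z * ((1 / be) ^ 6 / e6 + 1) * D2
     + (q - z) / be * ((al + be) / q - q * a / al - q * a / be) - (1 - 1 / z) * al * (1 / al + 1 / be - q * al / a - q * be / a) = 0"
    unfolding z_def e6 D1_def D2_def using u by (simp add: divide_simps) (simp add: algebra_simps eval_nat_numeral)
  have K1: "z / q * ((q / be) ^ 5 / e6) * D1 + q\<^sup>2 / z * (al / q) * D2 - 1 / z * al * D1 - q * z * ((1 / be) ^ 5 / e6) * D2
     - (q - z) / be * a - (1 - 1 / z) * al = 0"
    unfolding z_def e6 D1_def D2_def using u by (simp add: divide_simps) (simp add: algebra_simps eval_nat_numeral)
  have K2: "z / q * ((q / be) ^ 4 / e6) * D1 + q\<^sup>2 / z * (al / q) ^ 2 * D2 - 1 / z * al ^ 2 * D1 - q * z * ((1 / be) ^ 4 / e6) * D2 = 0"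
    unfolding z_def e6 D1_def D2_def using u by (simp add: divide_simps) (simp add: algebra_simps eval_nat_numeral)
  have K3: "z / q * ((q / be) ^ 3 / e6) * D1 + q\<^sup>2 / z * (al / q) ^ 3 * D2 - 1 / z * al ^ 3 * D1 - q * z * ((1 / be) ^ 3 / e6) * D2 = 0"
    unfolding z_def e6 D1_def D2_def using u by (simp add: divide_simps) (simp add: algebra_simps eval_nat_numeral)
  have K4: "z / q * ((q / be) ^ 2 / e6) * D1 + q\<^sup>2 / z * (al / q) ^ 4 * D2 - 1 / z * al ^ 4 * D1 - q * z * ((1 / be) ^ 2 / e6) * D2 = 0"
    unfolding z_def e6 D1_def D2_def using u by (simp add: divide_simps) (simp add: algebra_simps eval_nat_numeral)
  have K5: "z / q * (q / be) * D1 + q\<^sup>2 / z * (e6 * (al / q) ^ 5) * D2 - 1 / z * (e6 * al ^ 5) * D1 - q * z * (1 / be) * D2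
     + (q - z) / be + (1 - 1 / z) * al * (q / a) = 0"
    unfolding z_def e6 D1_def D2_def using u by (simp add: divide_simps) (simp add: algebra_simps eval_nat_numeral)
  have e6nz: "e6 \<noteq> 0" by (simp add: e6)
  have "bet a t p p' - bet (q / a) (dual t) p' p =
    (z / q * ((q / be) ^ 6 / e6 + 1) * D1 + q\<^sup>2 / z * (1 + e6 * (al / q) ^ 6) * D2
     - 1 / z * (1 + e6 * al ^ 6) * D1 - q * z * ((1 / be) ^ 6 / e6 + 1) * D2
     + (q - z) / be * ((al + be) / q - q * a / al - q * a / be) - (1 - 1 / z) * al * (1 / al + 1 / be - q * al / a - q * be / a))
    - e1 * (z / q * ((q / be) ^ 5 / e6) * D1 + q\<^sup>2 / z * (al / q) * D2 - 1 / z * al * D1 - q * z * ((1 / be) ^ 5 / e6) * D2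
     - (q - z) / be * a - (1 - 1 / z) * al)
    + e2 * (z / q * ((q / be) ^ 4 / e6) * D1 + q\<^sup>2 / z * (al / q) ^ 2 * D2 - 1 / z * al ^ 2 * D1 - q * z * ((1 / be) ^ 4 / e6) * D2)
    - e3 * (z / q * ((q / be) ^ 3 / e6) * D1 + q\<^sup>2 / z * (al / q) ^ 3 * D2 - 1 / z * al ^ 3 * D1 - q * z * ((1 / be) ^ 3 / e6) * D2)
    + e4 * (z / q * ((q / be) ^ 2 / e6) * D1 + q\<^sup>2 / z * (al / q) ^ 4 * D2 - 1 / z * al ^ 4 * D1 - q * z * ((1 / be) ^ 2 / e6) * D2)
    - i1 * (z / q * (q / be) * D1 + q\<^sup>2 / z * (e6 * (al / q) ^ 5) * D2 - 1 / z * (e6 * al ^ 5) * D1 - q * z * (1 / be) * D2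
     + (q - z) / be + (1 - 1 / z) * al * (q / a))"
  proof -
    have X: "(c0 - e1 * c1 + e2 * c2 - e3 * c3 + e4 * c4 - e6 * i1 * c5 + e6 * c6) / e6 =
       c0 / e6 + c6 - e1 * (c1 / e6) + e2 * (c2 / e6) - e3 * (c3 / e6) + e4 * (c4 / e6) - i1 * c5" for c0 c1 c2 c3 c4 c5 c6
      using e6nz by (simp add: field_simps)
    have Y: "a * (t p + t p') / q = (al + be) / q" "q / t p = q * a / al" "q / t p' = q * a / be"
      "q / a * (dual t p' + dual t p) / q = 1 / al + 1 / be" "q / dual t p' = q * be / a" "q / dual t p = q * al / a"
      by (simp_all add: tp dual_def field_simps)
    show ?thesis
      unfolding b1 b2 r1 g1 l1 r2 g2 l2 s2 e1_def[symmetric] i1_def[symmetric] E X Y by (simp add: algebra_simps diff_divide_distrib)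
  qed
  also have "\<dots> = 0" unfolding K0 K1 K2 K3 K4 K5 by simp
  finally show ?thesis by simp
qed

text \<open>Duality makes the two products over the fixed coordinates trade places: the one in
  \<open>rho\<close> moves into \<open>gam\<close> and conversely, so the product of both is
  unchanged.\<close>

lemma rho_gam_dual:
  assumes gen: "gen a t" and bal: "balanced a t" and pp: "movers p p'"
  shows "rho (q / a) (dual (shift p p' (-1) t)) p' p * gam (q / a) (dual t) p' p =
    rho a (shift p p' (-1) t) p p' * gam a t p p'"
proof -
  have p8: "p < 8" "p' < 8" "p \<noteq> p'" using pp by (auto simp: movers_def)
  have nz [simp]: "t p \<noteq> 0" "t p' \<noteq> 0" "a \<noteq> 0" "q \<noteq> 0" using genD[OF gen] p8 q_nz by auto
  have tm: "t m \<noteq> 0" if "m \<in> mids" for m using genD(2)[OF gen mids_less[OF that]] .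
  define P where "P = (\<Prod>m\<in>mids. 1 - 1 / (a * t p' * t m))"
  define Q where "Q = (\<Prod>m\<in>mids. 1 - a * t m * t p / q)"
  define s where "s = shift p p' (-1) t"
  have s: "s p = t p / q" "s p' = t p' * q" using p8 by (simp_all add: s_def power_int_minus divide_inverse)
  have sm: "s m = t m" if "m \<in> mids" for m using that pp by (simp add: s_def shift_mid)
  have 1: "(\<Prod>m\<in>mids. 1 - q / (q / a * dual s p * dual s m)) = Q"
    unfolding Q_def by (intro prod.cong refl) (simp add: dual_def s sm tm field_simps)
  have 2: "(\<Prod>m\<in>mids. 1 - q / a * dual t m * dual t p' / q) = P"
    unfolding P_def by (intro prod.cong refl) (simp add: dual_def tm field_simps)
  have 3: "(\<Prod>m\<in>mids. 1 - q / (a * s p' * s m)) = P"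
    unfolding P_def by (intro prod.cong refl) (simp add: s sm tm field_simps)
  show ?thesis
    unfolding s_def[symmetric] rho_def gam_def 1 2 3 Q_def[symmetric]
    by (simp add: dual_def s mult_ac power2_eq_square)
qed

end

section \<open>The sixteen families in octet coordinates\<close>

text \<open>\<open>c\<close> chooses the octet or its dual and \<open>T\<close> the coordinate at
  which the first series of \<open>Phi\<close> starts, which accounts for the sixteen families as 2
  times 8.\<close>

definition fam :: "bool \<Rightarrow> nat \<Rightarrow> family" where
  "fam c T = (if c then (if T = 7 then X1 else if T = 5 then X3 else if T = 6 then X6 else X7 T)
     else (if T = 7 then X2 else if T = 5 then X4 else if T = 6 then X5 else X8 T))"

text \<open>The order of the other seven coordinates that reproduces the parameter lists of
  \<open>family_data\<close>. For a letter \<open>T\<close>, position \<open>T\<close> holds the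
  coordinate 7: since \<open>t 7 = 1\<close>, its parameter is the letter \<open>r\<close>, or
  \<open>q / r\<close> in the dual.\<close>

definition fidx :: "nat \<Rightarrow> nat list" where
  "fidx T = (if T = 7 then [0, 1, 2, 3, 4, 5, 6] else if T = 5 then [6, 0, 1, 2, 3, 4, 7]
     else if T = 6 then [5, 0, 1, 2, 3, 4, 7] else [0, 1, 2, 3, 4, 5, 6][T := 7])"

lemma less_8_cases: "(T::nat) < 8 \<longleftrightarrow> T = 0 \<or> T = 1 \<or> T = 2 \<or> T = 3 \<or> T = 4 \<or> T = 5 \<or> T = 6 \<or> T = 7"
  by auto

lemma lessThan_8: "{..<8::nat} = {0, 1, 2, 3, 4, 5, 6, 7}"
  by auto

lemma card_mids: "card mids = 6" by (simp add: mids_def)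

lemma is_idx_fidx: "T < 8 \<Longrightarrow> is_idx T (fidx T)"
  unfolding less_8_cases is_idx_def fidx_def lessThan_8 by (elim disjE) auto

lemma families_eq: "families = {fam c T | c T. T < 8}"
proof -
  have "{..<5::nat} = {0, 1, 2, 3, 4}" by auto
  thus ?thesis unfolding families_def
    by (auto simp: fam_def less_8_cases ex_disj_distrib conj_disj_distribL conj_disj_distribR)
qed

text \<open>The coordinate multiplied by \<open>q\<close> when \<open>n\<close> grows: 5 in the
  octet, but 6 in the dual, whose coordinates are reciprocals.\<close>

definition mover :: "bool \<Rightarrow> nat" where "mover c = (if c then 5 else 6)"

lemma movers_mover [simp]: "movers (mover c) (mover (\<not> c))"
  by (simp add: movers_def mover_def)

context q_base
begin

definition oct :: "complex \<Rightarrow> complex list \<Rightarrow> complex \<Rightarrow> int \<Rightarrow> nat \<Rightarrow> complex" where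
  "oct a bs h n U = (if U < 5 then bs ! U / a else if U = 5 then s_of q a bs * q powi (n - 1) / (a * h)
     else if U = 6 then h * q powi (- n) / a else 1)"

definition base :: "bool \<Rightarrow> complex \<Rightarrow> complex" where "base c a = (if c then a else q / a)"

definition octc :: "bool \<Rightarrow> complex \<Rightarrow> complex list \<Rightarrow> complex \<Rightarrow> int \<Rightarrow> nat \<Rightarrow> complex" where
  "octc c a bs h n = (if c then oct a bs h n else dual (oct a bs h n))"

text \<open>The infinite products of the families in octet coordinates have three shapes: the
  leading coordinate rises with \<open>n\<close> (\<open>X3\<close>, \<open>X5\<close>), falls
  (\<open>X4\<close>, \<open>X6\<close>) or is fixed (\<open>X1\<close>, \<open>X2\<close>,
  \<open>X7\<close>, \<open>X8\<close>).\<close>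

definition pnum :: "complex \<Rightarrow> (nat \<Rightarrow> complex) \<Rightarrow> nat \<Rightarrow> nat \<Rightarrow> nat \<Rightarrow> complex" where
  "pnum a t p p' T =
     (if T = p then qi (t p / t p') * qi (q * t p / t p') * (\<Prod>m\<in>mids. qi (q * t p / t m))
      else if T = p' then qi (1 / (a * t p' * t p'))
      else qi (t p / t p') * qi (q * t T / t p'))"

definition pden :: "complex \<Rightarrow> (nat \<Rightarrow> complex) \<Rightarrow> nat \<Rightarrow> nat \<Rightarrow> nat \<Rightarrow> complex" where
  "pden a t p p' T =
     (if T = p then qi (q * (a * t p * t p)) * (\<Prod>m\<in>mids. qi (a * t p * t m)) * (\<Prod>m\<in>mids. qi (q / (a * t p' * t m)))
      else if T = p' then (\<Prod>m\<in>mids. qi (t m / t p'))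
      else qi (a * t p * t T) * qi (t p / t T) * (\<Prod>m\<in>mids - {T}. qi (q / (a * t p' * t m))))"

definition pgeo :: "complex \<Rightarrow> (nat \<Rightarrow> complex) \<Rightarrow> nat \<Rightarrow> nat \<Rightarrow> nat \<Rightarrow> int \<Rightarrow> complex" where
  "pgeo a t p p' T n = (if T = p \<or> T = p' then (a * t p * t p') powi n else 1)"

lemma mids_diff:
  "mids - {0} = {1, 2, 3, 4, 7}" "mids - {1} = {0, 2, 3, 4, 7}" "mids - {Suc 0} = {0, 2, 3, 4, 7}"
  "mids - {2} = {0, 1, 3, 4, 7}"
  "mids - {3} = {0, 1, 2, 4, 7}" "mids - {4} = {0, 1, 2, 3, 7}" "mids - {7} = {0, 1, 2, 3, 4}"
  by (auto simp: mids_def)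

lemma fam_data:
  fixes c :: bool and n :: int
  assumes nz: "a \<noteq> 0" "b0 \<noteq> 0" "b1 \<noteq> 0" "b2 \<noteq> 0" "b3 \<noteq> 0" "b4 \<noteq> 0" "h \<noteq> 0" and T: "T < 8"
  defines "bs \<equiv> [b0, b1, b2, b3, b4]"
  defines "t \<equiv> \<lambda>n. octc c a bs h n" and "a' \<equiv> base c a" and "p \<equiv> mover c" and "p' \<equiv> mover (\<not> c)"
  shows "\<exists>us vs. family_data q a bs h (fam c T) n =
      (pgeo a' (t n) p p' T n, us, vs, a' * (t n T)\<^sup>2, opars a' (t n) T (fidx T)) \<and>
      qpochs_inf q us = pnum a' (t n) p p' T \<and> qpochs_inf q vs = pden a' (t n) p p' T"
proof -
  define Q where "Q = q powi n"
  define s where "s = s_of q a bs"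
  have Qnz [simp]: "Q \<noteq> 0" "q \<noteq> 0" using q_nz by (auto simp: Q_def)
  have s_nz [simp]: "s \<noteq> 0" using nz q_nz by (simp add: s_def s_of_def bs_def)
  have len: "length bs = 5" "[0..<5] = [0, 1, 2, 3, 4::nat]" by (simp_all add: bs_def upt_rec)
  have bsn: "bs ! 0 = b0" "bs ! 1 = b1" "bs ! Suc 0 = b1" "bs ! 2 = b2" "bs ! 3 = b3" "bs ! 4 = b4"
    by (simp_all add: bs_def)
  have Q2: "q powi (2 * n) = Q\<^sup>2" "q powi (n * 2) = Q\<^sup>2" by (simp_all add: Q_def mult.commute power_int_mult)
  have pw: "q powi (n - 1) = Q / q" "q powi (n + 1) = Q * q" "q powi (2 * n - 1) = Q\<^sup>2 / q"
    "q powi (2 * n - 2) = Q\<^sup>2 / q\<^sup>2" "q powi (2 * n - 3) = Q\<^sup>2 / q ^ 3" "q powi (2 * n + 1) = Q\<^sup>2 * q"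
    "q powi (2 * n + 2) = Q\<^sup>2 * q\<^sup>2" "q powi (- n) = 1 / Q" "q powi (- n + 2) = q\<^sup>2 / Q"
    "q powi (- 2 * n) = 1 / Q\<^sup>2" "q powi (- 2 * n + 3) = q ^ 3 / Q\<^sup>2" "q powi n = Q"
    using Q2 by (simp_all add: power_int_diff power_int_add power_int_minus divide_inverse Q_def)
  have pw': "q powi (1 + n) = Q * q" "q powi (n * 2 - 1) = Q\<^sup>2 / q"
    "q powi (n * 2 - 2) = Q\<^sup>2 / q\<^sup>2" "q powi (n * 2 - 3) = Q\<^sup>2 / q ^ 3" "q powi (1 + n * 2) = Q\<^sup>2 * q"
    "q powi (2 + n * 2) = Q\<^sup>2 * q\<^sup>2" "q powi (2 - n) = q\<^sup>2 / Q" "q powi (- (n * 2)) = 1 / Q\<^sup>2" "q powi (3 - n * 2) = q ^ 3 / Q\<^sup>2"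
    "q powi (n * 2) = Q\<^sup>2"
    using Q2 by (simp_all add: power_int_diff power_int_add power_int_minus divide_inverse Q_def)
  have bse: "(bs = [b0, b1, b2, b3, b4]) = True" by (simp add: bs_def)
  have mp: "map f bs = [f b0, f b1, f b2, f b3, f b4]" for f :: "complex \<Rightarrow> complex" by (simp add: bs_def)
  have th: "oct a bs h n 0 = b0 / a" "oct a bs h n 1 = b1 / a" "oct a bs h n (Suc 0) = b1 / a" "oct a bs h n 2 = b2 / a"
    "oct a bs h n 3 = b3 / a" "oct a bs h n 4 = b4 / a" "oct a bs h n 5 = s * Q / (q * a * h)"
    "oct a bs h n 6 = h / (a * Q)" "oct a bs h n 7 = 1"
    by (simp_all add: oct_def bsn s_def[symmetric] pw)
  show ?thesis
  proof (cases c)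
    case True
    show ?thesis using T True nz unfolding less_8_cases
      unfolding t_def a'_def p_def p'_def octc_def base_def fam_def
      by (elim disjE)
        (simp_all add: Let_def s_def[symmetric] pw th bsn len mover_def opars_def fidx_def pnum_def pden_def pgeo_def
          qpochs_inf_def prod_mids mids_diff others_def field_simps power2_eq_square pw' mp bse)
  next
    case False
    show ?thesis using T False nz unfolding less_8_cases
      unfolding t_def a'_def p_def p'_def octc_def base_def fam_def
      by (elim disjE)
        (simp_all add: Let_def s_def[symmetric] pw th bsn len mover_def opars_def fidx_def pnum_def pden_def pgeo_def
          qpochs_inf_def prod_mids mids_diff others_def field_simps power2_eq_square dual_def pw' mp bse power3_eq_cube)
  qed
qed

lemma int_constantI:
  fixes f :: "int \<Rightarrow> complex"
  assumes "\<And>n. f (n + 1) = f n" shows "f n = f 0"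
proof (induction n rule: int_induct[of _ 0])
  case (step1 i)
  thus ?case using assms[of i] by simp
next
  case (step2 i)
  thus ?case using assms[of "i - 1"] by simp
qed auto

lemma qtheta_step': "x \<noteq> 0 \<Longrightarrow> qtheta (x / q) = - (x / q) * qtheta x"
  using qtheta_step[of "x / q"] q_nz by simp

lemma mid_nz:
  assumes "gen a t" "movers p p'"
  shows "m \<in> mids \<Longrightarrow> qi (a * t p * t m) \<noteq> 0" "m \<in> mids \<Longrightarrow> qi (q / (a * t p' * t m)) \<noteq> 0"
    "m \<in> mids \<Longrightarrow> t m \<noteq> 0"
proof -
  assume "m \<in> mids"
  hence m: "m < 8" by (rule mids_less)
  have p8: "p < 8" "p' < 8" "p \<noteq> p'" using assms(2) by (auto simp: movers_def)
  show "qi (a * t p * t m) \<noteq> 0" by (rule qi_nz, rule genD(3)[OF assms(1) p8(1) m])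
  show "t m \<noteq> 0" by (rule genD(2)[OF assms(1) m])
  show "qi (q / (a * t p' * t m)) \<noteq> 0"
  proof (rule qi_nz)
    fix k show "q / (a * t p' * t m) \<noteq> q powi k"
      using genD(3)[OF assms(1) p8(2) m, of "1 - k"] genD[OF assms(1)] p8 m q_nz
      by (auto simp: power_int_diff field_simps)
  qed
qed

section \<open>The prefactors of the families compared with the common gauge factor\<close>

definition prefactor :: "complex \<Rightarrow> (nat \<Rightarrow> complex) \<Rightarrow> nat \<Rightarrow> nat \<Rightarrow> nat \<Rightarrow> int \<Rightarrow> complex" where
  "prefactor a t p p' T n = pgeo a t p p' T n *
     (pnum a (shift p p' n t) p p' T / pden a (shift p p' n t) p p' T)"

text \<open>Dividing by the gauge factor and by the first term completes each \<open>qi x\<close>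
  depending on a mover to \<open>qtheta x\<close>, or cancels it. The result therefore changes under
  \<open>n \<mapsto> n + 1\<close> by an elementary factor.\<close>

lemma prefactor_mid:
  assumes gen: "gen a s" and pp: "movers p p'" and T: "T \<in> mids"
  shows "pnum a s p p' T / pden a s p p' T * (\<Prod>m\<in>mids. qi (q / (a * s p' * s m))) / qi (s p / s p') / fterm a s (s T) =
    qtheta (a * s p' * s T) / qtheta (s p / s T) /
    (s T * (1 - a * (s T)\<^sup>2) * (\<Prod>m\<in>mids. qi (q * s T / s m) / qi (a * s T * s m)))"
proof -
  have p8: "p < 8" "p' < 8" "p \<noteq> p'" "T < 8" "T \<noteq> p" "T \<noteq> p'" using pp T movers_octet[OF pp] mids_less by auto
  have u: "qi (s p / s p') \<noteq> 0" by (rule qi_nz, rule genD(4)[OF gen p8(1-3)])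
  define P where "P = (\<Prod>m\<in>mids - {T}. qi (q / (a * s p' * s m)))"
  have P: "P \<noteq> 0" unfolding P_def using mid_nz(2)[OF gen pp] by auto
  have all: "(\<Prod>m\<in>mids. qi (q / (a * s p' * s m))) = qi (q / (a * s p' * s T)) * P"
    unfolding P_def by (rule prod.remove) (use T in auto)
  have z: "qi (q * s T / s p') \<noteq> 0" "qi (a * s p * s T) \<noteq> 0"
    by (rule qi_nz, rule notin_powers_shift[OF genD(4)[OF gen p8(4,2,6)], of _ 1], simp)
       (rule qi_nz, rule genD(3)[OF gen p8(1,4)])
  define M where "M = (\<Prod>m\<in>mids. qi (q * s T / s m) / qi (a * s T * s m))"
  have f: "fterm a s (s T) = s T * (1 - a * (s T)\<^sup>2) * (qi (q * s T / s p) / qi (a * s p * s T) * (qi (q * s T / s p') / qi (a * s p' * s T)) * M)"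
    unfolding fterm_def prod_octet[OF pp] M_def by (simp add: mult_ac)
  have e: "q / (s p / s T) = q * s T / s p" by simp
  have aux: "(U * Z / (X * Y * P)) * (W * P) / U / (k * ((A / X) * (Z / B) * M)) = (B * W) / (Y * A) / (k * M)"
    if "U \<noteq> 0" "Z \<noteq> 0" "X \<noteq> 0" "P \<noteq> 0" for U Z X Y P W k A B M :: complex using that by (simp add: mult_ac)
  show ?thesis unfolding pnum_def pden_def f all qtheta_def e P_def[symmetric] M_def[symmetric]
    using p8 by (simp only: if_False) (rule aux[OF u z P])
qed

text \<open>For the rising coordinate everything cancels except \<open>1 / s p\<close> and a factor
  depending on the invariant product \<open>a * s p * s p'\<close>; the former is absorbed by the
  geometric factor.\<close>

lemma prefactor_up:
  assumes gen: "gen a s" and pp: "movers p p'"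
  shows "pnum a s p p' p / pden a s p p' p * (\<Prod>m\<in>mids. qi (q / (a * s p' * s m))) / qi (s p / s p') / fterm a s (s p) =
    qi (a * s p * s p') / qi q / s p"
proof -
  have p8: "p < 8" "p' < 8" "p \<noteq> p'" using pp movers_octet[OF pp] by auto
  have u: "qi (s p / s p') \<noteq> 0" "qi (q * s p / s p') \<noteq> 0"
    by (rule qi_nz, rule genD(4)[OF gen p8(1-3)])
       (rule qi_nz, rule notin_powers_shift[OF genD(4)[OF gen p8(1-3)], of _ 1], simp)
  define P where "P = (\<Prod>m\<in>mids. qi (q / (a * s p' * s m)))"
  define A where "A = (\<Prod>m\<in>mids. qi (q * s p / s m))"
  define B where "B = (\<Prod>m\<in>mids. qi (a * s p * s m))"
  have nz: "P \<noteq> 0" "B \<noteq> 0" unfolding P_def B_def using mid_nz[OF gen pp] by auto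
  have "qi (q * s p / s m) \<noteq> 0" if m: "m \<in> mids" for m
  proof -
    have "p \<noteq> m" using m movers_octet[OF pp] by auto
    show "qi (q * s p / s m) \<noteq> 0"
      by (rule qi_nz, rule notin_powers_shift[OF genD(4)[OF gen p8(1) mids_less[OF m] \<open>p \<noteq> m\<close>], of _ 1]) simp
  qed
  hence A: "A \<noteq> 0" by (simp add: A_def)
  have sp: "s p \<noteq> 0" using genD(2)[OF gen p8(1)] .
  have sq: "1 - a * s p * s p \<noteq> 0" "qi (a * s p * s p) = (1 - a * s p * s p) * qi (q * (a * s p * s p))"
    "qi (q * (a * s p * s p)) \<noteq> 0"
    using genD(3)[OF gen p8(1,1), of 0] qi_step[of "a * s p * s p"] qi_nz[OF genD(3)[OF gen p8(1,1)]] by auto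
  have f: "fterm a s (s p) = s p * (1 - a * s p * s p) * (qi q / ((1 - a * s p * s p) * qi (q * (a * s p * s p))) * (qi (q * s p / s p') / qi (a * s p * s p')) * (A / B))"
    unfolding fterm_def prod_octet[OF pp] A_def B_def prod_dividef sq(2)[symmetric] using sp by (simp add: power2_eq_square mult.assoc)
  have aux: "(U * V * A) / (S * B * P) * P / U / (k * d * (c / (d * S) * (V / Z) * (A / B))) = Z / c / k"
    if "U \<noteq> 0" "V \<noteq> 0" "A \<noteq> 0" "S \<noteq> 0" "B \<noteq> 0" "P \<noteq> 0" "d \<noteq> 0" for U V A S B P k d c Z :: complex using that by simp
  show ?thesis unfolding pnum_def pden_def f A_def[symmetric] B_def[symmetric] P_def[symmetric]
    by (simp only: if_True simp_thms) (rule aux[OF u A sq(3) nz(2,1) sq(1)])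
qed

text \<open>For the falling coordinate nothing of the theta functions cancels: fourteen of them
  remain, and the constancy in \<open>n\<close> rests on the product of all their
  multipliers.\<close>

lemma prefactor_down:
  assumes gen: "gen a s" and pp: "movers p p'"
  shows "pnum a s p p' p' / pden a s p p' p' * (\<Prod>m\<in>mids. qi (q / (a * s p' * s m))) / qi (s p / s p') / fterm a s (s p') =
    qtheta (1 / (a * s p' * s p')) * (\<Prod>m\<in>mids. qtheta (a * s p' * s m)) * qi (a * s p * s p') /
     (qi q * s p' * qtheta (s p / s p') * (\<Prod>m\<in>mids. qtheta (s m / s p')))"
proof -
  have p8: "p < 8" "p' < 8" "p \<noteq> p'" using pp movers_octet[OF pp] by auto
  have sp: "s p' \<noteq> 0" using genD(2)[OF gen p8(2)] .
  have a: "a \<noteq> 0" using genD(1)[OF gen] .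
  have sq: "1 - a * s p' * s p' \<noteq> 0" "qi (a * s p' * s p') = (1 - a * s p' * s p') * qi (q * (a * s p' * s p'))"
    "qi (q * (a * s p' * s p')) \<noteq> 0"
    using genD(3)[OF gen p8(2,2), of 0] qi_step[of "a * s p' * s p'"] qi_nz[OF genD(3)[OF gen p8(2,2)]] by auto
  define A where "A = (\<Prod>m\<in>mids. qi (q * s p' / s m))"
  define B where "B = (\<Prod>m\<in>mids. qi (a * s p' * s m))"
  define P where "P = (\<Prod>m\<in>mids. qi (q / (a * s p' * s m)))"
  define D where "D = (\<Prod>m\<in>mids. qi (s m / s p'))"
  have f: "fterm a s (s p') = s p' * (1 - a * s p' * s p') * ((qi (q * s p' / s p) / qi (a * s p * s p')) * (qi q / ((1 - a * s p' * s p') * qi (q * (a * s p' * s p')))) * (A / B))"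
    unfolding fterm_def prod_octet[OF pp] A_def B_def prod_dividef sq(2)[symmetric] using sp by (simp add: power2_eq_square mult.assoc) (simp add: mult_ac)
  have e: "q / (s p / s p') = q * s p' / s p" "q / (1 / (a * s p' * s p')) = q * (a * s p' * s p')" by simp_all
  have t1: "(\<Prod>m\<in>mids. qtheta (a * s p' * s m)) = B * P" unfolding qtheta_def prod.distrib B_def P_def ..
  have t2: "(\<Prod>m\<in>mids. qtheta (s m / s p')) = D * A" unfolding qtheta_def prod.distrib D_def A_def by simp
  have np: "p' \<noteq> p" using p8 by simp
  have aux: "N / D * P / U / (k * d * ((V / Z) * (c / (d * S)) * (A / B))) = N * S * (B * P) * Z / (c * k * (U * V) * (D * A))"
    if "d \<noteq> 0" for N D P U k d V Z c S A B :: complex using that by (simp add: mult_ac)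
  show ?thesis unfolding pnum_def pden_def f A_def[symmetric] P_def[symmetric] D_def[symmetric] t1 t2
    unfolding qtheta_def e
    using np by (simp only: if_True if_False simp_thms) (rule aux[OF sq(1)])
qed

lemma pnum_pden_nz:
  assumes gen: "gen a t" and pp: "movers p p'" and T: "T < 8"
  shows "pnum a t p p' T \<noteq> 0" "pden a t p p' T \<noteq> 0"
proof -
  have p8: "p < 8" "p' < 8" "p \<noteq> p'" using pp movers_octet[OF pp] by auto
  have u: "qi (t p / t p') \<noteq> 0" "qi (q * t p / t p') \<noteq> 0"
    by (rule qi_nz, rule genD(4)[OF gen p8(1-3)])
       (rule qi_nz, rule notin_powers_shift[OF genD(4)[OF gen p8(1-3)], of _ 1], simp)
  have r: "qi (t U / t V) \<noteq> 0" "qi (q * t U / t V) \<noteq> 0" if "U < 8" "V < 8" "U \<noteq> V" for U V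
    by (rule qi_nz, rule genD(4)[OF gen that])
       (rule qi_nz, rule notin_powers_shift[OF genD(4)[OF gen that], of _ 1], simp)
  have z: "qi (a * t U * t V) \<noteq> 0" "qi (q * (a * t U * t V)) \<noteq> 0" "qi (1 / (a * t U * t V)) \<noteq> 0" if "U < 8" "V < 8" for U V
  proof -
    show "qi (a * t U * t V) \<noteq> 0" by (rule qi_nz, rule genD(3)[OF gen that])
    show "qi (q * (a * t U * t V)) \<noteq> 0" by (rule qi_nz, rule notin_powers_shift[OF genD(3)[OF gen that], of _ 1]) simp
    show "qi (1 / (a * t U * t V)) \<noteq> 0"
    proof (rule qi_nz)
      fix k show "1 / (a * t U * t V) \<noteq> q powi k"
        using genD(3)[OF gen that, of "-k"] q_nz genD(1,2)[OF gen] that by (auto simp: power_int_minus field_simps)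
    qed
  qed
  have np: "m \<noteq> p" "m \<noteq> p'" "p \<noteq> m" "p' \<noteq> m" "m < 8" if "m \<in> mids" for m
    using that movers_octet[OF pp] mids_less by auto
  show "pnum a t p p' T \<noteq> 0"
    unfolding pnum_def using u r z np mid_nz[OF gen pp] T p8 by auto
  show "pden a t p p' T \<noteq> 0"
    unfolding pden_def using u r z np mid_nz[OF gen pp] T p8 by auto
qed

text \<open>This explains the infinite products in the statement: together with the first term of
  the series they amount to the gauge factor \<open>mu\<close>, up to a constant, so all families of
  a class share one gauge.\<close>

lemma prefactor_const:
  assumes gen: "gen a t" and bal: "balanced a t" and pp: "movers p p'" and T: "T < 8"
  shows "\<exists>K. K \<noteq> 0 \<and> (\<forall>n. prefactor a t p p' T n / fterm a (shift p p' n t) (shift p p' n t T) = K * mu a t p p' n)"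
proof -
  have p8: "p < 8" "p' < 8" "p \<noteq> p'" using pp movers_octet[OF pp] by auto
  define s where "s = (\<lambda>n. shift p p' n t)"
  have sd: "shift p p' n t = s n" for n by (simp add: s_def)
  define w where "w = a * t p * t p' / q"
  have gs: "gen a (s n)" for n unfolding s_def by (rule gen_shift[OF gen])
  note g0 = genD(2)[OF gen]
  have nz: "t p \<noteq> 0" "t p' \<noteq> 0" "a \<noteq> 0" "q \<noteq> 0" "w \<noteq> 0"
    using g0[OF p8(1)] g0[OF p8(2)] genD(1)[OF gen] q_nz by (auto simp: w_def)
  have sm: "s n m = t m" if "m \<in> mids" for m n unfolding s_def by (rule shift_mid[OF pp that])
  have s1: "s (n + 1) p = s n p * q" "s (n + 1) p' = s n p' / q" for n
    using p8 nz by (simp_all add: s_def power_int_add_1 power_int_diff power_int_minus divide_inverse)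
  have snz: "s n p \<noteq> 0" "s n p' \<noteq> 0" for n using genD(2)[OF gs[of n]] p8 by auto
  have szz: "a * s n p * s n p' = q * w" for n
    using p8 nz by (simp add: s_def w_def power_int_minus)
  define R where "R = (\<lambda>n. pnum a (s n) p p' T / pden a (s n) p p' T * (\<Prod>m\<in>mids. qi (q / (a * s n p' * s n m))) / qi (s n p / s n p') / fterm a (s n) (s n T))"
  \<comment> \<open>The quotient that has to be constant in \<open>n\<close>. For a fixed
    \<open>T\<close> the two theta multipliers yield exactly the factor \<open>w\<close>; for the
    rising coordinate a power of \<open>q\<close> meets \<open>1 / s p\<close>.\<close>
  define G where "G = (\<lambda>n. pgeo a t p p' T n / w powi n * R n)"
  have mu: "mu a t p p' n = w powi n * qi (s n p / s n p') / (\<Prod>m\<in>mids. qi (q / (a * s n p' * s n m)))" for n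
    unfolding mu_def sd w_def[symmetric] by (simp add: sm)
  have qu: "qi (s n p / s n p') \<noteq> 0" for n by (rule qi_nz, rule genD(4)[OF gs p8(1-3)])
  have Pn: "(\<Prod>m\<in>mids. qi (q / (a * s n p' * s n m))) \<noteq> 0" for n using mid_nz(2)[OF gs pp] by auto
  have pref: "prefactor a t p p' T n / fterm a (s n) (s n T) = G n * mu a t p p' n" for n
    unfolding G_def R_def mu prefactor_def sd using qu Pn nz(5) by simp
  have Gstep: "G (n + 1) = G n" for n
  proof -
    consider "T \<in> mids" | "T = p" | "T = p'" using T movers_octet(1)[OF pp] by auto
    thus ?thesis
    proof cases
      case 1
      hence pg: "pgeo a t p p' T n = 1" for n using movers_octet[OF pp] by (auto simp: pgeo_def)
      have tT: "t T \<noteq> 0" using g0[OF T] .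
      define k where "k = (t T * (1 - a * (t T)\<^sup>2) * (\<Prod>m\<in>mids. qi (q * t T / t m) / qi (a * t T * t m)))"
      have G: "G n = (1 / w powi n) * (qtheta (a * s n p' * t T) / qtheta (s n p / t T) / k)" for n
        unfolding G_def R_def prefactor_mid[OF gs pp 1] pg k_def by (simp add: sm 1)
      have a1: "qtheta (a * s (n + 1) p' * t T) = - (a * s n p' * t T / q) * qtheta (a * s n p' * t T)"
        using qtheta_step'[of "a * s n p' * t T"] nz snz tT by (simp add: s1)
      have a2: "qtheta (s (n + 1) p / t T) = - qtheta (s n p / t T) / (s n p / t T)"
        using qtheta_step[of "s n p / t T"] snz tT by (simp add: s1 mult.commute)
      have a3: "w powi (n + 1) = w powi n * (a * s n p * s n p' / q)"
        unfolding szz using nz by (simp add: power_int_add_1)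
      show ?thesis unfolding G a1 a2 a3 using nz snz[of n] tT by (simp add: field_simps)
    next
      case 2
      have pg: "pgeo a t p p' T n = (q * w) powi n" for n using 2 nz by (simp add: pgeo_def w_def)
      have G: "G n = q powi n * (qi (q * w) / qi q / s n p)" for n
        unfolding G_def R_def 2 prefactor_up[OF gs pp] pg[unfolded 2] szz using nz by (simp add: power_int_mult_distrib)
      show ?thesis unfolding G s1 using nz snz[of n] by (simp add: power_int_add_1)
    next
      case 3
      have pg: "pgeo a t p p' T n = (q * w) powi n" for n using 3 nz by (simp add: pgeo_def w_def)
      have G: "G n = q powi n * (qtheta (1 / (a * s n p' * s n p')) * (\<Prod>m\<in>mids. qtheta (a * s n p' * t m)) * qi (q * w) /
         (qi q * s n p' * qtheta (s n p / s n p') * (\<Prod>m\<in>mids. qtheta (t m / s n p'))))" for n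
        unfolding G_def R_def 3 prefactor_down[OF gs pp] pg[unfolded 3] szz using nz by (simp add: power_int_mult_distrib sm)
      define x y u where "x = s n p'" and "y = s n p" and "u = s n p / s n p'"
      have xy: "x \<noteq> 0" "y \<noteq> 0" using snz by (auto simp: x_def y_def)
      have t0: "t m \<noteq> 0" if "m \<in> mids" for m using g0[OF mids_less[OF that]] .
      define e6 where "e6 = (\<Prod>m\<in>mids. t m)"
      have e6nz: "e6 \<noteq> 0" using t0 by (simp add: e6_def)
      \<comment> \<open>One step takes \<open>x\<close> to \<open>x / q\<close> and \<open>y\<close>
        to \<open>y * q\<close>, so both \<open>1 / (a * x * x)\<close> and the ratio of the movers
        gain the factor \<open>q\<^sup>2\<close>.\<close>
      have two: "qtheta (q * (q * v)) = qtheta v / (q * v\<^sup>2)" if "v \<noteq> 0" for v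
        using qtheta_step[of "q * v"] qtheta_step[of v] that nz by (simp add: power2_eq_square)
      have a1: "qtheta (1 / (a * s (n + 1) p' * s (n + 1) p')) = qtheta (1 / (a * x * x)) * (a\<^sup>2 * x ^ 4 / q)"
        using two[of "1 / (a * x * x)"] nz xy by (simp add: s1 x_def[symmetric] power2_eq_square eval_nat_numeral)
      have a2: "qtheta (s (n + 1) p / s (n + 1) p') = qtheta u / (q * (y / x)\<^sup>2)"
        using two[of u] nz xy by (simp add: s1 x_def[symmetric] y_def[symmetric] u_def mult_ac)
      have a3: "(\<Prod>m\<in>mids. qtheta (a * s (n + 1) p' * t m)) = (a * x / q) ^ 6 * e6 * (\<Prod>m\<in>mids. qtheta (a * x * t m))"
      proof -
        have "(\<Prod>m\<in>mids. qtheta (a * s (n + 1) p' * t m)) = (\<Prod>m\<in>mids. (- (a * x / q) * t m) * qtheta (a * x * t m))"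
          by (intro prod.cong refl) (use qtheta_step' nz xy t0 in \<open>simp add: s1 x_def[symmetric]\<close>)
        also have "\<dots> = (\<Prod>m\<in>mids. - (a * x / q)) * (\<Prod>m\<in>mids. t m) * (\<Prod>m\<in>mids. qtheta (a * x * t m))"
          by (simp only: prod.distrib)
        also have "(\<Prod>m\<in>mids. - (a * x / q)) = (a * x / q) ^ 6" by (simp add: card_mids)
        finally show ?thesis unfolding e6_def .
      qed
      have a4: "(\<Prod>m\<in>mids. qtheta (t m / s (n + 1) p')) = x ^ 6 / e6 * (\<Prod>m\<in>mids. qtheta (t m / x))"
      proof -
        have "(\<Prod>m\<in>mids. qtheta (t m / s (n + 1) p')) = (\<Prod>m\<in>mids. (- x / t m) * qtheta (t m / x))"
        proof (intro prod.cong refl)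
          fix m assume "m \<in> mids"
          thus "qtheta (t m / s (n + 1) p') = (- x / t m) * qtheta (t m / x)"
            using qtheta_step[of "t m / x"] nz xy t0 by (simp add: s1 x_def[symmetric] mult.commute)
        qed
        also have "(\<Prod>m\<in>mids. (- x / t m) * qtheta (t m / x)) = (\<Prod>m\<in>mids. - x / t m) * (\<Prod>m\<in>mids. qtheta (t m / x))"
          by (rule prod.distrib)
        also have "(\<Prod>m\<in>mids. - x / t m) = x ^ 6 / e6"
          unfolding prod_dividef e6_def by (simp add: card_mids)
        finally show ?thesis .
      qed
      \<comment> \<open>Here balancing enters: it expresses the product of the fixed coordinates
        through the movers, and with this value the multipliers of all theta factors, of
        \<open>1 / x\<close> and of \<open>q powi n\<close> have product 1.\<close>
      have e6: "e6 = q\<^sup>2 / (a ^ 3 * (a * x * y))"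
      proof -
        have "a ^ 4 * (t p * t p' * e6) = q\<^sup>2" using bal by (simp add: balanced_def prod_octet[OF pp] e6_def)
        moreover have "a * x * y = a * t p * t p'" using szz[of n] nz by (simp add: x_def y_def w_def mult_ac)
        ultimately show ?thesis using nz by (simp add: field_simps eval_nat_numeral)
      qed
      have aux: "Q * q * ((A * (a\<^sup>2 * x ^ 4 / q)) * ((a * x / q) ^ 6 * e6 * B) * W / (c * (x / q) * (U / (q * (y / x)\<^sup>2)) * (x ^ 6 / e6 * D)))
          = Q * (A * B * W / (c * x * U * D))" for Q A B W c U D :: complex
      proof -
        have "q * (a\<^sup>2 * x ^ 4 / q) * ((a * x / q) ^ 6 * e6) * q * (q * (y / x)\<^sup>2) * e6 / x ^ 6 = 1"
          unfolding e6 using nz xy by (simp add: field_simps) (simp add: eval_nat_numeral)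
        moreover have "Q * q * ((A * (a\<^sup>2 * x ^ 4 / q)) * ((a * x / q) ^ 6 * e6 * B) * W / (c * (x / q) * (U / (q * (y / x)\<^sup>2)) * (x ^ 6 / e6 * D)))
           = Q * (A * B * W / (c * x * U * D)) * (q * (a\<^sup>2 * x ^ 4 / q) * ((a * x / q) ^ 6 * e6) * q * (q * (y / x)\<^sup>2) * e6 / x ^ 6)"
          by (simp add: mult_ac)
        ultimately show ?thesis by simp
      qed
      have pw: "q powi (n + 1) = q powi n * q" using nz by (simp add: power_int_add_1)
      show ?thesis unfolding G a1 a2 a3 a4 unfolding pw s1(2) x_def[symmetric] y_def[symmetric]
        using aux[of "q powi n"] unfolding u_def x_def[symmetric] y_def[symmetric] by blast
    qed
  qed
  have G0: "G n = G 0" for n by (rule int_constantI) (rule Gstep)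
  have "prefactor a t p p' T 0 \<noteq> 0"
    using pnum_pden_nz[OF gen pp T] nz by (auto simp: prefactor_def pgeo_def)
  hence "G 0 * mu a t p p' 0 \<noteq> 0"
    unfolding pref[of 0, symmetric] using fterm_nz[OF gs T, of 0] by simp
  hence "G 0 \<noteq> 0" by auto
  thus ?thesis using pref G0 unfolding s_def by (intro exI[of _ "G 0"]) metis
qed

lemma movers_56: "movers 5 6" by (simp add: movers_def)

lemma oct_shift: "oct a bs h n = shift 5 6 n (oct a bs h 0)"
  using q_nz by (auto simp: oct_def shift_def fun_eq_iff power_int_diff power_int_minus field_simps)

lemma octc_shift: "octc c a bs h n = shift (mover c) (mover (\<not> c)) n (octc c a bs h 0)"
  unfolding octc_def mover_def
  by (cases c) (simp_all add: oct_shift[symmetric] dual_shift[OF movers_56, symmetric])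

section \<open>The sequences and the recurrence for fixed parameters\<close>

context
  fixes a b0 b1 b2 b3 b4 h :: complex and bs
  assumes nz: "a \<noteq> 0" "b0 \<noteq> 0" "b1 \<noteq> 0" "b2 \<noteq> 0" "b3 \<noteq> 0" "b4 \<noteq> 0" "h \<noteq> 0"
  defines "bs \<equiv> [b0, b1, b2, b3, b4]"
begin

lemma s_nz: "s_of q a bs \<noteq> 0"
  using nz q_nz by (simp add: s_of_def bs_def)

lemma oct_nth: "oct a bs h n 0 = b0 / a" "oct a bs h n 1 = b1 / a" "oct a bs h n (Suc 0) = b1 / a"
  "oct a bs h n 2 = b2 / a" "oct a bs h n 3 = b3 / a" "oct a bs h n 4 = b4 / a"
  "oct a bs h n 5 = s_of q a bs * q powi (n - 1) / (a * h)" "oct a bs h n 6 = h * q powi (- n) / a" "oct a bs h n 7 = 1"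
  by (simp_all add: oct_def bs_def)

lemma oct_nz: "U < 8 \<Longrightarrow> oct a bs h n U \<noteq> 0"
  using nz s_nz q_nz unfolding less_8_cases by (elim disjE) (simp_all add: oct_nth)

lemma octc_nz: "U < 8 \<Longrightarrow> octc c a bs h n U \<noteq> 0"
  using oct_nz[of U n] by (simp add: octc_def dual_def)

lemma base_nz: "base c a \<noteq> 0" using nz q_nz by (simp add: base_def)

lemma balanced_oct: "balanced a (oct a bs h n)"
proof -
  have "a ^ 4 * (\<Prod>U<8. oct a bs h 0 U) = q\<^sup>2"
  proof -
    have "a ^ 4 = a * a * a * a" "a ^ 3 = a * a * a" by (simp_all add: eval_nat_numeral)
    thus ?thesis using nz q_nz unfolding lessThan_8
      by (simp add: oct_nth s_of_def power_int_minus power2_eq_square power3_eq_cube) (simp add: bs_def field_simps)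
  qed
  hence "balanced a (oct a bs h 0)" by (simp add: balanced_def)
  thus ?thesis by (subst oct_shift) (simp add: balanced_shift[OF movers_56])
qed

lemma gen_octc_base: "gen a (oct a bs h 0) \<Longrightarrow> gen (base c a) (octc c a bs h n)"
  unfolding base_def octc_def
  by (subst (1 2) oct_shift) (auto intro!: gen_dual gen_shift)

lemma balanced_octc: "gen a (oct a bs h 0) \<Longrightarrow> balanced (base c a) (octc c a bs h n)"
  using gen_octc_base[of True n] by (auto simp: base_def octc_def balanced_oct intro!: balanced_dual)

lemma fam_data':
  assumes "T < 8"
  obtains us vs where "family_data q a bs h (fam c T) n =
      (pgeo (base c a) (octc c a bs h n) (mover c) (mover (\<not> c)) T n, us, vs,
        base c a * (octc c a bs h n T)\<^sup>2, opars (base c a) (octc c a bs h n) T (fidx T))"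
    "qpochs_inf q us = pnum (base c a) (octc c a bs h n) (mover c) (mover (\<not> c)) T"
    "qpochs_inf q vs = pden (base c a) (octc c a bs h n) (mover c) (mover (\<not> c)) T"
  using fam_data[OF nz assms, where c = c and n = n] unfolding bs_def by blast

lemma gen_imp_X_regular:
  assumes "gen a (oct a bs h 0)" "T < 8" "i < 7"
  shows "X_regular q a bs h (fam c T) i n"
proof -
  obtain us vs where *: "family_data q a bs h (fam c T) n =
      (pgeo (base c a) (octc c a bs h n) (mover c) (mover (\<not> c)) T n, us, vs,
        base c a * (octc c a bs h n T)\<^sup>2, opars (base c a) (octc c a bs h n) T (fidx T))"
    "qpochs_inf q vs = pden (base c a) (octc c a bs h n) (mover c) (mover (\<not> c)) T"
    using fam_data'[OF assms(2)] by metis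
  note g = gen_octc_base[OF assms(1)]
  show ?thesis unfolding X_regular_def *(1)
    using gen_imp_Phi_regular[OF g is_idx_fidx[OF assms(2)] assms(3)] pnum_pden_nz(2)[OF g movers_mover assms(2)]
    by (simp add: *(2))
qed

lemma gen_imp_coeffs_regular:
  assumes gen: "gen a (oct a bs h 0)"
  shows "coeffs_regular q a bs h"
proof -
  note r = genD(4)[OF gen] 
  have "s_of q a bs * q powi n / h\<^sup>2 \<noteq> 1" for n
    using r[of 5 6 "- n - 1"] nz q_nz s_nz by (auto simp: oct_nth power_int_diff power_int_minus field_simps power2_eq_square)
  moreover have "a * q powi n / h \<noteq> 1" for n
    using r[of 6 7 n] nz q_nz by (auto simp: oct_nth field_simps)
  moreover have "s_of q a bs * q powi n / (a * h) \<noteq> 1" for n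
    using r[of 5 7 "- n - 1"] nz q_nz s_nz by (auto simp: oct_nth power_int_diff power_int_minus field_simps)
  ultimately show ?thesis unfolding coeffs_regular_def Let_def by (metis right_minus_eq)
qed

lemma gen_imp_nonsingular:
  assumes "gen a (oct a bs h 0)"
  shows "nonsingular q a bs h"
  unfolding nonsingular_def families_eq
  using gen_imp_coeffs_regular[OF assms] gen_imp_X_regular[OF assms] by auto

lemma qi_nz_nonpos: "qi x \<noteq> 0 \<Longrightarrow> n \<le> 0 \<Longrightarrow> x \<noteq> q powi n"
proof
  assume "qi x \<noteq> 0" "n \<le> 0" "x = q powi n"
  hence "x * q ^ nat (- n) = q powi n * q powi (- n)" by (simp add: power_int_def)
  also have "\<dots> = 1" using q_nz by (simp add: power_int_minus)
  finally show False using \<open>qi x \<noteq> 0\<close> qi_eq_0_iff by blast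
qed

text \<open>Each single denominator excludes a half-line of powers of \<open>q\<close>. The octet
  covers the nonpositive and the dual the positive exponents, apart from squares, where the division
  is slightly different.\<close>

lemma nonsingular_imp_gen:
  assumes ns: "nonsingular q a bs h"
  shows "gen a (oct a bs h 0)"
proof -
  define t where "t = (\<lambda>c. octc c a bs h 0)"
  have reg: "Phi_regular q i (base c a * (t c T)\<^sup>2) (opars (base c a) (t c) T (fidx T))" if "T < 8" "i < 7" for T i c
  proof -
    have "X_regular q a bs h (fam c T) i 0" using ns that by (auto simp: nonsingular_def families_eq)
    thus ?thesis using fam_data'[OF that(1), of c 0] unfolding X_regular_def t_def by (metis (no_types, lifting) case_prod_conv)
  qed
  have tnz: "t c U \<noteq> 0" if "U < 8" for c U using octc_nz[OF that] by (simp add: t_def)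
  have D1: "base c a * t c T * t c T \<noteq> 1" if "T < 8" for c T
    by (rule Phi_regular_octetD(1)[OF is_idx_fidx base_nz tnz reg]) (use that in auto)
  have D2: "qi (q * (base c a * t c V * t c V)) \<noteq> 0" if "T < 8" "V < 8" "V \<noteq> T" for c T V
    by (rule Phi_regular_octetD(2)[OF is_idx_fidx[OF that(1)] base_nz tnz reg]) (use that in auto)
  have D3: "qi (t c T / t c V) \<noteq> 0" if "T < 8" "V < 8" "V \<noteq> T" for c T V
    by (rule Phi_regular_octetD(3)[OF is_idx_fidx[OF that(1)] base_nz tnz reg]) (use that in auto)
  have D4: "qi (base c a * t c V * t c U) \<noteq> 0" if "T < 8" "V < 8" "V \<noteq> T" "U < 8" "U \<noteq> T" "U \<noteq> V" for c T U V
    by (rule Phi_regular_octetD(4)[OF is_idx_fidx[OF that(1)] base_nz tnz reg]) (use that in auto)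
  have t0: "t True = oct a bs h 0" "t False = dual (oct a bs h 0)" "base True a = a" "base False a = q / a"
    by (simp_all add: t_def octc_def base_def)
  define u where "u = oct a bs h 0"
  have unz: "u U \<noteq> 0" if "U < 8" for U using oct_nz[OF that] by (simp add: u_def)
  have ratio: "u U / u V \<noteq> q powi n" if "U < 8" "V < 8" "U \<noteq> V" for U V n
  proof (cases "n \<le> 0")
    case True
    have "qi (t True U / t True V) \<noteq> 0" using D3[of U V True] that by auto
    thus ?thesis using qi_nz_nonpos[OF _ True] unfolding t0 u_def by blast
  next
    case False
    have "qi (t False U / t False V) \<noteq> 0" using D3[of U V False] that by auto
    hence "qi (u V / u U) \<noteq> 0" by (simp add: t0 u_def dual_def)
    hence "u V / u U \<noteq> q powi (- n)" using False by (intro qi_nz_nonpos) auto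
    thus ?thesis using unz[OF that(1)] unz[OF that(2)] by (auto simp: power_int_minus field_simps)
  qed
  \<comment> \<open>\<open>a * u U * u V\<close> with \<open>U \<noteq> V\<close> occurs in a
    denominator of the family started at a third coordinate \<open>T\<close>, with \<open>V\<close>
    distinguished.\<close>
  have other: "\<exists>T<8. T \<noteq> U \<and> T \<noteq> V" for U V :: nat
  proof -
    consider "0 \<noteq> U \<and> 0 \<noteq> V" | "1 \<noteq> U \<and> 1 \<noteq> V" | "2 \<noteq> U \<and> 2 \<noteq> V" by linarith
    thus ?thesis by cases (rule exI[of _ 0] exI[of _ 1] exI[of _ 2], simp)+
  qed
  have prod: "a * u U * u V \<noteq> q powi n" if UV: "U < 8" "V < 8" for U V n
  proof -
    obtain T where T: "T < 8" "T \<noteq> U" "T \<noteq> V" using other by blast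
    have dl: "q / a * dual u U * dual u V = q / (a * u U * u V)" for V by (simp add: dual_def)
    show ?thesis
    proof (cases "U = V")
      case False
      show ?thesis
      proof (cases "n \<le> 0")
        case True
        have "qi (base True a * t True U * t True V) \<noteq> 0" using D4[of T U V True] UV T False by auto
        thus ?thesis using qi_nz_nonpos[OF _ True] unfolding t0 u_def by blast
      next
        case n: False
        have "qi (base False a * t False U * t False V) \<noteq> 0" using D4[of T U V False] UV T False by auto
        hence "qi (q / (a * u U * u V)) \<noteq> 0" unfolding t0 u_def[symmetric] dl .
        hence "q / (a * u U * u V) \<noteq> q powi (1 - n)" using n by (intro qi_nz_nonpos) auto
        thus ?thesis using unz[OF UV(1)] unz[OF UV(2)] nz q_nz by (auto simp: power_int_diff field_simps)
      qed
    next
      case True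
      \<comment> \<open>For a square the exponents 0 and 1 are excluded by \<open>1 - a\<close> in
        the denominator of the series itself, for the octet and its dual. The others come from the
        factor with the squared distinguished parameter in \<open>Phi_denominator\<close>.\<close>
      consider "n = 0" | "n = 1" | "n \<le> -1" | "n \<ge> 2" by linarith
      thus ?thesis
      proof cases
        case 1
        thus ?thesis using D1[of U True] UV True by (simp add: t0 u_def)
      next
        case 2
        have "base False a * t False U * t False U \<noteq> 1" using D1[of U False] UV by auto
        hence "q / (a * u U * u U) \<noteq> 1" unfolding t0 u_def[symmetric] dl .
        thus ?thesis using 2 True unz[OF UV(1)] nz by auto
      next
        case 3
        have "qi (q * (base True a * t True U * t True U)) \<noteq> 0" using D2[of T U True] UV T by auto
        hence "q * (a * u U * u U) \<noteq> q powi (n + 1)" using 3 unfolding t0 u_def[symmetric] by (intro qi_nz_nonpos) auto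
        thus ?thesis using True q_nz by (simp add: power_int_add_1 mult.assoc)
      next
        case 4
        have "qi (q * (base False a * t False U * t False U)) \<noteq> 0" using D2[of T U False] UV T by auto
        hence "qi (q * (q / (a * u U * u U))) \<noteq> 0" unfolding t0 u_def[symmetric] dl .
        hence "q * (q / (a * u U * u U)) \<noteq> q powi (2 - n)" using 4 by (intro qi_nz_nonpos) auto
        thus ?thesis using True unz[OF UV(1)] nz q_nz by (auto simp: power_int_diff field_simps power2_eq_square)
      qed
    qed
  qed
  show ?thesis unfolding gen_def using nz(1) oct_nz ratio prod unfolding u_def by blast
qed

text \<open>\<open>Phi_octet\<close> leaves the first term in the denominator; with the prefactor it
  merges into \<open>mu\<close>. The constant depends on the family but not on the distinguished
  position.\<close>

lemma X_seq_octet: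
  assumes gen: "gen a (oct a bs h 0)" and T: "T < 8"
  shows "\<exists>K. K \<noteq> 0 \<and> (\<forall>n. \<forall>i<7. X_seq q a bs h (fam c T) i n =
    K * (mu (base c a) (octc c a bs h 0) (mover c) (mover (\<not> c)) n *
      (fsum (base c a) (octc c a bs h n) T - fsum (base c a) (octc c a bs h n) (fidx T ! i))))"
proof -
  define t where "t = octc c a bs h 0"
  define p p' where "p = mover c" and "p' = mover (\<not> c)"
  have pp: "movers p p'" by (simp add: p_def p'_def)
  have np: "p \<noteq> p'" by (simp add: p_def p'_def mover_def)
  have tn: "octc c a bs h n = shift p p' n t" for n unfolding t_def p_def p'_def by (rule octc_shift)
  have g: "gen (base c a) (shift p p' n t)" for n using gen_octc_base[OF gen] tn by metis
  have g0: "gen (base c a) t" using g[of 0] by simp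
  have b: "balanced (base c a) t" using balanced_octc[OF gen] by (simp add: t_def)
  obtain K where K: "K \<noteq> 0" "\<And>n. prefactor (base c a) t p p' T n / fterm (base c a) (shift p p' n t) (shift p p' n t T) = K * mu (base c a) t p p' n"
    using prefactor_const[OF g0 b pp T] by blast
  have "X_seq q a bs h (fam c T) i n =
    K * (mu (base c a) t p p' n * (fsum (base c a) (shift p p' n t) T - fsum (base c a) (shift p p' n t) (fidx T ! i)))"
    if i: "i < 7" for n i
  proof -
    obtain us vs where *: "family_data q a bs h (fam c T) n =
      (pgeo (base c a) (shift p p' n t) p p' T n, us, vs,
        base c a * (shift p p' n t T)\<^sup>2, opars (base c a) (shift p p' n t) T (fidx T))"
      "qpochs_inf q us = pnum (base c a) (shift p p' n t) p p' T"
      "qpochs_inf q vs = pden (base c a) (shift p p' n t) p p' T"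
      using fam_data'[OF T, of c n] unfolding tn p_def[symmetric] p'_def[symmetric] by metis
    have pg: "pgeo (base c a) (shift p p' n t) p p' T n = pgeo (base c a) t p p' T n"
    proof -
      have "base c a * shift p p' n t p * shift p p' n t p' = base c a * t p * t p'"
        using np q_nz by (simp add: power_int_minus)
      thus ?thesis by (simp only: pgeo_def)
    qed
    have "X_seq q a bs h (fam c T) i n = prefactor (base c a) t p p' T n *
       ((fsum (base c a) (shift p p' n t) T - fsum (base c a) (shift p p' n t) (fidx T ! i)) / fterm (base c a) (shift p p' n t) (shift p p' n t T))"
      unfolding X_seq_def *(1) by (simp add: *(2,3) Phi_octet[OF g is_idx_fidx[OF T] i] prefactor_def pg)
    also have "\<dots> = prefactor (base c a) t p p' T n / fterm (base c a) (shift p p' n t) (shift p p' n t T) *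
       (fsum (base c a) (shift p p' n t) T - fsum (base c a) (shift p p' n t) (fidx T ! i))" by simp
    finally show ?thesis unfolding K(2) by (simp add: mult.assoc)
  qed
  thus ?thesis using K(1) unfolding tn by (auto simp: t_def[symmetric] p_def[symmetric] p'_def[symmetric])
qed

text \<open>In terms of the moving coordinates \<open>x\<close> and \<open>y\<close> the three
  summands of \<open>coeff_a\<close> are one by one those of \<open>bet\<close>: this is the content
  of \<open>T1\<close>, \<open>T2\<close> and \<open>T3\<close>. The value \<open>t 7 = 1\<close>
  accounts for the factors without a letter.\<close>

lemma coeffs_octet:
  assumes gen: "gen a (oct a bs h 0)"
  shows "coeff_a q a bs h n = bet a (oct a bs h n) 5 6"
    and "coeff_b q a bs h n = rho a (oct a bs h (n - 1)) 5 6 * gam a (oct a bs h n) 5 6"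
proof -
  define Q s where "Q = q powi n" and "s = s_of q a bs"
  have [simp]: "Q \<noteq> 0" "q \<noteq> 0" "s \<noteq> 0" using q_nz s_nz by (simp_all add: Q_def s_def)
  note [simp] = nz
  define x y where "x = s * Q / (q * a * h)" and "y = h / (a * Q)"
  have [simp]: "x \<noteq> 0" "y \<noteq> 0" by (simp_all add: x_def y_def)
  have t56: "oct a bs h n 5 = x" "oct a bs h n 6 = y" "oct a bs h (n - 1) 5 = x / q" "oct a bs h (n - 1) 6 = y * q"
    by (simp_all add: oct_nth x_def y_def Q_def s_def power_int_diff power_int_minus divide_inverse power2_eq_square)
  have hh: "h = a * y * Q" "s = a\<^sup>2 * q * x * y" by (simp_all add: x_def y_def field_simps power2_eq_square)
  have Q2: "q powi (2 * n) = Q\<^sup>2" "q powi (n * 2) = Q\<^sup>2" by (simp_all add: Q_def mult.commute power_int_mult)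
  have pw: "q powi (n - 1) = Q / q" "q powi (n + 1) = Q * q" "q powi (2 * n - 1) = Q\<^sup>2 / q" "q powi (n - 2) = Q / q\<^sup>2"
    "q powi (2 * n - 2) = Q\<^sup>2 / q\<^sup>2" "q powi n = Q"
    "q powi (2 * (n - 1)) = Q\<^sup>2 / q\<^sup>2" "q powi (2 * (n - 1) - 1) = Q\<^sup>2 / q ^ 3" "q powi (n - 1 - 1) = Q / q\<^sup>2"
    by (simp_all add: power_int_diff power_int_add Q_def[symmetric] Q2 right_diff_distrib power2_eq_square power3_eq_cube)
  note g = gen_octc_base[OF gen, of True n, unfolded base_def octc_def, simplified]
  have u: "x \<noteq> y" "q * x \<noteq> y" "x \<noteq> q * y" "y \<noteq> q" "x \<noteq> q" "a * y \<noteq> q" "a * x \<noteq> q" "q * x \<noteq> q * q * y" "x \<noteq> q * q * y"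
  proof -
    have r: "x / y \<noteq> q powi k" "y \<noteq> q powi k" "x \<noteq> q powi k" "a * y \<noteq> q powi k" "a * x \<noteq> q powi k" for k
      using genD(4)[OF g, of 5 6 k] genD(4)[OF g, of 6 7 k] genD(4)[OF g, of 5 7 k] genD(3)[OF g, of 6 7 k] genD(3)[OF g, of 5 7 k]
      unfolding t56 oct_nth(9) by simp_all
    show "x \<noteq> y" "q * x \<noteq> y" "x \<noteq> q * y" "y \<noteq> q" "x \<noteq> q" "a * y \<noteq> q" "a * x \<noteq> q" "q * x \<noteq> q * q * y" "x \<noteq> q * q * y"
      using r(1)[of 0] r(1)[of "-1"] r(1)[of 1] r(1)[of 2] r(2)[of 1] r(3)[of 1] r(4)[of 1] r(5)[of 1]
      by (auto simp: power_int_minus field_simps power2_eq_square)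
  qed
  define P1 where "P1 = (\<Prod>p\<leftarrow>bs. 1 - q / (y * p))"
  define P2 where "P2 = (\<Prod>p\<leftarrow>bs. 1 - p * x / q)"
  define P3 where "P3 = (\<Prod>p\<leftarrow>bs. 1 - p)"
  define P4 where "P4 = (\<Prod>p\<leftarrow>bs. 1 - 1 / (y * p))"
  have mA: "(\<Prod>p\<leftarrow>bs. 1 - a * q powi (n + 1) / (p * h)) = P1"
    unfolding P1_def pw by (simp add: hh(1) bs_def field_simps)
  have mA': "(\<Prod>p\<leftarrow>bs. 1 - a * q powi (n - 1 + 1) / (p * h)) = P4"
    unfolding P4_def by (simp add: hh(1) bs_def Q_def[symmetric] field_simps)
  have mB: "(\<Prod>p\<leftarrow>bs. 1 - p * s * q powi (n - 2) / (a * h)) = P2"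
    unfolding P2_def pw by (simp add: hh(1)) (simp add: hh(2) bs_def field_simps power2_eq_square)
  have bsp: "(\<Prod>p\<leftarrow>bs. f p) = f b0 * f b1 * f b2 * f b3 * f b4" for f :: "complex \<Rightarrow> complex"
    by (simp add: bs_def)
  have m1: "(\<Prod>m\<in>mids. 1 - q / (a * y * oct a bs h n m)) = P1 * (1 - q / (a * y))"
    unfolding P1_def prod_mids bsp by (simp add: oct_nth mult_ac)
  have m1': "(\<Prod>m\<in>mids. 1 - q / (a * (y * q) * oct a bs h (n - 1) m)) = P4 * (1 - 1 / (a * y))"
    unfolding P4_def prod_mids bsp by (simp add: oct_nth mult_ac)
  have m2: "(\<Prod>m\<in>mids. 1 - a * oct a bs h n m * x / q) = P2 * (1 - a * x / q)"
    unfolding P2_def prod_mids bsp by (simp add: oct_nth mult_ac)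
  have m3: "(\<Prod>m\<in>mids - {7}. 1 - a * 1 * oct a bs h n m) = P3"
    unfolding P3_def mids_diff bsp by (simp add: oct_nth mult_ac)
  have rho: "rho a (oct a bs h n) 5 6 = a * x * y / q * (P1 * (1 - q / (a * y))) / ((1 - x / y) * (1 - q * x / y))"
    unfolding rho_def t56 m1 ..
  have gam: "gam a (oct a bs h n) 5 6 = q\<^sup>2 / (a * x * y) * (P2 * (1 - a * x / q)) / ((1 - x / y) * (1 - x / (q * y)))"
    unfolding gam_def t56 m2 ..
  have rho': "rho a (oct a bs h (n - 1)) 5 6 = a * x * y / q * (P4 * (1 - 1 / (a * y))) / ((1 - x / (q\<^sup>2 * y)) * (1 - x / (q * y)))"
    unfolding rho_def t56 m1' by (simp add: power2_eq_square mult_ac)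
  have args: "s * q powi (n - 1) / h = a * x" "s * q powi (n - 1) / (a * h) = x" "s * q powi (2 * n) / h\<^sup>2 = q * x / y"
    "s * q powi (2 * n - 1) / h\<^sup>2 = x / y" "a * q powi (n + 1) / h = q / y" "q powi n / h = 1 / (a * y)" "a * q powi n / h = 1 / y"
    "s * q powi (2 * n - 2) / h\<^sup>2 = x / (q * y)" "s * q powi (n - 2) / (a * h) = x / q"
    "s * q powi (2 * n - 1) / (a * h\<^sup>2) = x / (a * y)" "s / (a * q\<^sup>2) = a * x * y / q"
    unfolding pw Q2 by (simp_all add: hh(1)) (simp_all add: hh(2) field_simps power2_eq_square)
  have A: "rec_A q a bs h n = (1 - a * x) * (1 - x) * P1 / ((1 - q * x / y) * (1 - x / y) * (1 - q / y))"
    unfolding rec_A_def Let_def s_def[symmetric] mA args ..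
  have B: "rec_B q a bs h n = q * (1 - 1 / (a * y)) * (1 - 1 / y) * P2 / ((1 - x / y) * (1 - x / (q * y)) * (1 - x / q))"
    unfolding rec_B_def Let_def s_def[symmetric] mB args ..
  have args': "s * q powi (n - 1 - 1) / h = a * x / q" "s * q powi (n - 1 - 1) / (a * h) = x / q" "s * q powi (2 * (n - 1)) / h\<^sup>2 = x / (q * y)"
    "s * q powi (2 * (n - 1) - 1) / h\<^sup>2 = x / (q\<^sup>2 * y)" "a * q powi (n - 1 + 1) / h = 1 / y"
    unfolding pw diff_add_cancel by (simp_all add: hh(1)) (simp_all add: hh(2) field_simps power2_eq_square eval_nat_numeral)
  have A': "rec_A q a bs h (n - 1) = (1 - a * x / q) * (1 - x / q) * P4 / ((1 - x / (q * y)) * (1 - x / (q\<^sup>2 * y)) * (1 - 1 / y))"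
    unfolding rec_A_def Let_def s_def[symmetric] mA' args' ..
  have y1: "y \<noteq> 1" using genD(4)[OF g, of 6 7 0] unfolding t56 oct_nth(9) by simp
  have T1: "(1 - a * x) * (1 - x) * P1 / ((1 - q * x / y) * (1 - x / y) * (1 - q / y)) =
     a * x * y / q * (P1 * (1 - q / (a * y))) / ((1 - x / y) * (1 - q * x / y)) * ((1 - 1 / x) * (1 - a * 1 * x)) / ((1 - q * 1 / y) * (1 - a * 1 * y / q))"
    using u by (simp add: divide_simps) (simp add: algebra_simps)
  have T2: "q * (1 - 1 / (a * y)) * (1 - 1 / y) * P2 / ((1 - x / y) * (1 - x / (q * y)) * (1 - x / q)) =
     q\<^sup>2 / (a * x * y) * (P2 * (1 - a * x / q)) / ((1 - x / y) * (1 - x / (q * y))) * ((1 - 1 / y) * (1 - a * 1 * y)) / ((1 - q * 1 / x) * (1 - a * 1 * x / q))"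
    using u by (simp add: divide_simps) (simp add: algebra_simps power2_eq_square)
  have T3: "x / (a * y) * ((1 - a * x * y / q) * P3 / ((1 - q / y) * (1 - x / q))) =
     - ((q - a * x * y) / (a * y) * P3 / (1 * ((1 - q * 1 / x) * (1 - q * 1 / y))))"
    using u by (simp add: divide_simps) (simp add: algebra_simps power2_eq_square)
  show "coeff_a q a bs h n = bet a (oct a bs h n) 5 6"
    unfolding coeff_a_def bet_def Let_def A B s_def[symmetric] args rho gam lam_def oct_nth(9) m3 t56 P3_def[symmetric] T1 T2 T3
    by simp
  show "coeff_b q a bs h n = rho a (oct a bs h (n - 1)) 5 6 * gam a (oct a bs h n) 5 6"
    unfolding coeff_b_def A' B rho' gam
    using u y1 by (simp add: divide_simps) (simp add: algebra_simps power2_eq_square)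
qed

lemma coeffs_octc:
  assumes gen: "gen a (oct a bs h 0)"
  shows "coeff_a q a bs h n = bet (base c a) (octc c a bs h n) (mover c) (mover (\<not> c))"
    and "coeff_b q a bs h n = rho (base c a) (octc c a bs h (n - 1)) (mover c) (mover (\<not> c)) *
       gam (base c a) (octc c a bs h n) (mover c) (mover (\<not> c))"
proof -
  have g: "gen a (oct a bs h n)" using gen_octc_base[OF gen, of True n] by (simp add: base_def octc_def)
  have s: "oct a bs h (n - 1) = shift 5 6 (-1) (oct a bs h n)"
    by (subst (1 2) oct_shift) (simp add: shift_shift)
  show "coeff_a q a bs h n = bet (base c a) (octc c a bs h n) (mover c) (mover (\<not> c))"
    using bet_dual[OF g balanced_oct movers_56]
    by (cases c) (simp_all add: coeffs_octet[OF gen] base_def octc_def mover_def)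
  show "coeff_b q a bs h n = rho (base c a) (octc c a bs h (n - 1)) (mover c) (mover (\<not> c)) *
       gam (base c a) (octc c a bs h n) (mover c) (mover (\<not> c))"
    using rho_gam_dual[OF g balanced_oct movers_56]
    by (cases c) (simp_all add: coeffs_octet[OF gen] base_def octc_def mover_def s)
qed

lemma family_solves:
  assumes gen: "gen a (oct a bs h 0)" and T: "T < 8" and i: "i < 7"
  shows "solves_recurrence q a bs h (X_seq q a bs h (fam c T) i)"
  unfolding solves_recurrence_def
proof
  fix n
  define t where "t = octc c a bs h 0"
  define p p' where "p = mover c" and "p' = mover (\<not> c)"
  define V where "V = fidx T ! i"
  have V: "V < 8" using is_idx_nth[OF is_idx_fidx[OF T] i] by (simp add: V_def)
  have tn: "octc c a bs h n = shift p p' n t" for n unfolding t_def p_def p'_def by (rule octc_shift)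
  define Y where "Y = (\<lambda>n. mu (base c a) t p p' n * (fsum (base c a) (shift p p' n t) T - fsum (base c a) (shift p p' n t) V))"
  obtain K where X: "\<And>n. X_seq q a bs h (fam c T) i n = K * Y n"
    using X_seq_octet[OF gen T, of c] i
    unfolding Y_def V_def tn p_def[symmetric] p'_def[symmetric] t_def[symmetric] shift_0 by blast
  have "gen (base c a) t" "balanced (base c a) t" "movers p p'"
    using gen_octc_base[OF gen] balanced_octc[OF gen] by (simp_all add: t_def p_def p'_def)
  from octet_recurrence[OF this T V, of n]
  have "Y (n + 1) - coeff_a q a bs h n * Y n + coeff_b q a bs h n * Y (n - 1) = 0"
    unfolding Y_def coeffs_octc[OF gen, of _ c] tn p_def[symmetric] p'_def[symmetric] .
  moreover have "K * Y (n + 1) - A * (K * Y n) + B * (K * Y (n - 1)) = K * (Y (n + 1) - A * Y n + B * Y (n - 1))" for A B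
    by (simp add: algebra_simps)
  ultimately show "X_seq q a bs h (fam c T) i (n + 1) - coeff_a q a bs h n * X_seq q a bs h (fam c T) i n +
      coeff_b q a bs h n * X_seq q a bs h (fam c T) i (n - 1) = 0"
    unfolding X by simp
qed

text \<open>Both sequences are multiples of \<open>mu\<close> times the difference of the same two
  sums, taken with opposite signs.\<close>

lemma family_swap:
  assumes gen: "gen a (oct a bs h 0)" and ij: "i < 5" "j < 5" "i \<noteq> j"
  shows "\<exists>C. C \<noteq> 0 \<and> (\<forall>n. X_seq q a bs h (fam c i) j n = C * X_seq q a bs h (fam c j) i n)"
proof -
  have idx: "fidx i ! j = j" "fidx j ! i = i"
    using ij by (auto simp: fidx_def less_Suc_eq numeral_eq_Suc)
  from X_seq_octet[OF gen, of i c] X_seq_octet[OF gen, of j c] ij obtain K L where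
    K: "K \<noteq> 0" "\<And>n. X_seq q a bs h (fam c i) j n = K * (mu (base c a) (octc c a bs h 0) (mover c) (mover (\<not> c)) n *
      (fsum (base c a) (octc c a bs h n) i - fsum (base c a) (octc c a bs h n) j))" and
    L: "L \<noteq> 0" "\<And>n. X_seq q a bs h (fam c j) i n = L * (mu (base c a) (octc c a bs h 0) (mover c) (mover (\<not> c)) n *
      (fsum (base c a) (octc c a bs h n) j - fsum (base c a) (octc c a bs h n) i))"
    by (auto simp: idx)
  show ?thesis
  proof (intro exI[of _ "- K / L"] conjI allI)
    show "- K / L \<noteq> 0" using K L by simp
    fix n show "X_seq q a bs h (fam c i) j n = - K / L * X_seq q a bs h (fam c j) i n"
      unfolding K(2) L(2) using L(1) by (simp add: algebra_simps)
  qed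
qed

end

end

section \<open>Holomorphic functions on the torus\<close>

lemma torus_slice: "x \<in> torus \<Longrightarrow> z \<noteq> 0 \<Longrightarrow> (\<chi> j. if j = i then z else x $ j) \<in> torus"
  by (simp add: torus_def)

lemma holT_const: "holomorphic_on_torus (\<lambda>x. c)"
  by (auto simp: holomorphic_on_torus_def intro!: continuous_intros holomorphic_intros)

lemma holT_coord: "holomorphic_on_torus (\<lambda>x. x $ i)"
  unfolding holomorphic_on_torus_def
proof (intro conjI ballI allI)
  fix x :: "complex ^ 7" and k
  show "(\<lambda>z. (\<chi> j. if j = k then z else x $ j) $ i) holomorphic_on - {0}"
    by (cases "i = k") (auto intro!: holomorphic_intros)
qed (intro continuous_intros)

lemma holT_add: "holomorphic_on_torus F \<Longrightarrow> holomorphic_on_torus G \<Longrightarrow> holomorphic_on_torus (\<lambda>x. F x + G x)"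
  by (auto simp: holomorphic_on_torus_def intro!: continuous_intros holomorphic_intros)

lemma holT_diff: "holomorphic_on_torus F \<Longrightarrow> holomorphic_on_torus G \<Longrightarrow> holomorphic_on_torus (\<lambda>x. F x - G x)"
  by (auto simp: holomorphic_on_torus_def intro!: continuous_intros holomorphic_intros)

lemma holT_mult: "holomorphic_on_torus F \<Longrightarrow> holomorphic_on_torus G \<Longrightarrow> holomorphic_on_torus (\<lambda>x. F x * G x)"
  by (auto simp: holomorphic_on_torus_def intro!: continuous_intros holomorphic_intros)

lemma holT_divide:
  assumes "holomorphic_on_torus F" "holomorphic_on_torus G" "\<And>x. x \<in> torus \<Longrightarrow> G x \<noteq> 0"
  shows "holomorphic_on_torus (\<lambda>x. F x / G x)"
  using assms unfolding holomorphic_on_torus_def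
  by (auto intro!: continuous_intros holomorphic_intros simp: torus_slice)

lemma holT_power: "holomorphic_on_torus F \<Longrightarrow> holomorphic_on_torus (\<lambda>x. F x ^ k)"
  by (auto simp: holomorphic_on_torus_def intro!: continuous_intros holomorphic_intros)

lemma holT_prod: "(\<And>i. i \<in> I \<Longrightarrow> holomorphic_on_torus (F i)) \<Longrightarrow> holomorphic_on_torus (\<lambda>x. \<Prod>i\<in>I. F i x)"
  by (auto simp: holomorphic_on_torus_def intro!: continuous_intros holomorphic_intros)

lemma holT_compose:
  assumes "holomorphic_on_torus F" "g holomorphic_on UNIV"
  shows "holomorphic_on_torus (\<lambda>x. g (F x))"
proof -
  have "continuous_on torus (\<lambda>x. g (F x))"
    using assms holomorphic_on_imp_continuous_on[OF assms(2)]
    by (auto simp: holomorphic_on_torus_def intro: continuous_on_compose2)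
  moreover have "(\<lambda>z. g (F (\<chi> j. if j = i then z else x $ j))) holomorphic_on - {0}" if "x \<in> torus" for x i
    using holomorphic_on_compose_gen[of "\<lambda>z. F (\<chi> j. if j = i then z else x $ j)" "- {0}" g UNIV] assms that
    by (auto simp: holomorphic_on_torus_def o_def)
  ultimately show ?thesis by (auto simp: holomorphic_on_torus_def)
qed

lemma open_torus: "open torus"
proof -
  have "torus = (\<Inter>i\<in>UNIV. {x :: complex ^ 7. x $ i \<noteq> 0})" by (auto simp: torus_def)
  moreover have "open {x :: complex ^ 7. x $ i \<noteq> 0}" for i
    by (intro open_Collect_neq continuous_intros)
  ultimately show ?thesis by (metis (no_types, lifting) finite open_INT)
qed

text \<open>The geometric majorant gives uniform convergence on compact subsets of the torus. Joint
  continuity follows on small balls, holomorphy in one variable on the compact images of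
  discs.\<close>

lemma holT_series:
  assumes hol: "\<And>k. holomorphic_on_torus (f k)" and B: "continuous_on torus B"
    and bound: "\<And>k x. x \<in> torus \<Longrightarrow> norm (f k x) \<le> r ^ k * B x" and r: "0 \<le> r" "r < 1"
  shows "holomorphic_on_torus (\<lambda>x. \<Sum>k. f k x)"
proof -
  have unif: "uniform_limit K (\<lambda>n x. \<Sum>k<n. f k x) (\<lambda>x. \<Sum>k. f k x) sequentially"
    if K: "compact K" "K \<subseteq> torus" for K
  proof -
    have "compact (B ` K)" using K B by (intro compact_continuous_image) (auto intro: continuous_on_subset)
    then obtain C where C: "\<And>x. x \<in> K \<Longrightarrow> norm (B x) \<le> C"
      using compact_imp_bounded[of "B ` K"] unfolding bounded_iff by auto
    show ?thesis
    proof (rule Weierstrass_m_test)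
      show "norm (f n x) \<le> r ^ n * C" if "x \<in> K" for n x
      proof -
        have "B x \<le> C" using C[OF that] by simp
        hence "r ^ n * B x \<le> r ^ n * C" using r by (intro mult_left_mono) auto
        moreover have "norm (f n x) \<le> r ^ n * B x" using that K by (intro bound) auto
        ultimately show ?thesis by linarith
      qed
      show "summable (\<lambda>n. r ^ n * C)" using r by (intro summable_mult2 summable_geometric) auto
    qed
  qed
  have cont: "continuous_on torus (\<lambda>x. \<Sum>k. f k x)"
  proof (rule continuous_at_imp_continuous_on)
    show "\<forall>x\<in>torus. isCont (\<lambda>x. \<Sum>k. f k x) x"
    proof
      fix x :: "complex ^ 7" assume "x \<in> torus"
      then obtain e where e: "e > 0" "cball x e \<subseteq> torus" using open_torus open_contains_cball by blast
      have "continuous_on (cball x e) (f k)" for k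
        using hol[of k] e(2) by (auto simp: holomorphic_on_torus_def intro: continuous_on_subset)
      hence "\<forall>n. continuous_on (cball x e) (\<lambda>x. \<Sum>k<n. f k x)"
        by (intro allI continuous_on_sum) auto
      from uniform_limit_theorem[OF always_eventually[OF this] unif[OF compact_cball e(2)]]
      have "continuous_on (cball x e) (\<lambda>x. \<Sum>k. f k x)" by simp
      thus "isCont (\<lambda>x. \<Sum>k. f k x) x"
        using e by (intro continuous_on_interior[of "cball x e"]) auto
    qed
  qed
  have "(\<lambda>z. \<Sum>k. f k (\<chi> j. if j = i then z else x $ j)) holomorphic_on - {0}" if x: "x \<in> torus" for x i
  proof (rule holomorphic_uniform_sequence[where f = "\<lambda>n z. \<Sum>k<n. f k (\<chi> j. if j = i then z else x $ j)"])
    show "open (- {0 :: complex})" by auto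
    show "(\<lambda>z. \<Sum>k<n. f k (\<chi> j. if j = i then z else x $ j)) holomorphic_on - {0}" for n
      using hol x by (auto simp: holomorphic_on_torus_def intro!: holomorphic_intros)
    fix y :: complex assume "y \<in> - {0}"
    then obtain e where e: "e > 0" "cball y e \<subseteq> - {0}" using open_contains_cball[of "- {0::complex}"] by blast
    let ?s = "\<lambda>z. (\<chi> j. if j = i then z else x $ j) :: complex ^ 7"
    have "continuous_on (cball y e) (\<lambda>z. if j = i then z else x $ j)" for j
      by (cases "j = i") (auto intro!: continuous_intros)
    hence "continuous_on (cball y e) ?s" by (intro continuous_on_vec_lambda) auto
    hence c: "compact (?s ` cball y e)" by (intro compact_continuous_image) auto
    have sub: "?s ` cball y e \<subseteq> torus" using e x by (auto intro!: torus_slice)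
    have "uniform_limit (cball y e) (\<lambda>n z. \<Sum>k<n. f k (?s z)) (\<lambda>z. \<Sum>k. f k (?s z)) sequentially"
      using unif[OF c sub] unfolding uniform_limit_iff by (simp only: ball_simps)
    thus "\<exists>d>0. cball y d \<subseteq> - {0} \<and> uniform_limit (cball y d) (\<lambda>n z. \<Sum>k<n. f k (?s z)) (\<lambda>z. \<Sum>k. f k (?s z)) sequentially"
      using e by blast
  qed
  thus ?thesis using cont by (auto simp: holomorphic_on_torus_def)
qed

text \<open>If \<open>g\<close> vanished wherever \<open>f\<close> does not, it would vanish on a
  nonempty open set, hence on all of the connected set \<open>S\<close> by the identity
  theorem.\<close>

lemma holomorphic_mult_nontrivial:
  assumes "f holomorphic_on S" "g holomorphic_on S" "open S" "connected S" "x \<in> S" "f x \<noteq> 0" "y \<in> S" "g y \<noteq> 0"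
  shows "\<exists>z\<in>S. f z \<noteq> 0 \<and> g z \<noteq> (0::complex)"
proof (rule ccontr)
  assume "\<not> ?thesis"
  hence *: "\<And>z. z \<in> S \<Longrightarrow> f z \<noteq> 0 \<Longrightarrow> g z = 0" by blast
  have "continuous_on S f" using assms(1) by (rule holomorphic_on_imp_continuous_on)
  hence "open (S \<inter> f -` (- {0}))" using assms(3) by (intro continuous_open_preimage) auto
  moreover have "x \<in> S \<inter> f -` (- {0})" using assms by auto
  ultimately have "x islimpt (S \<inter> f -` (- {0}))"
    by (intro interior_limit_point) (simp only: interior_open)
  hence "g y = 0"
    by (intro analytic_continuation[OF assms(2-4), of "S \<inter> f -` (- {0})" x y]) (use assms * in auto)
  thus False using assms by simp
qed

text \<open>The coordinates of two points are made to agree one after the other.\<close>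

lemma holT_mult_nontrivial:
  assumes F: "holomorphic_on_torus F" "x \<in> torus" "F x \<noteq> 0"
    and G: "holomorphic_on_torus G" "y \<in> torus" "G y \<noteq> 0"
  shows "\<exists>z\<in>torus. F z \<noteq> 0 \<and> G z \<noteq> 0"
proof -
  \<comment> \<open>\<open>I\<close> collects the coordinates in which the two points already agree;
    for \<open>I = UNIV\<close> they are the same point.\<close>
  have "\<exists>z\<in>torus. F (\<chi> j. if j \<in> I then z $ j else x $ j) \<noteq> 0 \<and> G (\<chi> j. if j \<in> I then z $ j else y $ j) \<noteq> 0"
    if "finite I" for I
    using that
  proof induction
    case empty
    show ?case using F G by (intro bexI[of _ x]) auto
  next
    case (insert i I)
    from insert.IH obtain z where z: "z \<in> torus" "F (\<chi> j. if j \<in> I then z $ j else x $ j) \<noteq> 0"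
      "G (\<chi> j. if j \<in> I then z $ j else y $ j) \<noteq> 0" by (elim bexE conjE)
    define u v :: "complex ^ 7" where "u = (\<chi> j. if j \<in> I then z $ j else x $ j)" and "v = (\<chi> j. if j \<in> I then z $ j else y $ j)"
    have uv: "u \<in> torus" "v \<in> torus" using z F G by (auto simp: torus_def u_def v_def)
    have id: "(\<chi> j. if j = i then u $ i else u $ j) = u" "(\<chi> j. if j = i then v $ i else v $ j) = v"
      by (auto simp: vec_eq_iff)
    have "\<exists>w\<in>- {0}. F (\<chi> j. if j = i then w else u $ j) \<noteq> 0 \<and> G (\<chi> j. if j = i then w else v $ j) \<noteq> 0"
    proof (rule holomorphic_mult_nontrivial[of _ "- {0}" _ "u $ i" "v $ i"])
      show "connected (- {0 :: complex})" by (rule connected_punctured_universe) simp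
      show "(\<lambda>w. F (\<chi> j. if j = i then w else u $ j)) holomorphic_on - {0}"
        "(\<lambda>w. G (\<chi> j. if j = i then w else v $ j)) holomorphic_on - {0}"
        using F(1) G(1) uv unfolding holomorphic_on_torus_def by simp_all
      show "F (\<chi> j. if j = i then u $ i else u $ j) \<noteq> 0" "G (\<chi> j. if j = i then v $ i else v $ j) \<noteq> 0"
        unfolding id using z(2,3) unfolding u_def v_def by simp_all
      show "u $ i \<in> - {0}" "v $ i \<in> - {0}" using uv by (simp_all add: torus_def)
    qed auto
    then obtain w where w: "w \<noteq> 0" "F (\<chi> j. if j = i then w else u $ j) \<noteq> 0" "G (\<chi> j. if j = i then w else v $ j) \<noteq> 0"
      by auto
    let ?z = "\<chi> j. if j = i then w else z $ j"
    have zt: "?z \<in> torus" using z(1) w(1) by (rule torus_slice)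
    have eq: "(\<chi> j. if j \<in> insert i I then ?z $ j else x $ j) = (\<chi> j. if j = i then w else u $ j)"
      "(\<chi> j. if j \<in> insert i I then ?z $ j else y $ j) = (\<chi> j. if j = i then w else v $ j)"
      using insert.hyps by (auto simp: vec_eq_iff u_def v_def)
    show ?case by (intro bexI[OF _ zt] conjI; unfold eq) (rule w(2), rule w(3))
  qed
  from this[of UNIV] obtain z where "z \<in> torus" "F (\<chi> j. z $ j) \<noteq> 0" "G (\<chi> j. z $ j) \<noteq> 0" by auto
  thus ?thesis unfolding vec_lambda_eta by blast
qed

section \<open>Generic properties of a point of the torus\<close>

definition gentorus :: "(complex ^ 7 \<Rightarrow> bool) \<Rightarrow> bool" where
  "gentorus P \<longleftrightarrow> (\<exists>F. holomorphic_on_torus F \<and> (\<exists>x\<in>torus. F x \<noteq> 0) \<and> (\<forall>x\<in>torus. F x \<noteq> 0 \<longrightarrow> P x))"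

lemma gentorusI: "holomorphic_on_torus F \<Longrightarrow> x \<in> torus \<Longrightarrow> F x \<noteq> 0 \<Longrightarrow> (\<And>x. x \<in> torus \<Longrightarrow> F x \<noteq> 0 \<Longrightarrow> P x) \<Longrightarrow> gentorus P"
  unfolding gentorus_def by blast

lemma gentorus_mono: "gentorus P \<Longrightarrow> (\<And>x. x \<in> torus \<Longrightarrow> P x \<Longrightarrow> Q x) \<Longrightarrow> gentorus Q"
  unfolding gentorus_def by blast

lemma gentorus_ex: "gentorus P \<Longrightarrow> \<exists>x\<in>torus. P x"
  unfolding gentorus_def by blast

lemma gentorus_conj:
  assumes "gentorus P" "gentorus Q" shows "gentorus (\<lambda>x. P x \<and> Q x)"
proof -
  obtain F x where F: "holomorphic_on_torus F" "x \<in> torus" "F x \<noteq> 0" "\<And>x. x \<in> torus \<Longrightarrow> F x \<noteq> 0 \<Longrightarrow> P x"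
    using assms(1) unfolding gentorus_def by blast
  obtain G y where G: "holomorphic_on_torus G" "y \<in> torus" "G y \<noteq> 0" "\<And>x. x \<in> torus \<Longrightarrow> G x \<noteq> 0 \<Longrightarrow> Q x"
    using assms(2) unfolding gentorus_def by blast
  obtain z where "z \<in> torus" "F z \<noteq> 0" "G z \<noteq> 0" using holT_mult_nontrivial[OF F(1-3) G(1-3)] by blast
  thus ?thesis using F(4) G(4) by (intro gentorusI[OF holT_mult[OF F(1) G(1)], of z]) auto
qed

lemma gentorus_ball:
  assumes "finite I" "\<And>i. i \<in> I \<Longrightarrow> gentorus (P i)" shows "gentorus (\<lambda>x. \<forall>i\<in>I. P i x)"
  using assms
proof (induction rule: finite_induct)
  case empty
  have "(\<chi> i. 1) \<in> torus" by (simp add: torus_def)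
  thus ?case by (intro gentorusI[OF holT_const[of 1]]) auto
next
  case (insert i I)
  thus ?case using gentorus_conj[of "P i" "\<lambda>x. \<forall>i\<in>I. P i x"] by simp
qed

lemma gentorus_ne_0: "holomorphic_on_torus F \<Longrightarrow> x \<in> torus \<Longrightarrow> F x \<noteq> 0 \<Longrightarrow> gentorus (\<lambda>x. F x \<noteq> 0)"
  by (rule gentorusI)

text \<open>Units among the holomorphic functions on the torus. All octet coordinates are such,
  being monomials in the parameters, so they may stand in denominators and inside
  \<open>qtheta\<close>.\<close>

definition nvT :: "(complex ^ 7 \<Rightarrow> complex) \<Rightarrow> bool" where
  "nvT F \<longleftrightarrow> holomorphic_on_torus F \<and> (\<forall>x\<in>torus. F x \<noteq> 0)"

lemma nvT_hol: "nvT F \<Longrightarrow> holomorphic_on_torus F"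
  and nvT_nz: "nvT F \<Longrightarrow> x \<in> torus \<Longrightarrow> F x \<noteq> 0"
  by (auto simp: nvT_def)

lemma nvT_coord: "nvT (\<lambda>x. x $ i)"
  by (auto simp: nvT_def torus_def holT_coord)

lemma nvT_const: "c \<noteq> 0 \<Longrightarrow> nvT (\<lambda>x. c)"
  by (auto simp: nvT_def holT_const)

lemma nvT_mult: "nvT F \<Longrightarrow> nvT G \<Longrightarrow> nvT (\<lambda>x. F x * G x)"
  by (auto simp: nvT_def holT_mult)

lemma nvT_divide: "nvT F \<Longrightarrow> nvT G \<Longrightarrow> nvT (\<lambda>x. F x / G x)"
  by (auto simp: nvT_def intro!: holT_divide)

lemma nvT_power: "nvT F \<Longrightarrow> nvT (\<lambda>x. F x ^ k)"
  by (auto simp: nvT_def intro!: holT_power)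

lemma nvT_prod: "(\<And>i. i \<in> I \<Longrightarrow> nvT (F i)) \<Longrightarrow> nvT (\<lambda>x. \<Prod>i\<in>I. F i x)"
  by (cases "finite I") (auto simp: nvT_def intro!: holT_prod holT_const)

context q_base
begin

lemma holT_qi: "holomorphic_on_torus F \<Longrightarrow> holomorphic_on_torus (\<lambda>x. qi (F x))"
  by (rule holT_compose[OF _ qi_holomorphic])

lemma holT_qpoch: "holomorphic_on_torus F \<Longrightarrow> holomorphic_on_torus (\<lambda>x. qpoch q (F x) k)"
  by (rule holT_compose[OF _ qpoch_holomorphic])

lemma holT_qtheta: "nvT F \<Longrightarrow> holomorphic_on_torus (\<lambda>x. qtheta (F x))"
  unfolding qtheta_def by (intro holT_mult holT_qi holT_divide holT_const) (auto simp: nvT_def)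

lemma holT_den:
  assumes "nvT A" "\<And>U. U < 8 \<Longrightarrow> nvT (\<lambda>x. t x U)" "T < 8"
  shows "holomorphic_on_torus (\<lambda>x. den (A x) (t x) T)"
  unfolding den_def using assms by (intro holT_prod holT_qi holT_mult) (auto simp: nvT_def)

lemma continuous_qbound: "continuous_on S f \<Longrightarrow> continuous_on S (\<lambda>x. qbound (f x))"
  unfolding qbound_def using q_lt1 by (intro continuous_intros) auto

lemma holT_hsum:
  assumes A: "nvT A" and t: "\<And>U. U < 8 \<Longrightarrow> nvT (\<lambda>x. t x U)" and T: "T < 8"
  shows "holomorphic_on_torus (\<lambda>x. hsum (A x) (t x) T)"
  unfolding hsum_def
proof (rule holT_series[where B = "\<lambda>x. hbound (A x) (t x) T" and r = "norm q"])
  note h = nvT_hol[OF A] nvT_hol[OF t]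
  show "holomorphic_on_torus (\<lambda>x. hterm (A x) (t x) T k)" for k
    unfolding hterm_def
    by (intro holT_mult holT_prod holT_qi holT_qpoch holT_diff holT_power holT_const holT_divide h T)
       (use T t nvT_nz in auto)
  have c: "continuous_on torus A" "\<And>U. U < 8 \<Longrightarrow> continuous_on torus (\<lambda>x. t x U)"
    using h by (auto simp: holomorphic_on_torus_def)
  show "continuous_on torus (\<lambda>x. hbound (A x) (t x) T)"
    unfolding hbound_def
    by (intro continuous_intros continuous_qbound c T) (use T t nvT_nz in auto)
qed (use q_lt1 norm_hterm_le in auto)

section \<open>The octet as a function on the torus\<close>

definition ax :: "bool \<Rightarrow> complex ^ 7 \<Rightarrow> complex" where "ax c x = base c (x $ 1)"

definition bx :: "complex ^ 7 \<Rightarrow> complex list" where "bx x = [x $ 2, x $ 3, x $ 4, x $ 5, x $ 6]"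

definition tx :: "bool \<Rightarrow> complex ^ 7 \<Rightarrow> nat \<Rightarrow> complex" where "tx c x = octc c (x $ 1) (bx x) (x $ 7) 0"

lemma tx_True: "tx True x 0 = x $ 2 / x $ 1" "tx True x 1 = x $ 3 / x $ 1" "tx True x 2 = x $ 4 / x $ 1"
  "tx True x 3 = x $ 5 / x $ 1" "tx True x 4 = x $ 6 / x $ 1"
  "tx True x 5 = ((x $ 1)\<^sup>2 * q\<^sup>2) / (x $ 2 * x $ 3 * x $ 4 * x $ 5 * x $ 6 * x $ 7)"
  "tx True x 6 = x $ 7 / x $ 1" "tx True x 7 = 1"
  using q_nz by (simp_all add: tx_def octc_def oct_def bx_def s_of_def power_int_minus field_simps power2_eq_square power3_eq_cube)

lemma tx_False: "tx False x U = 1 / tx True x U"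
  by (simp add: tx_def octc_def dual_def)

lemma nvT_ax: "nvT (ax c)"
  using q_nz by (cases c) (auto simp: ax_def[abs_def] base_def intro!: nvT_divide nvT_coord nvT_const)

lemma nvT_tx: "U < 8 \<Longrightarrow> nvT (\<lambda>x. tx c x U)"
proof -
  assume U: "U < 8"
  have "nvT (\<lambda>x. tx True x U)"
    using U q_nz unfolding less_8_cases
    by (elim disjE) (auto simp: tx_True[unfolded One_nat_def] tx_True intro!: nvT_divide nvT_mult nvT_coord nvT_const nvT_power)
  thus ?thesis by (cases c) (auto simp: tx_False intro!: nvT_divide nvT_const)
qed

lemma nvT_shift_tx: "U < 8 \<Longrightarrow> movers p p' \<Longrightarrow> nvT (\<lambda>x. shift p p' n (tx c x) U)"
  using q_nz by (cases "U = p'"; cases "U = p")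
    (auto simp: shift_def intro!: nvT_mult nvT_tx nvT_const dest: movers_octet)

text \<open>For each pair of coordinates the infinitely many excluded powers of \<open>q\<close> are
  the zeros of one theta function, so \<open>gen\<close> is the nonvanishing of a finite product of
  holomorphic functions. One point where it holds is then enough.\<close>

lemma gentorus_gen_aux:
  assumes x: "x \<in> torus" and g: "gen (ax True x) (tx True x)"
  shows "gentorus (\<lambda>x. gen (ax True x) (tx True x))"
proof (rule gentorusI[OF _ x])
  let ?F = "\<lambda>x. (\<Prod>U<8. \<Prod>V<8. qtheta (ax True x * tx True x U * tx True x V)) *
     (\<Prod>U<8. \<Prod>V\<in>{..<8} - {U}. qtheta (tx True x U / tx True x V))"
  show "holomorphic_on_torus ?F"
    by (intro holT_mult holT_prod holT_qtheta nvT_mult nvT_divide nvT_ax nvT_tx) auto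
  show "?F x \<noteq> 0" using genD(3,4)[OF g] by (auto intro!: qtheta_nz)
  fix y :: "complex ^ 7" assume y: "y \<in> torus" "?F y \<noteq> 0"
  note nz = nvT_nz[OF nvT_ax y(1)] nvT_nz[OF nvT_tx y(1)]
  show "gen (ax True y) (tx True y)" unfolding gen_def
  proof (intro conjI allI impI)
    fix U V :: nat and n :: int assume UV: "U < 8" "V < 8"
    have "qtheta (ax True y * tx True y U * tx True y V) \<noteq> 0" using y(2) UV by auto
    thus "ax True y * tx True y U * tx True y V \<noteq> q powi n"
      by (intro qtheta_nzD) (use nz UV in auto)
    assume "U \<noteq> V"
    hence "qtheta (tx True y U / tx True y V) \<noteq> 0" using y(2) UV by auto
    thus "tx True y U / tx True y V \<noteq> q powi n"
      by (intro qtheta_nzD) (use nz UV in auto)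
  qed (use nz in auto)
qed

end

section \<open>Special points\<close>

context q_base
begin

text \<open>Pairings and ratios determine an octet up to scaling, and
  \<open>a = (r 7)\<^sup>2\<close>, \<open>t U = r U / r 7\<close> is a scaling with
  \<open>t 7 = 1\<close>. The coordinate 5 cannot be chosen; it comes out right by the condition on
  the product.\<close>

lemma realize_True:
  assumes r: "\<And>U. U < 8 \<Longrightarrow> r U \<noteq> 0" and bal: "(\<Prod>U<8. r U) = q\<^sup>2"
  shows "\<exists>x\<in>torus. (\<forall>A<8. \<forall>B<8. ax True x * tx True x A * tx True x B = r A * r B \<and> tx True x A / tx True x B = r A / r B)"
proof -
  define v :: "7 \<Rightarrow> complex" where "v = (\<lambda>i. if i = 1 then (r 7)\<^sup>2 else if i = 2 then r 7 * r 0 else if i = 3 then r 7 * r 1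
    else if i = 4 then r 7 * r 2 else if i = 5 then r 7 * r 3 else if i = 6 then r 7 * r 4 else r 7 * r 6)"
  define x :: "complex ^ 7" where "x = (\<chi> i. v i)"
  have xs: "x $ 1 = (r 7)\<^sup>2" "x $ 2 = r 7 * r 0" "x $ 3 = r 7 * r 1" "x $ 4 = r 7 * r 2" "x $ 5 = r 7 * r 3"
    "x $ 6 = r 7 * r 4" "x $ 7 = r 7 * r 6"
    by (simp_all only: x_def vec_lambda_beta) (simp_all add: v_def)
  have nz: "r 0 \<noteq> 0" "r 1 \<noteq> 0" "r (Suc 0) \<noteq> 0" "r 2 \<noteq> 0" "r 3 \<noteq> 0" "r 4 \<noteq> 0" "r 5 \<noteq> 0" "r 6 \<noteq> 0" "r 7 \<noteq> 0"
    using r by simp_all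
  have "v i \<noteq> 0" for i using nz by (simp add: v_def)
  hence "x \<in> torus" by (simp add: torus_def x_def)
  moreover have t: "tx True x U = r U / r 7" if "U < 8" for U
  proof -
    have "r 0 * r 1 * r 2 * r 3 * r 4 * r 5 * r 6 * r 7 = q\<^sup>2" using bal by (simp add: lessThan_8 mult.assoc)
    hence "q\<^sup>2 = r 0 * r 1 * r 2 * r 3 * r 4 * r 5 * r 6 * r 7" ..
    hence t5: "tx True x 5 = r 5 / r 7" unfolding tx_True(6) xs using nz by (simp add: power2_eq_square)
    have "tx True x U = r U / r 7" if "U \<noteq> 5"
      using \<open>U < 8\<close> that nz unfolding less_8_cases
      by (elim disjE) (simp_all add: tx_True[unfolded One_nat_def] tx_True xs power2_eq_square)
    thus ?thesis using t5 by blast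
  qed
  moreover have "ax True x = (r 7)\<^sup>2" by (simp add: ax_def base_def xs)
  ultimately show ?thesis using nz by (intro bexI[of _ x]) (auto simp: power2_eq_square)
qed

lemma ax_False: "ax False x = q / ax True x"
  by (simp add: ax_def base_def)

lemma tx_dual: "tx False x = dual (tx True x)"
  by (simp add: tx_False dual_def fun_eq_iff)

lemma realize:
  assumes r: "\<And>U. U < 8 \<Longrightarrow> r U \<noteq> 0" and bal: "(\<Prod>U<8. r U) = q\<^sup>2"
  shows "\<exists>x\<in>torus. (\<forall>A<8. \<forall>B<8. ax c x * tx c x A * tx c x B = r A * r B \<and> tx c x A / tx c x B = r A / r B)"
proof (cases c)
  case True
  thus ?thesis using realize_True[OF assms] by simp
next
  case False
  define z where "z = csqrt q"
  have z: "z\<^sup>2 = q" "z \<noteq> 0" using q_nz by (auto simp: z_def)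
  have zz: "z * z = q" using z(1) by (simp add: power2_eq_square)
  \<comment> \<open>Duality replaces a pairing by \<open>q\<close> divided by it and inverts ratios.
    As \<open>z\<^sup>2 = q\<close>, realising \<open>z / r\<close> in the octet realises
    \<open>r\<close> in the dual.\<close>
  define r' where "r' = (\<lambda>U. z / r U)"
  have "(\<Prod>U<8. r' U) = z ^ 8 / q\<^sup>2" unfolding r'_def prod_dividef bal by simp
  also have "z ^ 8 = (z\<^sup>2) ^ 4" by (simp flip: power_mult)
  also have "(z\<^sup>2) ^ 4 / q\<^sup>2 = q\<^sup>2" unfolding z(1) using q_nz by (simp add: field_simps flip: power_add)
  finally have "(\<Prod>U<8. r' U) = q\<^sup>2" .
  moreover have "r' U \<noteq> 0" if "U < 8" for U using r[OF that] z by (simp add: r'_def)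
  ultimately have "\<exists>x\<in>torus. (\<forall>A<8. \<forall>B<8. ax True x * tx True x A * tx True x B = r' A * r' B \<and> tx True x A / tx True x B = r' A / r' B)"
    by (intro realize_True)
  then obtain x where x: "x \<in> torus" "\<And>A B. A < 8 \<Longrightarrow> B < 8 \<Longrightarrow> ax True x * tx True x A * tx True x B = r' A * r' B"
    "\<And>A B. A < 8 \<Longrightarrow> B < 8 \<Longrightarrow> tx True x A / tx True x B = r' A / r' B"
    by (elim bexE) simp
  have "ax False x * tx False x A * tx False x B = r A * r B \<and> tx False x A / tx False x B = r A / r B"
    if AB: "A < 8" "B < 8" for A B
  proof
    have "ax False x * tx False x A * tx False x B = q / (ax True x * tx True x A * tx True x B)"
      by (simp add: ax_False tx_False)
    also have "\<dots> = r A * r B" unfolding x(2)[OF AB] r'_def using zz r[OF AB(1)] r[OF AB(2)] q_nz by simp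
    finally show "ax False x * tx False x A * tx False x B = r A * r B" .
    have "tx False x A / tx False x B = 1 / (tx True x A / tx True x B)" by (simp add: tx_False)
    also have "\<dots> = r A / r B" unfolding x(3)[OF AB] r'_def using z by simp
    finally show "tx False x A / tx False x B = r A / r B" .
  qed
  thus ?thesis using x(1) False by (intro bexI[of _ x]) simp_all
qed

definition qexp :: "int \<Rightarrow> complex" where "qexp k = exp (Ln q / 100) powi k"

lemma qexp: "qexp k \<noteq> 0" "qexp (k + l) = qexp k * qexp l" "qexp (k - l) = qexp k / qexp l"
    "qexp 0 = 1" "qexp (100 * n) = q powi n"
proof -
  have "exp (Ln q / 100) ^ 100 = exp (of_nat 100 * (Ln q / 100))" by (rule exp_of_nat_mult[symmetric])
  hence "exp (Ln q / 100) powi 100 = q" using q_nz by simp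
  thus "qexp (100 * n) = q powi n" by (simp add: qexp_def power_int_mult)
qed (simp_all add: qexp_def power_int_add power_int_diff)

text \<open>Compares absolute values: the norm of \<open>q\<close> is not 1, so the exponent can be
  recovered from the norm. Exponents modulo 100 thus decide which products are integer powers of
  \<open>q\<close>.\<close>

lemma qexp_eq_powi: "qexp k = q powi n \<Longrightarrow> k = 100 * n"
proof -
  assume "qexp k = q powi n"
  hence "norm (qexp (k - 100 * n)) = 1" unfolding qexp(3,5) using q_nz by simp
  hence "norm (exp (Ln q / 100)) powi (k - 100 * n) = 1" unfolding qexp_def norm_power_int .
  hence "norm (exp (Ln q / 100)) powr of_int (k - 100 * n) = 1"
    by (subst powr_real_of_int') auto
  moreover have "norm (exp (Ln q / 100)) \<noteq> 1" using q_nz q_lt1 by (simp add: norm_exp_eq_Re)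
  ultimately have "(of_int (k - 100 * n) :: real) = 0"
    by (subst (asm) powr_eq_one_iff_gen) auto
  thus ?thesis by (simp only: of_int_eq_0_iff)
qed

definition pairing :: "complex \<Rightarrow> (nat \<Rightarrow> complex) \<Rightarrow> nat \<Rightarrow> nat \<Rightarrow> complex" where
  "pairing a t A B = a * t A * t B"

definition free_ratio :: "(nat \<Rightarrow> complex) \<Rightarrow> nat \<Rightarrow> nat \<Rightarrow> bool" where
  "free_ratio t A B \<longleftrightarrow> (\<forall>n::int. t A / t B \<noteq> q powi n)"

definition free_pairing :: "complex \<Rightarrow> (nat \<Rightarrow> complex) \<Rightarrow> nat \<Rightarrow> nat \<Rightarrow> bool" where
  "free_pairing a t A B \<longleftrightarrow> (\<forall>n::int. pairing a t A B \<noteq> q powi n)"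

text \<open>Points whose coordinates are powers of a hundredth root of \<open>q\<close>: \<open>K\<close> lists the exponents,
  in the order of the coordinates given by \<open>L\<close>.\<close>

lemma realize_list:
  assumes L: "distinct L" "set L = {..<8}" and K: "length K = 8" "sum_list K = 200"
    and E: "\<And>i j. i < 8 \<Longrightarrow> j < 8 \<Longrightarrow> (K ! i + K ! j) mod 100 = 0 \<Longrightarrow> {L ! i, L ! j} \<in> E"
    and D: "\<And>i j. i < 8 \<Longrightarrow> j < 8 \<Longrightarrow> i \<noteq> j \<Longrightarrow> (K ! i - K ! j) mod 100 = 0 \<Longrightarrow> {L ! i, L ! j} \<in> D"
  shows "\<exists>x\<in>torus. (\<forall>i<8. \<forall>j<8. pairing (ax c x) (tx c x) (L ! i) (L ! j) = qexp (K ! i + K ! j)) \<and>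
     (\<forall>A<8. \<forall>B<8. {A, B} \<notin> E \<longrightarrow> free_pairing (ax c x) (tx c x) A B) \<and>
     (\<forall>A<8. \<forall>B<8. A \<noteq> B \<longrightarrow> {A, B} \<notin> D \<longrightarrow> free_ratio (tx c x) A B)"
proof -
  have len: "length L = 8" using distinct_card[OF L(1)] L(2) by simp
  have bij: "bij_betw ((!) L) {..<8} {..<8}" 
    by (rule bij_betw_nth[OF L(1)]) (simp_all add: L(2) len)
  define k where "k = (\<lambda>A. K ! (inv_into {..<8} ((!) L) A))"
  have kL: "k (L ! i) = K ! i" if "i < 8" for i
    unfolding k_def using bij that by (simp add: bij_betw_def inv_into_f_f)
  have "(\<Prod>U<8. qexp (k U)) = (\<Prod>i<8. qexp (k (L ! i)))"
    by (rule prod.reindex_bij_betw[OF bij, symmetric])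
  also have "\<dots> = (\<Prod>i<8. qexp (K ! i))" by (intro prod.cong) (auto simp: kL)
  also have "\<dots> = qexp (\<Sum>i<8. K ! i)"
    by (simp add: lessThan_8 qexp(2))
  \<comment> \<open>The total 200 stands for \<open>q\<^sup>2\<close>, the value required by the
    balancing condition.\<close>
  also have "(\<Sum>i<8. K ! i) = 100 * 2" using K by (simp add: sum_list_sum_nth atLeast0LessThan)
  finally have "(\<Prod>U<8. qexp (k U)) = q\<^sup>2" unfolding qexp(5) by simp
  from realize[where c = c, OF qexp(1) this]
  obtain x where x0: "x \<in> torus" "\<And>A B. A < 8 \<Longrightarrow> B < 8 \<Longrightarrow> ax c x * tx c x A * tx c x B = qexp (k A) * qexp (k B) \<and>
      tx c x A / tx c x B = qexp (k A) / qexp (k B)"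
    by (elim bexE) simp
  have x: "x \<in> torus" "\<And>A B. A < 8 \<Longrightarrow> B < 8 \<Longrightarrow> pairing (ax c x) (tx c x) A B = qexp (k A + k B)"
    "\<And>A B. A < 8 \<Longrightarrow> B < 8 \<Longrightarrow> tx c x A / tx c x B = qexp (k A - k B)"
    using x0 by (simp_all only: pairing_def qexp(2,3))
  have L8: "L ! i < 8" if "i < 8" for i
  proof -
    have "L ! i \<in> set L" by (rule nth_mem) (simp only: len that)
    thus ?thesis unfolding L(2) lessThan_iff .
  qed
  have ex: "\<exists>i<8. A = L ! i" if "A < 8" for A
  proof -
    from that have "A \<in> set L" unfolding L(2) by simp
    thus ?thesis unfolding in_set_conv_nth len by blast
  qed
  show ?thesis
  proof (intro bexI[OF _ x(1)] conjI allI impI)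
    fix i j :: nat assume ij: "i < 8" "j < 8"
    show "pairing (ax c x) (tx c x) (L ! i) (L ! j) = qexp (K ! i + K ! j)"
      by (simp only: x(2)[OF L8[OF ij(1)] L8[OF ij(2)]] kL ij)
  next
    fix A B :: nat assume AB: "A < 8" "B < 8" "{A, B} \<notin> E"
    obtain i j where ij: "i < 8" "A = L ! i" "j < 8" "B = L ! j" using ex AB(1,2) by blast
    show "free_pairing (ax c x) (tx c x) A B" unfolding free_pairing_def x(2)[OF AB(1,2)]
    proof (intro allI notI)
      fix n assume "qexp (k A + k B) = q powi n"
      hence "K ! i + K ! j = 100 * n" unfolding ij(2,4) kL[OF ij(1)] kL[OF ij(3)] by (rule qexp_eq_powi)
      hence "(K ! i + K ! j) mod 100 = 0" by simp
      from E[OF ij(1,3) this] show False using AB(3) unfolding ij(2,4) by contradiction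
    qed
  next
    fix A B :: nat assume AB: "A < 8" "B < 8" "A \<noteq> B" "{A, B} \<notin> D"
    obtain i j where ij: "i < 8" "A = L ! i" "j < 8" "B = L ! j" using ex AB(1,2) by blast
    show "free_ratio (tx c x) A B" unfolding free_ratio_def x(3)[OF AB(1,2)]
    proof (intro allI notI)
      fix n assume "qexp (k A - k B) = q powi n"
      hence "K ! i - K ! j = 100 * n" unfolding ij(2,4) kL[OF ij(1)] kL[OF ij(3)] by (rule qexp_eq_powi)
      hence "(K ! i - K ! j) mod 100 = 0" by simp
      moreover have "i \<noteq> j" using AB(3) ij(2,4) by blast
      ultimately have "{L ! i, L ! j} \<in> D" by (intro D ij)
      thus False using AB(4) unfolding ij(2,4) by contradiction
    qed
  qed
qed

lemma less_8_nth: "(\<forall>i<8. P i) \<longleftrightarrow> P 0 \<and> P 1 \<and> P 2 \<and> P 3 \<and> P 4 \<and> P 5 \<and> P 6 \<and> P (7::nat)"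
  by (simp only: less_8_cases imp_disjL all_conj_distrib simp_thms)

lemma gentorus_gen: "gentorus (\<lambda>x. gen (ax c x) (tx c x))"
proof -
  \<comment> \<open>Powers of two have distinct sums and differences modulo 100 as required here;
    the last entry only completes the total to 200.\<close>
  define K :: "int list" where "K = [1, 2, 4, 8, 16, 32, 64, 73]"
  define L :: "nat list" where "L = [0, 1, 2, 3, 4, 5, 6, 7]"
  have Ksum: "\<forall>i<8. \<forall>j<8. (K ! i + K ! j) mod 100 = 0 \<longrightarrow> {L ! i, L ! j} \<in> {}"
    unfolding less_8_nth K_def by simp
  have Kdiff: "\<forall>i<8. \<forall>j<8. i \<noteq> j \<longrightarrow> (K ! i - K ! j) mod 100 = 0 \<longrightarrow> {L ! i, L ! j} \<in> {}"
    unfolding less_8_nth K_def by simp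
  have L: "distinct L" "set L = {..<8}" by (auto simp: L_def)
  have "length K = 8" "sum_list K = 200" by (simp_all add: K_def)
  hence "\<exists>x\<in>torus. (\<forall>i<8. \<forall>j<8. pairing (ax True x) (tx True x) (L ! i) (L ! j) = qexp (K ! i + K ! j)) \<and>
     (\<forall>A<8. \<forall>B<8. {A, B} \<notin> {} \<longrightarrow> free_pairing (ax True x) (tx True x) A B) \<and>
     (\<forall>A<8. \<forall>B<8. A \<noteq> B \<longrightarrow> {A, B} \<notin> {} \<longrightarrow> free_ratio (tx True x) A B)"
    by (rule realize_list[OF L _ _ Ksum[rule_format] Kdiff[rule_format]])
  then obtain x where x: "x \<in> torus"
    "\<And>A B. A < 8 \<Longrightarrow> B < 8 \<Longrightarrow> free_pairing (ax True x) (tx True x) A B"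
    "\<And>A B. A < 8 \<Longrightarrow> B < 8 \<Longrightarrow> A \<noteq> B \<Longrightarrow> free_ratio (tx True x) A B"
    by (elim bexE conjE) simp
  have "gen (ax True x) (tx True x)"
    unfolding gen_def using x(2,3) nvT_nz[OF nvT_ax x(1)] nvT_nz[OF nvT_tx x(1)]
    by (simp add: free_pairing_def free_ratio_def pairing_def)
  hence "gentorus (\<lambda>x. gen (ax True x) (tx True x))" by (rule gentorus_gen_aux[OF x(1)])
  thus ?thesis
  proof (rule gentorus_mono)
    fix x assume "gen (ax True x) (tx True x)"
    thus "gen (ax c x) (tx c x)" using gen_dual by (cases c) (auto simp: ax_False tx_dual)
  qed
qed

lemma special_point:
  assumes pp: "movers p p'" and w: "w \<in> mids" "m \<in> mids" "U \<in> mids" "w \<noteq> m" "w \<noteq> U" "m \<noteq> U"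
  shows "\<exists>x\<in>torus. pairing (ax c x) (tx c x) p w = 1 \<and> pairing (ax c x) (tx c x) m U = 1 \<and>
     (\<forall>A<8. \<forall>B<8. A \<noteq> B \<longrightarrow> free_ratio (tx c x) A B) \<and>
     (\<forall>A<8. \<forall>B<8. {A, B} \<noteq> {p, w} \<longrightarrow> {A, B} \<noteq> {m, U} \<longrightarrow> free_pairing (ax c x) (tx c x) A B)"
proof -
  obtain os where os: "set os = mids - {w, m, U}" "distinct os"
    using finite_distinct_list[of "mids - {w, m, U}"] by auto
  have "length os = card (mids - {w, m, U})" using distinct_card[OF os(2)] os(1) by simp
  also have "\<dots> = 3" using w by (simp add: card_Diff_subset card_mids)
  finally have "length os = 3" .
  then obtain o1 o2 o3 where os3: "os = [o1, o2, o3]" by (auto simp: length_Suc_conv numeral_eq_Suc)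
  define L where "L = [p, w, m, U, o1, o2, o3, p']"
  have Lset: "set L = {..<8}" unfolding movers_octet(1)[OF pp] L_def using w os(1) unfolding os3 by auto
  have Ld: "distinct L" unfolding L_def using w os movers_octet[OF pp] unfolding os3 by auto
  \<comment> \<open>Opposite exponents produce the two pairings equal to 1; the remaining entries
    avoid every other coincidence modulo 100, and the last one brings the total to 200.\<close>
  define K :: "int list" where "K = [1, -1, 2, -2, 4, 8, 16, 172]"
  have Kdiff: "\<forall>i<8. \<forall>j<8. i \<noteq> j \<longrightarrow> (K ! i - K ! j) mod 100 = 0 \<longrightarrow> {L ! i, L ! j} \<in> {}"
    unfolding less_8_nth K_def by simp
  have Ksum: "\<forall>i<8. \<forall>j<8. (K ! i + K ! j) mod 100 = 0 \<longrightarrow> {L ! i, L ! j} \<in> {{p, w}, {m, U}}"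
    unfolding less_8_nth K_def L_def by (simp add: insert_commute)
  have "length K = 8" "sum_list K = 200" by (simp_all add: K_def)
  hence "\<exists>x\<in>torus. (\<forall>i<8. \<forall>j<8. pairing (ax c x) (tx c x) (L ! i) (L ! j) = qexp (K ! i + K ! j)) \<and>
     (\<forall>A<8. \<forall>B<8. {A, B} \<notin> {{p, w}, {m, U}} \<longrightarrow> free_pairing (ax c x) (tx c x) A B) \<and>
     (\<forall>A<8. \<forall>B<8. A \<noteq> B \<longrightarrow> {A, B} \<notin> {} \<longrightarrow> free_ratio (tx c x) A B)"
    by (rule realize_list[OF Ld Lset _ _ Ksum[rule_format] Kdiff[rule_format]])
  then obtain x where x: "x \<in> torus"
    "\<And>i j. i < 8 \<Longrightarrow> j < 8 \<Longrightarrow> pairing (ax c x) (tx c x) (L ! i) (L ! j) = qexp (K ! i + K ! j)"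
    "\<And>A B. A < 8 \<Longrightarrow> B < 8 \<Longrightarrow> {A, B} \<notin> {{p, w}, {m, U}} \<Longrightarrow> free_pairing (ax c x) (tx c x) A B"
    "\<And>A B. A < 8 \<Longrightarrow> B < 8 \<Longrightarrow> A \<noteq> B \<Longrightarrow> free_ratio (tx c x) A B" by (elim bexE conjE) simp
  have "pairing (ax c x) (tx c x) p w = 1" "pairing (ax c x) (tx c x) m U = 1"
    using x(2)[of 0 1] x(2)[of 2 3] by (simp_all add: L_def K_def qexp(4))
  thus ?thesis using x(3,4) by (intro bexI[OF _ x(1)]) simp
qed

text \<open>Serves \<open>cross_clash\<close>. A pairing equal to \<open>q\<close> becomes 1 in the
  dual, so at such a point \<open>m\<close> has a pole through \<open>U\<close> in the octet and one
  through \<open>U'\<close> in the dual. The price is that \<open>U\<close> and \<open>U'\<close>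
  have a ratio that is a power of \<open>q\<close>.\<close>

lemma special_point':
  assumes pp: "movers p p'" and w: "w \<in> mids" "m \<in> mids" "U \<in> mids" "U' \<in> mids" "distinct [w, m, U, U']"
  shows "\<exists>x\<in>torus. pairing (ax c x) (tx c x) p w = 1 \<and> pairing (ax c x) (tx c x) m U = 1 \<and>
     pairing (ax c x) (tx c x) m U' = q \<and>
     (\<forall>A<8. \<forall>B<8. A \<noteq> B \<longrightarrow> {A, B} \<noteq> {U, U'} \<longrightarrow> free_ratio (tx c x) A B) \<and>
     (\<forall>A<8. \<forall>B<8. {A, B} \<noteq> {p, w} \<longrightarrow> {A, B} \<noteq> {m, U} \<longrightarrow> {A, B} \<noteq> {m, U'} \<longrightarrow> free_pairing (ax c x) (tx c x) A B)"
proof -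
  obtain os where os: "set os = mids - {w, m, U, U'}" "distinct os"
    using finite_distinct_list[of "mids - {w, m, U, U'}"] by auto
  have "length os = card (mids - {w, m, U, U'})" using distinct_card[OF os(2)] os(1) by simp
  also have "\<dots> = 2" using w by (simp add: card_Diff_subset card_mids)
  finally have "length os = 2" .
  then obtain o1 o2 where os2: "os = [o1, o2]" by (auto simp: length_Suc_conv numeral_eq_Suc)
  define L where "L = [p, w, m, U, U', o1, o2, p']"
  have Lset: "set L = {..<8}" unfolding movers_octet(1)[OF pp] L_def using w os(1) unfolding os2 by auto
  have Ld: "distinct L" unfolding L_def using w os movers_octet[OF pp] unfolding os2 by auto
  \<comment> \<open>The fifth entry is \<open>98 = 100 - 2\<close>, so the exponents of
    \<open>m\<close> and \<open>U'\<close> add up to one full power of \<open>q\<close>; it differs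
    from the exponent of \<open>U\<close> by 100.\<close>
  define K :: "int list" where "K = [1, -1, 2, -2, 98, 4, 8, 90]"
  have Kdiff: "\<forall>i<8. \<forall>j<8. i \<noteq> j \<longrightarrow> (K ! i - K ! j) mod 100 = 0 \<longrightarrow> {L ! i, L ! j} \<in> {{U, U'}}"
    unfolding less_8_nth K_def L_def by (simp add: insert_commute)
  have Ksum: "\<forall>i<8. \<forall>j<8. (K ! i + K ! j) mod 100 = 0 \<longrightarrow> {L ! i, L ! j} \<in> {{p, w}, {m, U}, {m, U'}}"
    unfolding less_8_nth K_def L_def by (simp add: insert_commute)
  have "length K = 8" "sum_list K = 200" by (simp_all add: K_def)
  hence "\<exists>x\<in>torus. (\<forall>i<8. \<forall>j<8. pairing (ax c x) (tx c x) (L ! i) (L ! j) = qexp (K ! i + K ! j)) \<and>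
     (\<forall>A<8. \<forall>B<8. {A, B} \<notin> {{p, w}, {m, U}, {m, U'}} \<longrightarrow> free_pairing (ax c x) (tx c x) A B) \<and>
     (\<forall>A<8. \<forall>B<8. A \<noteq> B \<longrightarrow> {A, B} \<notin> {{U, U'}} \<longrightarrow> free_ratio (tx c x) A B)"
    by (rule realize_list[OF Ld Lset _ _ Ksum[rule_format] Kdiff[rule_format]])
  then obtain x where x: "x \<in> torus"
    "\<And>i j. i < 8 \<Longrightarrow> j < 8 \<Longrightarrow> pairing (ax c x) (tx c x) (L ! i) (L ! j) = qexp (K ! i + K ! j)"
    "\<And>A B. A < 8 \<Longrightarrow> B < 8 \<Longrightarrow> {A, B} \<notin> {{p, w}, {m, U}, {m, U'}} \<Longrightarrow> free_pairing (ax c x) (tx c x) A B"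
    "\<And>A B. A < 8 \<Longrightarrow> B < 8 \<Longrightarrow> A \<noteq> B \<Longrightarrow> {A, B} \<notin> {{U, U'}} \<Longrightarrow> free_ratio (tx c x) A B"
    by (elim bexE conjE) simp
  have P: "pairing (ax c x) (tx c x) p w = 1" "pairing (ax c x) (tx c x) m U = 1" "pairing (ax c x) (tx c x) m U' = q"
    using x(2)[of 0 1] x(2)[of 2 3] x(2)[of 2 4] qexp(5)[of 1] by (simp_all add: L_def K_def qexp(4))
  show ?thesis
  proof (intro bexI[OF _ x(1)] conjI allI impI P)
    fix A B :: nat assume AB: "A < 8" "B < 8" "A \<noteq> B" "{A, B} \<noteq> {U, U'}"
    have "{A, B} \<notin> {{U, U'}}" unfolding singleton_iff by (rule AB(4))
    thus "free_ratio (tx c x) A B" by (rule x(4)[OF AB(1-3)])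
  next
    fix A B :: nat assume AB: "A < 8" "B < 8" "{A, B} \<noteq> {p, w}" "{A, B} \<noteq> {m, U}" "{A, B} \<noteq> {m, U'}"
    have "{A, B} \<notin> {{p, w}, {m, U}, {m, U'}}" unfolding insert_iff empty_iff de_Morgan_disj
      by (intro conjI AB(3-5) notI)
    thus "free_pairing (ax c x) (tx c x) A B" by (rule x(3)[OF AB(1,2)])
  qed
qed

end

section \<open>Linear independence inside a class\<close>

lemma fresh_mid:
  assumes "length xs < 6" shows "\<exists>U\<in>mids. U \<notin> set xs"
proof (rule ccontr)
  assume "\<not> ?thesis"
  hence "mids \<subseteq> set xs" by blast
  hence "card mids \<le> card (set xs)" by (intro card_mono) auto
  thus False using assms card_length[of xs] by (simp add: card_mids)
qed

context q_base
begin

lemma pairing_commute: "pairing a t A B = pairing a t B A"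
  by (simp add: pairing_def mult_ac)

lemma pairing_shift: "\<exists>k. pairing a (shift p p' n t) A B = pairing a t A B * q powi k"
proof -
  obtain k l where "shift p p' n t A = t A * q powi k" "shift p p' n t B = t B * q powi l"
    using shift_cases[of p p' n t A] shift_cases[of p p' n t B] by blast
  thus ?thesis using q_nz by (intro exI[of _ "k + l"]) (simp add: pairing_def power_int_add)
qed

lemma free_pairing_shift: "free_pairing a t A B \<Longrightarrow> free_pairing a (shift p p' n t) A B"
  using pairing_shift[of a p p' n t A B] notin_powers_shift unfolding free_pairing_def by blast

lemma free_ratio_shift: "free_ratio t A B \<Longrightarrow> free_ratio (shift p p' n t) A B"
proof -
  assume f: "free_ratio t A B"
  obtain k l where "shift p p' n t A = t A * q powi k" "shift p p' n t B = t B * q powi l"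
    using shift_cases[of p p' n t A] shift_cases[of p p' n t B] by blast
  hence "shift p p' n t A / shift p p' n t B = t A / t B * q powi (k - l)"
    using q_nz by (simp add: power_int_diff)
  thus ?thesis using f notin_powers_shift unfolding free_ratio_def by blast
qed

lemma pairing_dual: "pairing (q / a) (dual t) A B = q / pairing a t A B"
  by (simp add: pairing_def dual_def)

lemma free_pairing_dual: "free_pairing a t A B \<Longrightarrow> free_pairing (q / a) (dual t) A B"
  unfolding free_pairing_def pairing_dual
proof (intro allI notI)
  fix n assume f: "\<forall>n::int. pairing a t A B \<noteq> q powi n" and e: "q / pairing a t A B = q powi n"
  have "pairing a t A B \<noteq> 0" using e q_nz by auto
  hence "pairing a t A B = q powi (1 - n)"
    using e q_nz by (simp add: power_int_diff field_simps)
  thus False using f by blast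
qed

lemma free_ratio_dual: "free_ratio t B A \<Longrightarrow> free_ratio (dual t) A B"
  by (simp add: free_ratio_def dual_def)

lemma qi_free: "free_pairing a t A B \<Longrightarrow> qi (pairing a t A B) \<noteq> 0"
  unfolding free_pairing_def by (rule qi_nz) blast

section \<open>Differences of sums with the denominators cleared\<close>

definition denx :: "complex \<Rightarrow> (nat \<Rightarrow> complex) \<Rightarrow> nat \<Rightarrow> nat \<Rightarrow> complex" where
  "denx a t A W = (\<Prod>U\<in>{..<8} - {W}. qi (pairing a t A U))"

lemma den_split: "W < 8 \<Longrightarrow> den a t A = denx a t A W * qi (pairing a t A W)"
  unfolding den_def denx_def pairing_def
  by (subst prod.remove[of "{..<8}" W]) (simp_all add: mult.commute)

lemma den_ne_0: "(\<And>U. U < 8 \<Longrightarrow> qi (pairing a t A U) \<noteq> 0) \<Longrightarrow> den a t A \<noteq> 0"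
  unfolding den_def pairing_def by simp

lemma denx_ne_0: "(\<And>U. U < 8 \<Longrightarrow> U \<noteq> W \<Longrightarrow> qi (pairing a t A U) \<noteq> 0) \<Longrightarrow> denx a t A W \<noteq> 0"
  unfolding denx_def by simp

lemma den_eq_0: "pairing a t A W = 1 \<Longrightarrow> W < 8 \<Longrightarrow> den a t A = 0"
  by (simp add: den_split[of W] qi_1)

text \<open>The factor \<open>qpoch q 1 k\<close> is zero for \<open>k > 0\<close>, so only the term
  with \<open>k = 0\<close> is left. It is a product whose factors are nonzero because the start
  meets no other progression.\<close>

lemma hsum_ne_0:
  assumes A: "A < 8" "W < 8" and P: "pairing a t A W = 1"
    and free: "free_pairing a t A A" "\<And>U. U < 8 \<Longrightarrow> U \<noteq> A \<Longrightarrow> free_ratio t A U"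
  shows "hsum a t A \<noteq> 0"
proof -
  have "t A \<noteq> 0" using P by (auto simp: pairing_def)
  have "hterm a t A k = 0" if "k \<notin> {0}" for k
  proof -
    have "qpoch q (a * t A * t W) k = 0"
      using P that unfolding qpoch_def pairing_def by (auto intro!: bexI[of _ 0])
    hence "(\<Prod>U<8. qi (q * (t A * q ^ k) / t U) * qpoch q (a * t A * t U) k) = 0"
      using A by (intro prod_zero) auto
    thus ?thesis by (simp add: hterm_def)
  qed
  hence "hsum a t A = hterm a t A 0" unfolding hsum_def by (subst suminf_finite[of "{0}"]) auto
  moreover have "hterm a t A 0 \<noteq> 0"
  proof -
    have "1 - a * (t A)\<^sup>2 \<noteq> 0"
      using free(1)[unfolded free_pairing_def pairing_def, rule_format, of 0] by (simp add: power2_eq_square mult.assoc)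
    moreover have "qi (q * t A / t U) \<noteq> 0" if U: "U < 8" for U
    proof (cases "U = A")
      case True
      thus ?thesis using \<open>t A \<noteq> 0\<close> qi_q by simp
    next
      case False
      have "q * t A / t U \<noteq> q powi n" for n
        by (rule notin_powers_shift[of "t A / t U" _ 1]) (use free(2)[OF U False] in \<open>auto simp: free_ratio_def\<close>)
      thus ?thesis by (rule qi_nz)
    qed
    ultimately show ?thesis using \<open>t A \<noteq> 0\<close> by (simp add: hterm_def qpoch_def)
  qed
  ultimately show ?thesis by simp
qed

text \<open>The difference of two sums multiplied by both denominators. Unlike the difference itself
  it is holomorphic on the whole torus, so it can be evaluated at poles.\<close>

definition cl :: "complex \<Rightarrow> (nat \<Rightarrow> complex) \<Rightarrow> nat \<Rightarrow> nat \<Rightarrow> complex" where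
  "cl a t A B = hsum a t A * den a t B - hsum a t B * den a t A"

lemma cl_gen:
  assumes "gen a t" "A < 8" "B < 8"
  shows "cl a t A B = (fsum a t A - fsum a t B) * (den a t A * den a t B)"
  using den_nz[OF assms(1,2)] den_nz[OF assms(1,3)]
  by (simp add: cl_def fsum_den[OF assms(1)] assms(2,3) field_simps)

lemma cl_ne_0:
  assumes "A < 8" "W < 8" "pairing a t A W = 1" "free_pairing a t A A"
    "\<And>U. U < 8 \<Longrightarrow> U \<noteq> A \<Longrightarrow> free_ratio t A U" "den a t B \<noteq> 0"
  shows "cl a t A B \<noteq> 0"
  using hsum_ne_0[OF assms(1-5)] assms(6) den_eq_0[OF assms(3,2)] by (simp add: cl_def)

lemma holT_pairing:
  assumes "nvT A" "\<And>U. U < 8 \<Longrightarrow> nvT (\<lambda>x. t x U)" "S < 8" "T < 8"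
  shows "holomorphic_on_torus (\<lambda>x. pairing (A x) (t x) S T)"
  unfolding pairing_def using assms by (intro nvT_hol nvT_mult) auto

lemma holT_denx:
  assumes "nvT A" "\<And>U. U < 8 \<Longrightarrow> nvT (\<lambda>x. t x U)" "T < 8"
  shows "holomorphic_on_torus (\<lambda>x. denx (A x) (t x) T W)"
  unfolding denx_def using assms by (intro holT_prod holT_qi holT_pairing) auto

lemma holT_cl:
  assumes "nvT A" "\<And>U. U < 8 \<Longrightarrow> nvT (\<lambda>x. t x U)" "S < 8" "T < 8"
  shows "holomorphic_on_torus (\<lambda>x. cl (A x) (t x) S T)"
  unfolding cl_def using assms by (intro holT_diff holT_mult holT_hsum holT_den) auto

text \<open>
  The second pairing \<open>{m, U}\<close> is forced to 1 as well: both products in the determinant then have a pole at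
  \<open>m\<close>, which is divided out, whereas the pole at \<open>{p, w}\<close> is present before the shift only.
\<close>

lemma class_independent_aux:
  assumes pp: "movers p p'" and w: "w \<in> mids" "m \<in> mids" "w \<noteq> m"
    and T: "T = w \<or> T = p" and V: "V < 8" "V \<notin> {w, p, m}" "V' < 8" "V' \<notin> {w, p, m}"
  shows "gentorus (\<lambda>x. gen (ax c x) (tx c x) \<and>
    (let f = fsum (ax c x) (tx c x); g = fsum (ax c x) (shift p p' 1 (tx c x)) in
     (f T - f V) * (g m - g V') \<noteq> (g T - g V) * (f m - f V')))"
proof -
  obtain U where U: "U \<in> mids" "U \<notin> {w, m, V, V'}" using fresh_mid[of "[w, m, V, V']"] by auto
  define W where "W = (if T = w then p else w)"
  note mo = movers_octet[OF pp]
  have le: "w < 8" "m < 8" "U < 8" "T < 8" "W < 8" "p < 8" "p' < 8"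
    using w U T mo mids_less by (auto simp: W_def)
  have ne: "w \<noteq> p" "m \<noteq> p" "U \<noteq> p" "w \<noteq> p'" "m \<noteq> p'" "U \<noteq> p'" "p \<noteq> p'" using w U mo by auto
  define s where "s = (\<lambda>x. shift p p' 1 (tx c x))"
  have "nvT (\<lambda>x. s x U)" if "U < 8" for U unfolding s_def by (rule nvT_shift_tx[OF that pp])
  note nv = nvT_ax[of c] nvT_tx[of _ c] this
  \<comment> \<open>The determinant times all denominators, divided by the square of
    \<open>qi (pairing a t m U)\<close>. Each product gets one such factor from \<open>den\<close>
    of \<open>m\<close>, hence \<open>denx\<close>; this pairing is unaffected by the shift since
    \<open>m\<close> and \<open>U\<close> are fixed, so it can be taken out of both products
    alike.\<close>
  define K where "K = (\<lambda>x. cl (ax c x) (tx c x) T V * cl (ax c x) (s x) m V' *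
      (den (ax c x) (s x) T * den (ax c x) (s x) V * denx (ax c x) (tx c x) m U * den (ax c x) (tx c x) V')
     - cl (ax c x) (s x) T V * cl (ax c x) (tx c x) m V' *
      (den (ax c x) (tx c x) T * den (ax c x) (tx c x) V * denx (ax c x) (s x) m U * den (ax c x) (s x) V'))"
  have hol: "holomorphic_on_torus K"
    unfolding K_def by (intro holT_diff holT_mult holT_cl holT_den holT_denx nv le V)
  have mU: "m \<noteq> U" "w \<noteq> U" using U by auto
  from special_point[OF pp w(1,2) U(1) w(3) mU(2,1), of c] obtain x where x: "x \<in> torus"
    "pairing (ax c x) (tx c x) p w = 1" "pairing (ax c x) (tx c x) m U = 1"
    "\<And>A B. A < 8 \<Longrightarrow> B < 8 \<Longrightarrow> A \<noteq> B \<Longrightarrow> free_ratio (tx c x) A B"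
    "\<And>A B. A < 8 \<Longrightarrow> B < 8 \<Longrightarrow> {A, B} \<noteq> {p, w} \<Longrightarrow> {A, B} \<noteq> {m, U} \<Longrightarrow> free_pairing (ax c x) (tx c x) A B"
    by (elim bexE conjE) simp
  define a t where "a = ax c x" and "t = tx c x"
  note x = x[folded a_def t_def]
  have st: "s x = shift p p' 1 t" by (simp add: s_def t_def)
  have ratio: "free_ratio (s x) A B" if "A < 8" "B < 8" "A \<noteq> B" for A B
    unfolding st by (rule free_ratio_shift, rule x(4)[OF that])
  have free: "free_pairing a (s x) A B" if "A < 8" "B < 8" "{A, B} \<noteq> {p, w}" "{A, B} \<noteq> {m, U}" for A B
    unfolding st by (rule free_pairing_shift, rule x(5)[OF that])
  have TW: "{T, W} = {p, w}" using T by (auto simp: W_def)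
  have ptw: "pairing a t T W = 1" using x(2) T by (auto simp: W_def pairing_commute)
  have pmu: "pairing a (s x) m U = 1" using x(3) ne by (simp add: pairing_def st)
  \<comment> \<open>The shift multiplies the pairing of \<open>p\<close> and \<open>w\<close> by
    \<open>q\<close>: before it the denominator of \<open>T\<close> contains
    \<open>qi 1 = 0\<close>, after it \<open>qi q\<close>, which is not zero.\<close>
  have psw: "pairing a (s x) T W = q" 
    using ptw T ne by (auto simp: pairing_def st W_def mult_ac)
  have den: "den a t B \<noteq> 0" "den a (s x) B \<noteq> 0" if "B < 8" "B \<notin> {w, p, m, U}" for B
  proof -
    show "den a t B \<noteq> 0"
      by (rule den_ne_0, rule qi_free, rule x(5)) (use that in \<open>auto simp: doubleton_eq_iff\<close>)
    show "den a (s x) B \<noteq> 0"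
      by (rule den_ne_0, rule qi_free, rule free) (use that in \<open>auto simp: doubleton_eq_iff\<close>)
  qed
  have mU: "m \<noteq> U" "T \<noteq> m" "T \<noteq> U" using U T w(3) ne by auto
  have "cl a t T V \<noteq> 0"
    by (rule cl_ne_0[OF le(4,5) ptw x(5) x(4) den(1)])
       (use le V U TW mU ne(1-3) in \<open>auto simp: doubleton_eq_iff W_def split: if_splits\<close>)
  moreover have "cl a (s x) m V' \<noteq> 0"
    by (rule cl_ne_0[OF le(2,3) pmu free ratio den(2)])
       (use le V U ne w mU in \<open>auto simp: doubleton_eq_iff\<close>)
  moreover have "den a (s x) T \<noteq> 0"
  proof (rule den_ne_0)
    fix B :: nat assume B: "B < 8"
    show "qi (pairing a (s x) T B) \<noteq> 0"
    proof (cases "B = W")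
      case True
      thus ?thesis using psw qi_q by simp
    next
      case False
      show ?thesis by (rule qi_free, rule free[OF le(4) B]) (use False TW mU in \<open>auto simp: doubleton_eq_iff\<close>)
    qed
  qed
  moreover have "denx a t m U \<noteq> 0"
    by (rule denx_ne_0, rule qi_free, rule x(5)) (use le ne w mU in \<open>auto simp: doubleton_eq_iff\<close>)
  moreover have "den a (s x) V \<noteq> 0" by (rule den(2)[OF V(1)]) (use V U in auto)
  moreover have "den a t V' \<noteq> 0" by (rule den(1)[OF V(3)]) (use V U in auto)
  moreover have "den a t T = 0" by (rule den_eq_0[OF ptw le(5)])
  ultimately have "K x \<noteq> 0" by (simp add: K_def a_def t_def)
  from gentorus_conj[OF gentorus_gen[of c] gentorus_ne_0[OF hol x(1) this]] show ?thesis
  proof (rule gentorus_mono)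
    fix y assume y: "gen (ax c y) (tx c y) \<and> K y \<noteq> 0"
    define a t where "a = ax c y" and "t = tx c y"
    have g: "gen a t" "gen a (s y)" using y by (auto simp: a_def t_def s_def intro: gen_shift)
    have nz: "qi (pairing a t m U) \<noteq> 0"
      unfolding pairing_def by (rule qi_nz, rule genD(3)[OF g(1) le(2,3)])
    have pe: "pairing a (s y) m U = pairing a t m U" using ne by (simp add: pairing_def s_def t_def)
    have d: "den a t m = denx a t m U * qi (pairing a t m U)" "den a (s y) m = denx a (s y) m U * qi (pairing a t m U)"
      using den_split[OF le(3), of a t m] den_split[OF le(3), of a "s y" m] pe by simp_all
    have "K y * qi (pairing a t m U) =
      ((fsum a t T - fsum a t V) * (fsum a (s y) m - fsum a (s y) V') -
       (fsum a (s y) T - fsum a (s y) V) * (fsum a t m - fsum a t V')) *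
      (den a t T * den a t V * den a (s y) T * den a (s y) V * denx a t m U * denx a (s y) m U
        * den a t V' * den a (s y) V' * qi (pairing a t m U) * qi (pairing a t m U))"
      unfolding K_def a_def[symmetric] t_def[symmetric] cl_gen[OF g(1) le(4) V(1)] cl_gen[OF g(2) le(4) V(1)]
        cl_gen[OF g(1) le(2) V(3)] cl_gen[OF g(2) le(2) V(3)] d
      by (simp add: algebra_simps)
    moreover have "K y * qi (pairing a t m U) \<noteq> 0" using y nz by simp
    ultimately have "(fsum a t T - fsum a t V) * (fsum a (s y) m - fsum a (s y) V') -
       (fsum a (s y) T - fsum a (s y) V) * (fsum a t m - fsum a t V') \<noteq> 0"
      by (metis mult_zero_left)
    thus "gen (ax c y) (tx c y) \<and> (let f = fsum (ax c y) (tx c y); g = fsum (ax c y) (shift p p' 1 (tx c y)) in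
     (f T - f V) * (g m - g V') \<noteq> (g T - g V) * (f m - f V'))"
      using y by (simp add: Let_def a_def t_def s_def)
  qed
qed

end

lemma octet_cases: "T < 8 \<Longrightarrow> T \<in> mids \<or> T = 5 \<or> T = 6"
  by (auto simp: mids_def)

lemma octet_pairs_aux:
  assumes 8: "A < 8" "B < 8" "C < 8" "D < 8" and ne: "A \<noteq> B" "C \<noteq> D" "A \<notin> {C, D}"
    and mid: "\<And>m. m \<in> mids \<Longrightarrow> m \<in> {A, B} \<longleftrightarrow> m \<in> {C, D}"
  shows "\<exists>m p p'. m \<in> mids \<and> movers p p' \<and> {A, B} = {m, p} \<and> {C, D} = {m, p'}"
proof -
  have A: "A = 5 \<or> A = 6" using octet_cases[OF 8(1)] mid[of A] ne(3) by blast
  have *: "\<exists>m p p'. m \<in> mids \<and> movers p p' \<and> {A, B} = {m, p} \<and> {B, E} = {m, p'}"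
    if E: "E < 8" "B \<noteq> E" "A \<noteq> E" "E \<in> mids \<Longrightarrow> E \<in> {A, B}" for E
  proof -
    have "E = 5 \<or> E = 6" using octet_cases[OF E(1)] E(2-4) by blast
    hence m: "movers A E" using A E(3) by (auto simp: movers_def)
    have "B \<noteq> 5" "B \<noteq> 6" using m ne(1) E(2) by (auto simp: movers_def)
    hence "B \<in> mids" using octet_cases[OF 8(2)] by blast
    thus ?thesis using m by (intro exI[of _ B] exI[of _ A] exI[of _ E]) (simp add: insert_commute)
  qed
  consider "B = C" | "B = D" | "B \<noteq> C" "B \<noteq> D" by blast
  thus ?thesis
  proof cases
    case 1
    show ?thesis unfolding 1[symmetric] by (rule *) (use 8 ne mid[of D] 1 in auto)
  next
    case 2
    have "{C, D} = {B, C}" using 2 by auto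
    thus ?thesis by (simp only:) (rule *, use 8 ne mid[of C] 2 in auto)
  next
    case 3
    have "B = 5 \<or> B = 6" using octet_cases[OF 8(2)] mid[of B] 3 by blast
    moreover have "C = 5 \<or> C = 6" using octet_cases[OF 8(3)] mid[of C] 3 ne by blast
    ultimately show ?thesis using A ne 3 by auto
  qed
qed

text \<open>The argument with poles needs a fixed coordinate that lies in one pair only. As just two
  coordinates move, its absence forces the pairs to share a fixed coordinate and to contain one
  mover each.\<close>

lemma octet_pairs:
  assumes 8: "T < 8" "V < 8" "T' < 8" "V' < 8" and ne: "T \<noteq> V" "T' \<noteq> V'" "{T, V} \<noteq> {T', V'}"
  shows "(\<exists>m\<in>mids. m \<in> {T', V'} \<and> m \<notin> {T, V}) \<or> (\<exists>m\<in>mids. m \<in> {T, V} \<and> m \<notin> {T', V'}) \<or>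
    (\<exists>m p p'. m \<in> mids \<and> movers p p' \<and> {T, V} = {m, p} \<and> {T', V'} = {m, p'})"
proof (rule ccontr)
  assume N: "\<not> ?thesis"
  hence mid: "m \<in> {T, V} \<longleftrightarrow> m \<in> {T', V'}" if "m \<in> mids" for m using that by blast
  from N have n: "\<not> (\<exists>m p p'. m \<in> mids \<and> movers p p' \<and> {T, V} = {m, p} \<and> {T', V'} = {m, p'})" by blast
  have "T \<notin> {T', V'} \<or> V \<notin> {T', V'}" using ne by auto
  thus False
  proof
    assume "T \<notin> {T', V'}"
    from octet_pairs_aux[OF 8 ne(1,2) this mid] n show False by contradiction
  next
    assume V: "V \<notin> {T', V'}"
    have "{V, T} = {T, V}" by auto
    from octet_pairs_aux[OF 8(2,1,3,4) ne(1)[symmetric] ne(2) V, unfolded this, OF mid] n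
    show False by contradiction
  qed
qed

context q_base
begin

section \<open>Solutions as functions on the torus\<close>

definition sx :: "bool \<Rightarrow> int \<Rightarrow> complex ^ 7 \<Rightarrow> nat \<Rightarrow> complex" where
  "sx c n x = octc c (x $ 1) (bx x) (x $ 7) n"

lemma sx_0: "sx c 0 x = tx c x"
  by (simp add: sx_def tx_def)

lemma sx_shift: "sx c n x = shift (mover c) (mover (\<not> c)) n (tx c x)"
  unfolding sx_def tx_def by (rule octc_shift)

lemma sx_False: "sx False n x = dual (sx True n x)"
  by (simp add: sx_def octc_def)

lemma shift_tx:
  assumes "movers p p'" shows "shift p p' 1 (tx c x) = sx c (if p = mover c then 1 else - 1) x"
proof (cases "p = mover c")
  case True
  hence "p' = mover (\<not> c)" using assms by (auto simp: movers_def mover_def split: if_splits)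
  thus ?thesis using True by (simp add: sx_shift)
next
  case False
  hence p: "p = mover (\<not> c)" "p' = mover c" using assms by (auto simp: movers_def mover_def split: if_splits)
  hence "p \<noteq> p'" using movers_octet(4)[OF assms] by simp
  from shift_swap[OF this, of 1] show ?thesis using False p by (simp add: sx_shift)
qed

lemma gen_sx: "gen (ax c x) (tx c x) \<Longrightarrow> gen (ax c x) (sx c n x)"
  unfolding sx_shift by (rule gen_shift)

lemma gen_ax: "gen (ax True x) (tx True x) \<Longrightarrow> gen (ax c x) (tx c x)"
  using gen_dual by (cases c) (auto simp: ax_False tx_dual)

lemma nvT_sx: "U < 8 \<Longrightarrow> nvT (\<lambda>x. sx c n x U)"
  unfolding sx_shift by (rule nvT_shift_tx) simp_all

definition sol :: "bool \<Rightarrow> nat \<Rightarrow> nat \<Rightarrow> complex ^ 7 \<Rightarrow> int \<Rightarrow> complex" where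
  "sol c T V x n = mu (ax c x) (tx c x) (mover c) (mover (\<not> c)) n *
     (fsum (ax c x) (sx c n x) T - fsum (ax c x) (sx c n x) V)"

text \<open>A nonzero determinant of the values at 0 and at some \<open>n\<close>. The index 0 is
  kept fixed, as the special points are prescribed there.\<close>

definition indep :: "bool \<Rightarrow> nat \<Rightarrow> nat \<Rightarrow> bool \<Rightarrow> nat \<Rightarrow> nat \<Rightarrow> complex ^ 7 \<Rightarrow> bool" where
  "indep c T V c' T' V' x \<longleftrightarrow>
     (\<exists>n. sol c T V x 0 * sol c' T' V' x n \<noteq> sol c T V x n * sol c' T' V' x 0)"

lemma sol_swap: "sol c V T x n = - sol c T V x n"
  by (simp add: sol_def algebra_simps)

lemma sol_add: "sol c T U x n = sol c T V x n + sol c V U x n"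
  by (simp add: sol_def algebra_simps)

lemma indep_swap: "indep c V T c' T' V' = indep c T V c' T' V'" "indep c T V c' V' T' = indep c T V c' T' V'"
  by (simp_all add: indep_def fun_eq_iff sol_swap[of c V T] sol_swap[of c' V' T'])

lemma indep_commute: "indep c' T' V' c T V = indep c T V c' T' V'"
  unfolding indep_def fun_eq_iff by (metis mult.commute)

lemma mu_nz:
  assumes gen: "gen a t" and pp: "movers p p'" shows "mu a t p p' n \<noteq> 0"
proof -
  have p8: "p < 8" "p' < 8" "p \<noteq> p'" using movers_octet[OF pp] by auto
  note g = gen_shift[OF gen, of p p' n]
  have "a * t p * t p' / q \<noteq> 0" using genD(1,2)[OF gen] p8 q_nz by simp
  moreover have "qi (shift p p' n t p / shift p p' n t p') \<noteq> 0"
    by (rule qi_nz, rule genD(4)[OF g p8])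
  moreover have "qi (q / (a * shift p p' n t p' * t m)) \<noteq> 0" if "m \<in> mids" for m
    using mid_nz(2)[OF g pp that] shift_mid[OF pp that] by simp
  ultimately show ?thesis unfolding mu_def by simp
qed

lemma gentorus_indep_aux:
  assumes "movers p p'" "w \<in> mids" "m \<in> mids" "w \<noteq> m" "T = w \<or> T = p" "V < 8" "V \<notin> {w, p, m}" "V' < 8" "V' \<notin> {w, p, m}"
  shows "gentorus (indep c T V c m V')"
proof (rule gentorus_mono[OF class_independent_aux[OF assms]])
  fix x
  define n :: int where "n = (if p = mover c then 1 else - 1)"
  assume H: "gen (ax c x) (tx c x) \<and> (let f = fsum (ax c x) (tx c x); g = fsum (ax c x) (shift p p' 1 (tx c x)) in
     (f T - f V) * (g m - g V') \<noteq> (g T - g V) * (f m - f V'))"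
  have g: "gen (ax c x) (tx c x)" using H by blast
  have "mu (ax c x) (tx c x) (mover c) (mover (\<not> c)) k \<noteq> 0" for k
    by (rule mu_nz[OF g movers_mover])
  thus "indep c T V c m V' x"
    unfolding indep_def using H unfolding shift_tx[OF assms(1)] n_def[symmetric] Let_def
    by (intro exI[of _ n]) (simp add: sol_def sx_0)
qed

text \<open>\<open>gentorus_indep_aux\<close> wants \<open>T\<close> to be \<open>w\<close> or
  \<open>p\<close>, with \<open>V\<close> and \<open>V'\<close> different from both. A moving
  \<open>T\<close> is taken as \<open>p\<close>, with a fresh \<open>w\<close>; a fixed
  \<open>T\<close> is taken as \<open>w\<close>, with a mover not occupied by \<open>V\<close> or
  \<open>V'\<close>.\<close>

lemma class_independent_mid:
  assumes m: "m \<in> mids" "m \<noteq> T" "m \<noteq> V" "m \<noteq> V'" and 8: "T < 8" "V < 8" "V' < 8" and TV: "T \<noteq> V"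
  shows "gentorus (indep c T V c m V')"
proof -
  have mover: "gentorus (indep c T V c m V')" if "movers T p'" "T \<noteq> V'" "T \<noteq> V" "V < 8" "m \<noteq> V" for T V p'
  proof -
    obtain w where w: "w \<in> mids" "w \<notin> {T, V, m, V'}" using fresh_mid[of "[T, V, m, V']"] by auto
    show ?thesis by (rule gentorus_indep_aux[OF that(1) w(1) m(1)]) (use w(2) that m 8 in auto)
  qed
  have *: "gentorus (indep c T V c m V')"
    if T: "T \<noteq> V'" "T \<noteq> V" "T < 8" "V < 8" "m \<noteq> T" "m \<noteq> V" for T V
  proof (cases "T \<in> mids")
    case False
    hence "T = 5 \<or> T = 6" using octet_cases[OF T(3)] by blast
    hence "movers T (11 - T)" by (auto simp: movers_def)
    from mover[OF this] show ?thesis using T by blast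
  next
    case True
    show ?thesis
    proof (cases "\<exists>p p'. movers p p' \<and> p \<noteq> V \<and> p \<noteq> V'")
      case True
      then obtain p p' where p: "movers p p'" "p \<noteq> V" "p \<noteq> V'" by blast
      have "m \<noteq> p" using movers_octet(2)[OF p(1)] m(1) by blast
      thus ?thesis by (intro gentorus_indep_aux[OF p(1) \<open>T \<in> mids\<close> m(1)]) (use p T m 8 in auto)
    next
      \<comment> \<open>Both movers are occupied, one by \<open>V\<close> and one by
        \<open>V'\<close>. Exchanging \<open>T\<close> and \<open>V\<close> only changes a sign and
        makes the first coordinate a mover.\<close>
      case False
      have "movers 5 6" "movers 6 5" by (simp_all add: movers_def)
      with False have "5 = V \<or> 5 = V'" "6 = V \<or> 6 = V'" by blast+
      hence "(V = 5 \<and> V' = 6) \<or> (V = 6 \<and> V' = 5)" by linarith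
      hence V: "movers V V'" by (simp add: movers_def)
      have "gentorus (indep c V T c m V')"
        by (rule mover[OF V movers_octet(4)[OF V]]) (use T in auto)
      thus ?thesis unfolding indep_swap(1)[of c T V] .
    qed
  qed
  show ?thesis
  proof (cases "T = V'")
    case False
    thus ?thesis using m 8 TV by (intro *) auto
  next
    case True
    have "gentorus (indep c V T c m V')" using m 8 TV True by (intro *) auto
    thus ?thesis unfolding indep_swap(1)[of c V T] .
  qed
qed

lemma class_independent:
  assumes 8: "T < 8" "V < 8" "T' < 8" "V' < 8" and ne: "T \<noteq> V" "T' \<noteq> V'" "{T, V} \<noteq> {T', V'}"
  shows "gentorus (indep c T V c T' V')"
proof -
  have mid: "gentorus (indep c T V c T' V')"
    if "m \<in> mids" "m \<in> {T', V'}" "m \<notin> {T, V}" "T < 8" "V < 8" "T' < 8" "V' < 8" "T \<noteq> V" "T' \<noteq> V'" for T V T' V' m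
  proof (cases "m = T'")
    case True
    thus ?thesis using that by (intro class_independent_mid) auto
  next
    case False
    hence "m = V'" using that by blast
    hence "gentorus (indep c T V c V' T')" using that by (intro class_independent_mid) auto
    thus ?thesis unfolding indep_swap(2)[of c T V c T' V'] .
  qed
  \<comment> \<open>No fixed coordinate tells these pairs apart. But \<open>S_m - S_p'\<close> is
    the sum of \<open>S_m - S_p\<close> and \<open>S_p - S_p'\<close>, so its determinant with
    \<open>S_m - S_p\<close> reduces to that of \<open>S_p - S_p'\<close>, where \<open>m\<close>
    lies in one pair only.\<close>
  have special: "gentorus (indep c m p c m p')" if m: "m \<in> mids" and pp: "movers p p'" for m p p'
  proof -
    note mo = movers_octet[OF pp]
    have "gentorus (indep c p p' c m p)"
      by (rule mid[OF m]) (use mo m mids_less[OF m] in auto)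
    thus ?thesis
    proof (rule gentorus_mono)
      fix x assume "indep c p p' c m p x"
      then obtain n where n: "sol c p p' x 0 * sol c m p x n \<noteq> sol c p p' x n * sol c m p x 0"
        unfolding indep_def by blast
      show "indep c m p c m p' x"
        unfolding indep_def sol_add[of c m p' x _ p] by (rule exI[of _ n]) (use n in \<open>simp add: algebra_simps\<close>)
    qed
  qed
  consider m where "m \<in> mids" "m \<in> {T', V'}" "m \<notin> {T, V}" | m where "m \<in> mids" "m \<in> {T, V}" "m \<notin> {T', V'}"
    | m p p' where "m \<in> mids" "movers p p'" "{T, V} = {m, p}" "{T', V'} = {m, p'}"
    using octet_pairs[OF assms] by (elim disjE exE bexE conjE)
  thus ?thesis
  proof cases
    case 1
    thus ?thesis by (rule mid) (use assms in auto)
  next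
    case 2
    have "gentorus (indep c T' V' c T V)" using 2 by (rule mid) (use assms in auto)
    thus ?thesis unfolding indep_commute[of c T V] .
  next
    case 3
    have "T = m \<and> V = p \<or> T = p \<and> V = m" "T' = m \<and> V' = p' \<or> T' = p' \<and> V' = m"
      using 3(3,4) unfolding doubleton_eq_iff by blast+
    hence "indep c T V c T' V' = indep c m p c m p'"
      by (elim disjE conjE) (simp_all add: indep_swap)
    thus ?thesis using special[OF 3(1,2)] by simp
  qed
qed

end

section \<open>Linear independence across the classes\<close>

lemma nvT_powi: "nvT F \<Longrightarrow> nvT (\<lambda>x. F x powi n)"
proof (cases "n \<ge> 0")
  case True
  assume "nvT F"
  thus ?thesis using nvT_power[of F "nat n"] True by (simp add: power_int_def)
next
  case False
  assume "nvT F"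
  hence "nvT (\<lambda>x. 1 / F x ^ nat (- n))" by (intro nvT_divide nvT_const nvT_power) auto
  thus ?thesis using False by (simp add: power_int_def field_simps)
qed

context q_base
begin

text \<open>For the \<open>n\<close> found at \<open>x\<close>, the determinant with cleared
  denominators is holomorphic on the torus and nonzero at \<open>x\<close>, hence nonzero
  generically. Read contrapositively, failure of generic independence means dependence at every
  point where \<open>gen\<close> holds.\<close>

lemma indep_spread:
  assumes x: "x \<in> torus" "gen (ax True x) (tx True x)" "indep c T V c' T' V' x"
    and 8: "T < 8" "V < 8" "T' < 8" "V' < 8"
  shows "gentorus (indep c T V c' T' V')"
proof -
  define N where "N = (\<lambda>c T V n x. (ax c x * tx c x (mover c) * tx c x (mover (\<not> c)) / q) powi n *
    qi (sx c n x (mover c) / sx c n x (mover (\<not> c))) * cl (ax c x) (sx c n x) T V)"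
  define D where "D = (\<lambda>c T V n x. (\<Prod>m\<in>mids. qi (q / (ax c x * sx c n x (mover (\<not> c)) * tx c x m))) *
     (den (ax c x) (sx c n x) T * den (ax c x) (sx c n x) V))"
  have m8: "mover c < 8" for c by (simp add: mover_def)
  have hol: "holomorphic_on_torus (N c T V n)" "holomorphic_on_torus (D c T V n)" if "T < 8" "V < 8" for c T V n
  proof -
    show "holomorphic_on_torus (N c T V n)" unfolding N_def using q_nz that
      by (intro holT_mult holT_qi holT_cl nvT_hol[OF nvT_powi] nvT_hol[OF nvT_divide] nvT_divide nvT_mult nvT_ax nvT_tx nvT_sx
          nvT_const m8)
    show "holomorphic_on_torus (D c T V n)" unfolding D_def
      by (intro holT_mult holT_prod holT_qi holT_den nvT_hol[OF nvT_divide] nvT_mult nvT_ax nvT_tx nvT_sx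
          nvT_const m8) (use q_nz that mids_less in auto)
  qed
  have D: "D c T V n y \<noteq> 0" and S: "sol c T V y n = N c T V n y / D c T V n y"
    if g: "gen (ax True y) (tx True y)" and 8: "T < 8" "V < 8" for c T V n y
  proof -
    note g0 = gen_ax[OF g, of c] and gs = gen_sx[OF gen_ax[OF g, of c], of n]
    have "qi (q / (ax c y * sx c n y (mover (\<not> c)) * tx c y m)) \<noteq> 0" if "m \<in> mids" for m
      using mid_nz(2)[OF gs movers_mover[of c] that] unfolding sx_shift shift_mid[OF movers_mover that] .
    moreover have "den (ax c y) (sx c n y) T \<noteq> 0" "den (ax c y) (sx c n y) V \<noteq> 0"
      using den_nz[OF gs] 8 by simp_all
    ultimately show D: "D c T V n y \<noteq> 0" by (simp add: D_def)
    show "sol c T V y n = N c T V n y / D c T V n y"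
      using D unfolding sol_def mu_def N_def D_def cl_gen[OF gs 8] sx_shift[symmetric] by simp
  qed
  from x(3) obtain n where n: "sol c T V x 0 * sol c' T' V' x n \<noteq> sol c T V x n * sol c' T' V' x 0"
    unfolding indep_def by blast
  define K where "K = (\<lambda>x. N c T V 0 x * N c' T' V' n x * (D c T V n x * D c' T' V' 0 x) -
     N c T V n x * N c' T' V' 0 x * (D c T V 0 x * D c' T' V' n x))"
  have K: "K y \<noteq> 0 \<longleftrightarrow> sol c T V y 0 * sol c' T' V' y n \<noteq> sol c T V y n * sol c' T' V' y 0"
    if g: "gen (ax True y) (tx True y)" for y
    using D[OF g 8(1,2)] D[OF g 8(3,4)] unfolding S[OF g 8(1,2)] S[OF g 8(3,4)] K_def by (simp add: field_simps)
  have "holomorphic_on_torus K" unfolding K_def by (intro holT_diff holT_mult hol 8)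
  hence "gentorus (\<lambda>x. K x \<noteq> 0)" by (rule gentorus_ne_0[OF _ x(1)]) (use K[OF x(2)] n in simp)
  from gentorus_conj[OF gentorus_gen[of True] this] show ?thesis
    by (rule gentorus_mono) (use K in \<open>auto simp: indep_def\<close>)
qed

section \<open>Interchanging two letters\<close>

definition flip :: "nat \<Rightarrow> nat \<Rightarrow> nat \<Rightarrow> nat" where
  "flip m w U = (if U = m then w else if U = w then m else U)"

lemma flip_bij: "m \<in> S \<Longrightarrow> w \<in> S \<Longrightarrow> bij_betw (flip m w) S S"
  by (rule bij_betw_byWitness[of _ "flip m w"]) (auto simp: flip_def)

text \<open>\<open>s_of\<close> depends on the letters through their product only, so permuting
  letters permutes coordinates 0 to 4 and leaves the rest of the octet alone, for every
  \<open>n\<close> and in both classes.\<close>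

lemma letters_swap:
  assumes x: "x \<in> torus" and mw: "m < 5" "w < 5"
  shows "\<exists>y\<in>torus. \<forall>c n. ax c y = ax c x \<and> sx c n y = sx c n x \<circ> flip m w"
proof -
  define ys where "ys = (bx x)[w := bx x ! m, m := bx x ! w]"
  have len: "length (bx x) = 5" by (simp add: bx_def)
  hence len': "length ys = 5" by (simp add: ys_def)
  have ys: "ys ! U = bx x ! flip m w U" if "U < 5" for U
    using that mw len by (auto simp: ys_def flip_def nth_list_update)
  have lt: "flip m w U < 5" if "U < 5" for U using that mw by (auto simp: flip_def)
  have "mset ys = mset (bx x)" unfolding ys_def using mw len by (intro mset_swap) auto
  hence "prod_mset (mset ys) = prod_mset (mset (bx x))" by simp
  hence prod: "s_of q a ys = s_of q a (bx x)" for a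
    by (simp add: prod_mset_prod_list s_of_def)
  define v :: "7 \<Rightarrow> complex" where "v = (\<lambda>i. if i = 2 then ys ! 0 else if i = 3 then ys ! 1 else if i = 4 then ys ! 2
    else if i = 5 then ys ! 3 else if i = 6 then ys ! 4 else x $ i)"
  define y :: "complex ^ 7" where "y = (\<chi> i. v i)"
  have y: "y $ 1 = x $ 1" "y $ 7 = x $ 7" "y $ 2 = ys ! 0" "y $ 3 = ys ! 1" "y $ 4 = ys ! 2" "y $ 5 = ys ! 3" "y $ 6 = ys ! 4"
    by (simp_all only: y_def vec_lambda_beta) (simp_all add: v_def)
  have by': "bx y = ys"
  proof (rule nth_equalityI)
    fix i assume "i < length (bx y)"
    hence "i = 0 \<or> i = 1 \<or> i = 2 \<or> i = 3 \<or> i = 4" by (auto simp: bx_def)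
    thus "bx y ! i = ys ! i" by (elim disjE) (simp_all add: bx_def y)
  qed (simp add: len' bx_def)
  have nz: "bx x ! U \<noteq> 0" if "U < 5" for U
  proof -
    have "U = 0 \<or> U = 1 \<or> U = 2 \<or> U = 3 \<or> U = 4" using that by auto
    thus ?thesis using x by (elim disjE) (simp_all add: bx_def torus_def)
  qed
  have "v i \<noteq> 0" for i using x by (simp add: v_def ys nz lt torus_def)
  hence yt: "y \<in> torus" by (simp add: torus_def y_def)
  have ax: "ax c y = ax c x" for c by (simp add: ax_def y)
  have oct: "oct (x $ 1) ys (x $ 7) n U = oct (x $ 1) (bx x) (x $ 7) n (flip m w U)" for U n
  proof (cases "U < 5")
    case True
    thus ?thesis using lt[OF True] by (simp add: oct_def ys)
  next
    case False
    hence "flip m w U = U" using mw by (auto simp: flip_def)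
    thus ?thesis using False by (simp add: oct_def prod)
  qed
  have "sx c n y = sx c n x \<circ> flip m w" for c n
    by (rule ext) (simp add: sx_def octc_def dual_def by' y oct)
  thus ?thesis using ax yt by blast
qed

lemma fsum_flip:
  assumes "m < 8" "w < 8" shows "fsum a (t \<circ> flip m w) T = fsum a t (flip m w T)"
proof -
  have "(\<Prod>U<8. qi (q * x / t (flip m w U)) / qi (a * x * t (flip m w U))) = (\<Prod>U<8. qi (q * x / t U) / qi (a * x * t U))" for x
    by (rule prod.reindex_bij_betw[OF flip_bij]) (use assms in auto)
  thus ?thesis by (simp add: fsum_def fterm_def)
qed

lemma mu_flip:
  assumes pp: "movers p p'" and mw: "m \<in> mids" "w \<in> mids" shows "mu a (t \<circ> flip m w) p p' n = mu a t p p' n"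
proof -
  have "flip m w p = p" "flip m w p' = p'" using movers_octet(2,3)[OF pp] mw by (auto simp: flip_def)
  moreover have "(\<Prod>U\<in>mids. qi (q / (a * z * t (flip m w U)))) = (\<Prod>U\<in>mids. qi (q / (a * z * t U)))" for z
    by (rule prod.reindex_bij_betw[OF flip_bij[OF mw]])
  ultimately show ?thesis using movers_octet(4)[OF pp] by (simp add: mu_def)
qed

lemma gen_flip:
  assumes "gen a t" "m < 8" "w < 8" shows "gen a (t \<circ> flip m w)"
proof -
  have "flip m w U < 8" if "U < 8" for U using that assms by (auto simp: flip_def)
  moreover have "flip m w U \<noteq> flip m w V" if "U \<noteq> V" for U V using that by (auto simp: flip_def)
  ultimately show ?thesis using genD[OF assms(1)] unfolding gen_def by simp
qed

lemma sol_flip: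
  assumes y: "\<And>c n. ax c y = ax c x" "\<And>c n. sx c n y = sx c n x \<circ> flip m w" and mw: "m \<in> mids" "w \<in> mids"
  shows "sol c T V y n = sol c (flip m w T) (flip m w V) x n"
  unfolding sol_def y(1) sx_0[symmetric] y(2) mu_flip[OF movers_mover mw]
    fsum_flip[OF mids_less[OF mw(1)] mids_less[OF mw(2)]] ..

text \<open>Proportionality is transitive through \<open>Y\<close> as long as \<open>Y\<close> is
  not zero where it is compared; the partner \<open>Z\<close> independent of \<open>Y\<close>
  guarantees this.\<close>

lemma dependence_transitive:
  fixes X X' Y Z :: "int \<Rightarrow> complex"
  assumes "\<And>n. X 0 * Y n = X n * Y 0" "\<And>n. X' 0 * Y n = X' n * Y 0" and Z: "Y 0 * Z k \<noteq> Y k * Z 0"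
  shows "X 0 * X' n = X n * X' 0"
proof (cases "Y 0 = 0")
  case False
  have "X 0 * X' n * Y 0 = X' 0 * (X 0 * Y n)" using assms(2)[of n] by simp
  also have "\<dots> = X n * X' 0 * Y 0" unfolding assms(1) by simp
  finally show ?thesis using False by simp
next
  case True
  hence "Y k \<noteq> 0" using Z by auto
  thus ?thesis using True assms(1,2)[of k] by simp
qed

text \<open>With no mover in either pair, a common pole of both differences at \<open>{p, w}\<close>
  would require \<open>w\<close> to lie in both pairs, which are disjoint. Hence the detour through
  interchanged letters, which leaves the dual difference unchanged.\<close>

lemma cross_mids:
  assumes m: "m \<in> mids" "m' \<in> mids" "u \<in> mids" "u' \<in> mids" and ne: "m \<noteq> m'" "u \<noteq> u'" "{m, m'} \<inter> {u, u'} = {}"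
  shows "gentorus (indep True m m' False u u')"
proof -
  have *: "gentorus (indep True m m' False u u')"
    if m: "m \<in> mids" "m' \<in> mids" "m \<noteq> m'" "{m, m'} \<inter> {u, u'} = {}" "m \<noteq> 7" for m m'
  proof -
    \<comment> \<open>Of the six fixed coordinates these five are avoided; 7 is among them because
      \<open>t 7 = 1\<close> is not a letter and cannot be interchanged.\<close>
    obtain w where w: "w \<in> mids" "w \<noteq> 7" "w \<notin> {m, m', u, u'}" using fresh_mid[of "[m, m', u, u', 7]"] by auto
    have 5: "m < 5" "w < 5" using m w by (auto simp: mids_def)
    have 8: "m < 8" "m' < 8" "u < 8" "u' < 8" "w < 8" using m w assms(3,4) mids_less by auto
    have "gentorus (indep True m m' True w m')" by (rule class_independent) (use 8 m w in \<open>auto simp: doubleton_eq_iff\<close>)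
    \<comment> \<open>Ensures that the dual difference is not the zero sequence at \<open>x\<close>,
      as the transitivity of dependence requires.\<close>
    moreover have "gentorus (indep False u u' False u w)"
      by (rule class_independent) (use 8 ne w in \<open>auto simp: doubleton_eq_iff\<close>)
    ultimately have "\<exists>x\<in>torus. gen (ax True x) (tx True x) \<and> indep True m m' True w m' x \<and> indep False u u' False u w x"
      by (intro gentorus_ex gentorus_conj gentorus_gen)
    then obtain x where x: "x \<in> torus" "gen (ax True x) (tx True x)" "indep True m m' True w m' x"
      "indep False u u' False u w x" by (elim bexE conjE)
    obtain y where y: "y \<in> torus" "\<And>c. ax c y = ax c x" "\<And>c n. sx c n y = sx c n x \<circ> flip m w"
      using letters_swap[OF x(1) 5] by (elim bexE) simp
    have gy: "gen (ax True y) (tx True y)"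
      unfolding sx_0[symmetric] y(2,3) by (rule gen_flip) (use x 8 in \<open>simp_all add: sx_0\<close>)
    have fl: "flip m w m = w" "flip m w m' = m'" "flip m w u = u" "flip m w u' = u'"
      using m w by (auto simp: flip_def)
    show ?thesis
    proof (rule ccontr)
      assume N: "\<not> ?thesis"
      have "\<not> indep True m m' False u u' x" using indep_spread[OF x(1,2)] N 8 by blast
      hence 1: "\<And>n. sol True m m' x 0 * sol False u u' x n = sol True m m' x n * sol False u u' x 0"
        unfolding indep_def by blast
      have "\<not> indep True m m' False u u' y" using indep_spread[OF y(1) gy] N 8 by blast
      hence 2: "\<And>n. sol True w m' x 0 * sol False u u' x n = sol True w m' x n * sol False u u' x 0"
        unfolding indep_def sol_flip[OF y(2,3) m(1) w(1)] fl by blast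
      from x(4) obtain k where "sol False u u' x 0 * sol False u w x k \<noteq> sol False u u' x k * sol False u w x 0"
        unfolding indep_def by blast
      from dependence_transitive[of "sol True m m' x", OF 1 2 this] show False using x(3) unfolding indep_def by blast
    qed
  qed
  show ?thesis
  proof (cases "m = 7")
    case False
    thus ?thesis by (intro *) (use assms in auto)
  next
    case True
    have "gentorus (indep True m' m False u u')" by (intro *) (use assms True in auto)
    thus ?thesis unfolding indep_swap(1)[of True m' m] .
  qed
qed

text \<open>\<open>crossl\<close> and \<open>crossr\<close> carry the quotients of neighbouring values of \<open>mu\<close> for the octet and its dual, up to a common factor.\<close>

definition crossl :: "nat \<Rightarrow> complex ^ 7 \<Rightarrow> complex" where
  "crossl p x = (let a = ax True x; t = tx True x; z = a * t 5 * t 6 in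
     if p = 5 then 1 / z else z / q / (\<Prod>m\<in>mids. a * t p * t m))"

definition crossr :: "nat \<Rightarrow> nat \<Rightarrow> complex ^ 7 \<Rightarrow> complex" where
  "crossr p p' x = (let a = ax True x; t = tx True x; z = a * t 5 * t 6 in
     if p = 5 then z / q else 1 / z * (\<Prod>m\<in>mids. a * t p' * t m / q))"

lemma nvT_cross: "movers p p' \<Longrightarrow> nvT (crossl p)" "movers p p' \<Longrightarrow> nvT (crossr p p')"
proof -
  assume pp: "movers p p'"
  note n = nvT_divide nvT_mult nvT_prod nvT_ax nvT_tx nvT_const movers_octet(5,6)[OF pp] q_nz
  show "nvT (crossl p)" unfolding crossl_def Let_def
    by (cases "p = 5") (auto intro!: n dest: mids_less)
  show "nvT (crossr p p')" unfolding crossr_def Let_def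
    by (cases "p = 5") (auto intro!: n dest: mids_less)
qed

text \<open>There are six factors, so the signs cancel.\<close>

lemma prod_mids_reflect:
  fixes y :: "nat \<Rightarrow> complex"
  assumes "\<And>m. m \<in> mids \<Longrightarrow> y m \<noteq> 0"
  shows "(\<Prod>m\<in>mids. 1 - 1 / y m) = (\<Prod>m\<in>mids. 1 - y m) / (\<Prod>m\<in>mids. y m)"
proof -
  have "(\<Prod>m\<in>mids. 1 - 1 / y m) = (\<Prod>m\<in>mids. - 1 * ((1 - y m) / y m))"
    by (intro prod.cong refl) (use assms in \<open>simp add: field_simps\<close>)
  also have "\<dots> = (\<Prod>m\<in>mids. (1 - y m) / y m)"
    unfolding prod.distrib by (simp add: card_mids)
  finally show ?thesis by (simp add: prod_dividef)
qed

lemma rho_dual: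
  assumes "a \<noteq> 0" "t p \<noteq> 0" "t p' \<noteq> 0" "\<And>m. m \<in> mids \<Longrightarrow> t m \<noteq> 0"
  shows "rho (q / a) (dual t) p' p = 1 / (a * t p * t p') * (\<Prod>m\<in>mids. 1 - a * t p * t m) /
     ((1 - t p / t p') * (1 - q * t p / t p'))"
proof -
  have "(\<Prod>m\<in>mids. 1 - q / (q / a * dual t p * dual t m)) = (\<Prod>m\<in>mids. 1 - a * t p * t m)"
    by (intro prod.cong refl) (use assms q_nz in \<open>simp add: dual_def\<close>)
  thus ?thesis using assms q_nz unfolding rho_def by (simp add: dual_def mult_ac)
qed

text \<open>One step multiplies the gauge factors of the two classes by \<open>rho\<close> of the
  octet and of its dual, which have the same denominator. Once this is cancelled, the determinant
  keeps two products over the fixed coordinates, with zeros at pairings of \<open>p\<close> equal to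
  1 and pairings of \<open>p'\<close> equal to \<open>q\<close>. For \<open>p = 6\<close> the step
  goes down, so \<open>rho\<close> is taken at the shifted octet.\<close>

lemma cross_criterion:
  assumes pp: "movers p p'" and gen: "gen (ax True x) (tx True x)"
  defines "a \<equiv> ax True x" and "t \<equiv> tx True x"
  defines "s \<equiv> shift p p' 1 t"
  assumes ne: "crossl p x * (\<Prod>m\<in>mids. 1 - a * t p * t m) *
      ((fsum a t T - fsum a t V) * (fsum (q / a) (dual s) T' - fsum (q / a) (dual s) V')) \<noteq>
     crossr p p' x * (\<Prod>m\<in>mids. 1 - q / (a * t p' * t m)) *
      ((fsum a s T - fsum a s V) * (fsum (q / a) (dual t) T' - fsum (q / a) (dual t) V'))"
  shows "indep True T V False T' V' x"
proof -
  have g: "gen a t" "gen (q / a) (dual t)" using gen gen_dual by (simp_all add: a_def t_def)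
  have p8: "p < 8" "p' < 8" "p \<noteq> p'" using movers_octet[OF pp] by auto
  have nz: "a \<noteq> 0" "\<And>U. U < 8 \<Longrightarrow> t U \<noteq> 0" using genD[OF g(1)] by auto
  define n :: int where "n = (if p = 5 then 1 else - 1)"
  have s: "sx True n x = s" "sx False n x = dual s" "ax False x = q / a" "tx False x = dual t"
    using shift_tx[OF pp, of True x] unfolding sx_False s_def t_def a_def n_def
    by (simp_all add: mover_def ax_False tx_dual)
  define M N where "M = (\<lambda>k. mu a t 5 6 k)" and "N = (\<lambda>k. mu (q / a) (dual t) 6 5 k)"
  have m56: "movers 5 6" "movers 6 5" by (simp_all add: movers_def)
  have MN: "M k \<noteq> 0" "N k \<noteq> 0" for k unfolding M_def N_def
    by (rule mu_nz[OF g(1) m56(1)], rule mu_nz[OF g(2) m56(2)])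
  have "\<exists>r. r \<noteq> 0 \<and> M 0 * N n = r * (crossl p x * (\<Prod>m\<in>mids. 1 - a * t p * t m)) \<and>
     M n * N 0 = r * (crossr p p' x * (\<Prod>m\<in>mids. 1 - q / (a * t p' * t m)))"
  proof (cases "p = 5")
    case True
    hence p: "p = 5" "p' = 6" using pp by (auto simp: movers_def)
    define D where "D = (1 - t 5 / t 6) * (1 - q * t 5 / t 6)"
    have D: "D \<noteq> 0"
      using genD(4)[OF g(1), of 5 6 0] notin_powers_shift[OF genD(4)[OF g(1), of 5 6], of "q * t 5 / t 6" 1 0]
      by (simp add: D_def)
    have "M 1 = rho a t 5 6 * M 0" "N 1 = rho (q / a) (dual t) 6 5 * N 0"
      using mu_step[OF g(1) m56(1), of 0] mu_step[OF g(2) m56(2), of 0] by (simp_all add: M_def N_def)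
    moreover have "rho a t 5 6 = crossr p p' x * (\<Prod>m\<in>mids. 1 - q / (a * t p' * t m)) / D"
      by (simp add: rho_def crossr_def Let_def p D_def a_def t_def)
    moreover have "rho (q / a) (dual t) 6 5 = crossl p x * (\<Prod>m\<in>mids. 1 - a * t p * t m) / D"
      by (subst rho_dual) (use nz mids_less in \<open>simp_all add: crossl_def Let_def p D_def a_def t_def\<close>)
    ultimately show ?thesis using D MN by (intro exI[of _ "M 0 * N 0 / D"]) (simp add: n_def p)
  next
    case False
    hence p: "p = 6" "p' = 5" using pp by (auto simp: movers_def)
    have s56: "s = shift 5 6 (- 1) t" "dual s = shift 6 5 (- 1) (dual t)"
      using shift_swap[of 6 5 1 t] dual_shift[OF m56(1), of "- 1" t] by (simp_all add: s_def p)
    define D where "D = (1 - s 5 / s 6) * (1 - q * s 5 / s 6)"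
    have gs: "gen a s" using g(1) by (simp add: s_def gen_shift)
    have D: "D \<noteq> 0"
      using genD(4)[OF gs, of 5 6 0] notin_powers_shift[OF genD(4)[OF gs, of 5 6], of "q * s 5 / s 6" 1 0]
      by (simp add: D_def)
    have se: "s 5 = t 5 / q" "s 6 = t 6 * q" "\<And>m. m \<in> mids \<Longrightarrow> s m = t m"
      using shift_mid[OF pp] by (simp_all add: s_def p power_int_minus divide_inverse)
    have "M 0 = rho a s 5 6 * M (- 1)" "N 0 = rho (q / a) (dual s) 6 5 * N (- 1)"
      using mu_step[OF g(1) m56(1), of "- 1"] mu_step[OF g(2) m56(2), of "- 1"] s56 by (simp_all add: M_def N_def)
    moreover have "rho a s 5 6 = crossl p x * (\<Prod>m\<in>mids. 1 - a * t p * t m) / D"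
    proof -
      have "(\<Prod>m\<in>mids. 1 - q / (a * s 6 * s m)) = (\<Prod>m\<in>mids. 1 - 1 / (a * t 6 * t m))"
        by (intro prod.cong refl) (use q_nz in \<open>simp add: se mult.assoc\<close>)
      also have "\<dots> = (\<Prod>m\<in>mids. 1 - a * t 6 * t m) / (\<Prod>m\<in>mids. a * t 6 * t m)"
        by (rule prod_mids_reflect) (use nz mids_less in simp)
      finally have pr: "(\<Prod>m\<in>mids. 1 - q / (a * s 6 * s m)) = (\<Prod>m\<in>mids. 1 - a * t 6 * t m) / (\<Prod>m\<in>mids. a * t 6 * t m)" .
      have z: "a * s 5 * s 6 = a * t 5 * t 6" using q_nz by (simp add: se(1,2))
      show ?thesis unfolding rho_def pr D_def[symmetric] z
        by (simp add: crossl_def Let_def p a_def[symmetric] t_def[symmetric])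
    qed
    moreover have "rho (q / a) (dual s) 6 5 = crossr p p' x * (\<Prod>m\<in>mids. 1 - q / (a * t p' * t m)) / D"
    proof -
      have "(\<Prod>m\<in>mids. 1 - q / (a * t 5 * t m)) = (\<Prod>m\<in>mids. 1 - 1 / (a * t 5 * t m / q))"
        by (intro prod.cong refl) simp
      also have "\<dots> = (\<Prod>m\<in>mids. 1 - a * t 5 * t m / q) / (\<Prod>m\<in>mids. a * t 5 * t m / q)"
        by (rule prod_mids_reflect) (use nz mids_less q_nz in simp)
      finally have pr: "(\<Prod>m\<in>mids. 1 - a * t 5 * t m / q) =
         (\<Prod>m\<in>mids. 1 - q / (a * t 5 * t m)) * (\<Prod>m\<in>mids. a * t 5 * t m / q)"
        using nz mids_less q_nz by (simp add: prod_zero_iff)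
      have pr': "(\<Prod>m\<in>mids. 1 - a * s 5 * s m) = (\<Prod>m\<in>mids. 1 - a * t 5 * t m / q)"
        by (intro prod.cong refl) (simp add: se)
      have z: "a * s 5 * s 6 = a * t 5 * t 6" using q_nz by (simp add: se(1,2))
      have "rho (q / a) (dual s) 6 5 = 1 / (a * s 5 * s 6) * (\<Prod>m\<in>mids. 1 - a * s 5 * s m) / D"
        unfolding D_def by (rule rho_dual) (use nz mids_less genD(2)[OF gs] in simp_all)
      thus ?thesis unfolding pr' pr z
        by (simp add: crossr_def Let_def p a_def[symmetric] t_def[symmetric])
    qed
    ultimately show ?thesis using D MN by (intro exI[of _ "M (- 1) * N (- 1) / D"]) (simp add: n_def p)
  qed
  then obtain r where r: "r \<noteq> 0" "M 0 * N n = r * (crossl p x * (\<Prod>m\<in>mids. 1 - a * t p * t m))"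
     "M n * N 0 = r * (crossr p p' x * (\<Prod>m\<in>mids. 1 - q / (a * t p' * t m)))" by blast
  have e: "sol True T V x 0 = M 0 * (fsum a t T - fsum a t V)" "sol True T V x n = M n * (fsum a s T - fsum a s V)"
    "sol False T' V' x 0 = N 0 * (fsum (q / a) (dual t) T' - fsum (q / a) (dual t) V')"
    "sol False T' V' x n = N n * (fsum (q / a) (dual s) T' - fsum (q / a) (dual s) V')"
    unfolding sol_def s M_def N_def by (simp_all add: mover_def sx_0 s a_def t_def)
  have "sol True T V x 0 * sol False T' V' x n = r * (crossl p x * (\<Prod>m\<in>mids. 1 - a * t p * t m) *
      ((fsum a t T - fsum a t V) * (fsum (q / a) (dual s) T' - fsum (q / a) (dual s) V')))"
    using arg_cong[OF r(2), of "\<lambda>v. v * ((fsum a t T - fsum a t V) * (fsum (q / a) (dual s) T' - fsum (q / a) (dual s) V'))"]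
    unfolding e by (simp only: mult_ac)
  moreover have "sol True T V x n * sol False T' V' x 0 = r * (crossr p p' x * (\<Prod>m\<in>mids. 1 - q / (a * t p' * t m)) *
      ((fsum a s T - fsum a s V) * (fsum (q / a) (dual t) T' - fsum (q / a) (dual t) V')))"
    using arg_cong[OF r(3), of "\<lambda>v. v * ((fsum a s T - fsum a s V) * (fsum (q / a) (dual t) T' - fsum (q / a) (dual t) V'))"]
    unfolding e by (simp only: mult_ac)
  ultimately show ?thesis unfolding indep_def using ne r(1) by (intro exI[of _ n]) simp
qed

lemma holT_prod_mids:
  assumes "p < 8" "S \<subseteq> mids"
  shows "holomorphic_on_torus (\<lambda>x. \<Prod>m\<in>S. 1 - ax c x * tx c x p * tx c x m)"
    "holomorphic_on_torus (\<lambda>x. \<Prod>m\<in>S. 1 - q / (ax c x * tx c x p * tx c x m))"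
  using assms mids_less q_nz
  by (auto intro!: holT_prod holT_diff holT_const nvT_hol[OF nvT_mult] nvT_hol[OF nvT_divide] nvT_mult nvT_ax nvT_tx nvT_const)

text \<open>
  The pole at \<open>{p, w}\<close> is present before the shift in the octet, but after the shift in its dual,
  because \<open>pairing\<close> becomes \<open>q / pairing\<close> there. It occurs twice in one product and not at all in the
  other, and the factor \<open>1 - a t\<^sub>p t\<^sub>w\<close> of the former cancels only one of the two.
\<close>

lemma cross_pole:
  assumes pp: "movers p p'" and w: "w \<in> mids" and T: "T = w \<or> T = p" and T': "T' = w \<or> T' = p"
    and V: "V < 8" "V \<notin> {w, p}" "V' < 8" "V' \<notin> {w, p}"
  shows "gentorus (indep True T V False T' V')"
proof -
  \<comment> \<open>The pair \<open>{m, U}\<close> avoids \<open>V\<close>, \<open>V'\<close> and,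
    being fixed and different from \<open>w\<close>, also \<open>T\<close> and \<open>T'\<close>:
    the pole it creates does not enter the determinant.\<close>
  obtain m where m: "m \<in> mids" "m \<notin> {w, V, V'}" using fresh_mid[of "[w, V, V']"] by auto
  obtain U where U: "U \<in> mids" "U \<notin> {w, V, V', m}" using fresh_mid[of "[w, V, V', m]"] by auto
  define W W' where "W = (if T = w then p else w)" and "W' = (if T' = w then p else w)"
  note mo = movers_octet[OF pp]
  have le: "w < 8" "m < 8" "U < 8" "T < 8" "W < 8" "p < 8" "p' < 8" "T' < 8" "W' < 8"
    using w U T T' mo mids_less m by (auto simp: W_def W'_def)
  have ne: "w \<noteq> p" "m \<noteq> p" "U \<noteq> p" "w \<noteq> p'" "m \<noteq> p'" "U \<noteq> p'" "p \<noteq> p'" using w m U mo by auto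
  have mU: "w \<noteq> m" "w \<noteq> U" "m \<noteq> U" using m U by auto
  define t s dt ds where "t = tx True" and "s = (\<lambda>x. shift p p' 1 (tx True x))"
    and "dt = tx False" and "ds = (\<lambda>x. shift p' p 1 (tx False x))"
  define a A where "a = ax True" and "A = ax False"
  have nvs: "nvT (\<lambda>x. s x B)" "nvT (\<lambda>x. ds x B)" if "B < 8" for B
    unfolding s_def ds_def by (rule nvT_shift_tx[OF that pp], rule nvT_shift_tx[OF that movers_commute[OF pp]])
  have nv: "nvT a" "nvT A" "\<And>B. B < 8 \<Longrightarrow> nvT (\<lambda>x. t x B)" "\<And>B. B < 8 \<Longrightarrow> nvT (\<lambda>x. dt x B)"
    unfolding a_def A_def t_def dt_def by (rule nvT_ax nvT_tx, assumption?)+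
  have A: "A x = q / a x" and dt: "dt x = dual (t x)" and ds: "ds x = dual (s x)" for x
    unfolding A_def a_def dt_def t_def ds_def s_def by (simp_all add: ax_False tx_dual dual_shift[OF pp])
  define P where "P = (\<lambda>x. pairing (a x) (t x) p w)"
  \<comment> \<open>The cleared determinant divided by \<open>1 - P\<close>. In the first product
    this factor is taken from the product over the fixed coordinates, in the second from the
    denominator of \<open>T\<close> before the shift.\<close>
  define K where "K = (\<lambda>x. crossl p x * (\<Prod>m\<in>mids - {w}. 1 - a x * t x p * t x m) * (cl (a x) (t x) T V * cl (A x) (ds x) T' V') *
      (den (a x) (s x) T * den (a x) (s x) V * (den (A x) (dt x) T' * den (A x) (dt x) V'))
     - crossr p p' x * (\<Prod>m\<in>mids. 1 - q / (a x * t x p' * t x m)) * (cl (a x) (s x) T V * cl (A x) (dt x) T' V') *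
      (denx (a x) (t x) T W * qi (q * P x) * den (a x) (t x) V * (den (A x) (ds x) T' * den (A x) (ds x) V')))"
  have hol: "holomorphic_on_torus K"
  proof -
    have "holomorphic_on_torus (\<lambda>x. \<Prod>m\<in>mids - {w}. 1 - a x * t x p * t x m)"
      "holomorphic_on_torus (\<lambda>x. \<Prod>m\<in>mids. 1 - q / (a x * t x p' * t x m))"
      unfolding a_def t_def by (rule holT_prod_mids(1)[OF le(6)], simp) (rule holT_prod_mids(2)[OF le(7)], simp)
    thus ?thesis unfolding K_def P_def
      by (intro holT_diff holT_mult holT_cl holT_den holT_denx holT_qi holT_const holT_pairing nv nvs le V
        nvT_hol[OF nvT_cross(1)[OF pp]] nvT_hol[OF nvT_cross(2)[OF pp]])
  qed
  from special_point[OF pp w m(1) U(1) mU, of True] obtain x where x: "x \<in> torus"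
    "pairing (a x) (t x) p w = 1" "pairing (a x) (t x) m U = 1"
    "\<And>A B. A < 8 \<Longrightarrow> B < 8 \<Longrightarrow> A \<noteq> B \<Longrightarrow> free_ratio (t x) A B"
    "\<And>A B. A < 8 \<Longrightarrow> B < 8 \<Longrightarrow> {A, B} \<noteq> {p, w} \<Longrightarrow> {A, B} \<noteq> {m, U} \<Longrightarrow> free_pairing (a x) (t x) A B"
    unfolding a_def t_def by (elim bexE conjE) simp
  have ratio: "free_ratio (ds x) B C" if "B < 8" "C < 8" "B \<noteq> C" for B C
    unfolding ds s_def by (rule free_ratio_dual, rule free_ratio_shift, rule x(4)[unfolded t_def]) (use that in auto)
  have free: "free_pairing (a x) (s x) B C" "free_pairing (A x) (dt x) B C" "free_pairing (A x) (ds x) B C"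
    if "B < 8" "C < 8" "{B, C} \<noteq> {p, w}" "{B, C} \<noteq> {m, U}" for B C
  proof -
    have f: "free_pairing (a x) (s x) B C" unfolding s_def by (rule free_pairing_shift, rule x(5)[OF that, unfolded t_def])
    thus "free_pairing (a x) (s x) B C" "free_pairing (A x) (dt x) B C" "free_pairing (A x) (ds x) B C"
      unfolding A dt ds using free_pairing_dual[OF f] free_pairing_dual[OF x(5)[OF that]] by simp_all
  qed
  have TW: "{T, W} = {p, w}" "{T', W'} = {p, w}" using T T' by (auto simp: W_def W'_def)
  have ptw: "pairing (a x) (t x) T W = 1" "pairing (a x) (t x) T' W' = 1"
    using x(2) T T' by (auto simp: W_def W'_def pairing_commute[of _ _ w])
  have psw: "pairing (a x) (s x) T W = q" "pairing (a x) (s x) T' W' = q"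
    using ptw T T' ne by (auto simp: pairing_def s_def t_def W_def W'_def mult_ac)
  have pd: "pairing (A x) (dt x) T' W' = q" "pairing (A x) (ds x) T' W' = 1"
    unfolding A dt ds pairing_dual ptw psw using q_nz by simp_all
  have den: "den (a x) (t x) B \<noteq> 0" "den (a x) (s x) B \<noteq> 0" "den (A x) (dt x) B \<noteq> 0" "den (A x) (ds x) B \<noteq> 0"
    if "B < 8" "B \<notin> {w, p, m, U}" for B
  proof -
    have n: "{B, C} \<noteq> {p, w}" "{B, C} \<noteq> {m, U}" for C using that by (auto simp: doubleton_eq_iff)
    show "den (a x) (t x) B \<noteq> 0" by (rule den_ne_0, rule qi_free, rule x(5)[OF that(1) _ n])
    show "den (a x) (s x) B \<noteq> 0" by (rule den_ne_0, rule qi_free, rule free(1)[OF that(1) _ n])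
    show "den (A x) (dt x) B \<noteq> 0" by (rule den_ne_0, rule qi_free, rule free(2)[OF that(1) _ n])
    show "den (A x) (ds x) B \<noteq> 0" by (rule den_ne_0, rule qi_free, rule free(3)[OF that(1) _ n])
  qed
  have TmU: "T \<noteq> m" "T \<noteq> U" "T' \<noteq> m" "T' \<noteq> U" using T T' mU ne by auto
  have nTB: "{T, B} \<noteq> {m, U}" "{T', B} \<noteq> {m, U}" for B using TmU by (auto simp: doubleton_eq_iff)
  have nTT: "{T, T} \<noteq> {p, w}" "{T', T'} \<noteq> {p, w}" using ne by (auto simp: doubleton_eq_iff)
  have nTC: "{T, B} \<noteq> {p, w}" if "B \<noteq> W" for B using that TW(1) by (auto simp: doubleton_eq_iff)
  have nTC': "{T', B} \<noteq> {p, w}" if "B \<noteq> W'" for B using that TW(2) by (auto simp: doubleton_eq_iff)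
  have Vm: "V \<notin> {w, p, m, U}" "V' \<notin> {w, p, m, U}" using V m U by auto
  have "cl (a x) (t x) T V \<noteq> 0"
    by (rule cl_ne_0[OF le(4,5) ptw(1) x(5)[OF le(4,4) nTT(1) nTB(1)] x(4)[OF le(4)] den(1)[OF V(1) Vm(1)]]) simp_all
  moreover have "cl (A x) (ds x) T' V' \<noteq> 0"
    by (rule cl_ne_0[OF le(8,9) pd(2) free(3)[OF le(8,8) nTT(2) nTB(2)] ratio[OF le(8)] den(4)[OF V(3) Vm(2)]]) simp_all
  moreover have "den (a x) (s x) T \<noteq> 0"
  proof (rule den_ne_0)
    fix B :: nat assume B: "B < 8"
    show "qi (pairing (a x) (s x) T B) \<noteq> 0"
      using psw(1) qi_q qi_free[OF free(1)[OF le(4) B nTC nTB(1)]] by (cases "B = W") auto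
  qed
  moreover have "den (A x) (dt x) T' \<noteq> 0"
  proof (rule den_ne_0)
    fix B :: nat assume B: "B < 8"
    show "qi (pairing (A x) (dt x) T' B) \<noteq> 0"
      using pd(1) qi_q qi_free[OF free(2)[OF le(8) B nTC' nTB(2)]] by (cases "B = W'") auto
  qed
  moreover have "(\<Prod>m\<in>mids - {w}. 1 - a x * t x p * t x m) \<noteq> 0"
  proof -
    have "1 - a x * t x p * t x B \<noteq> 0" if "B \<in> mids - {w}" for B
    proof -
      have "{p, B} \<noteq> {p, w}" "{p, B} \<noteq> {m, U}" using that ne by (auto simp: doubleton_eq_iff)
      from x(5)[OF le(6) _ this] that mids_less have "pairing (a x) (t x) p B \<noteq> q powi 0"
        unfolding free_pairing_def by blast
      thus ?thesis by (simp add: pairing_def)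
    qed
    thus ?thesis by simp
  qed
  moreover have "crossl p x \<noteq> 0" by (rule nvT_nz[OF nvT_cross(1)[OF pp] x(1)])
  moreover note den(2)[OF V(1) Vm(1)] den(3)[OF V(3) Vm(2)]
  \<comment> \<open>The second product of \<open>K\<close> still contains this denominator after the
    division by \<open>1 - P\<close>, and vanishes.\<close>
  moreover have "den (A x) (ds x) T' = 0" by (rule den_eq_0[OF pd(2) le(9)])
  ultimately have "K x \<noteq> 0" unfolding K_def by simp
  from gentorus_conj[OF gentorus_gen[of True] gentorus_ne_0[OF hol x(1) this]] show ?thesis
  proof (rule gentorus_mono)
    fix y assume y: "gen (ax True y) (tx True y) \<and> K y \<noteq> 0"
    have g: "gen (a y) (t y)" "gen (a y) (s y)" "gen (A y) (dt y)" "gen (A y) (ds y)"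
      using y gen_dual unfolding A dt ds by (auto simp: a_def t_def s_def intro: gen_shift)
    have P: "1 - P y \<noteq> 0" using genD(3)[OF g(1) le(6,1), of 0] by (simp add: P_def pairing_def)
    have PW: "pairing (a y) (t y) T W = P y" using T by (auto simp: W_def P_def pairing_commute[of _ _ w])
    have d: "den (a y) (t y) T = denx (a y) (t y) T W * ((1 - P y) * qi (q * P y))"
      using den_split[OF le(5), of "a y" "t y" T] unfolding PW using qi_step[of "P y"] by simp
    have pr: "(\<Prod>m\<in>mids. 1 - a y * t y p * t y m) = (1 - P y) * (\<Prod>m\<in>mids - {w}. 1 - a y * t y p * t y m)"
      using w by (subst prod.remove[of mids w]) (simp_all add: P_def pairing_def)
    show "indep True T V False T' V' y"
    proof (rule cross_criterion[OF pp conjunct1[OF y]], fold a_def t_def, rule notI)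
      let ?s = "shift p p' 1 (t y)"
      assume E: "crossl p y * (\<Prod>m\<in>mids. 1 - a y * t y p * t y m) *
        ((fsum (a y) (t y) T - fsum (a y) (t y) V) * (fsum (q / a y) (dual ?s) T' - fsum (q / a y) (dual ?s) V')) =
       crossr p p' y * (\<Prod>m\<in>mids. 1 - q / (a y * t y p' * t y m)) *
        ((fsum (a y) ?s T - fsum (a y) ?s V) * (fsum (q / a y) (dual (t y)) T' - fsum (q / a y) (dual (t y)) V'))"
      have ss: "?s = s y" by (simp add: s_def t_def)
      define J1 J2 J3 J4 where J: "J1 = fsum (a y) (t y) T - fsum (a y) (t y) V" "J2 = fsum (A y) (ds y) T' - fsum (A y) (ds y) V'"
        "J3 = fsum (a y) (s y) T - fsum (a y) (s y) V" "J4 = fsum (A y) (dt y) T' - fsum (A y) (dt y) V'"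
      define R where "R = den (a y) (t y) V * den (a y) (s y) T * den (a y) (s y) V *
        (den (A y) (dt y) T' * den (A y) (dt y) V' * den (A y) (ds y) T' * den (A y) (ds y) V') * (denx (a y) (t y) T W * qi (q * P y))"
      have E': "crossl p y * ((1 - P y) * (\<Prod>m\<in>mids - {w}. 1 - a y * t y p * t y m)) * (J1 * J2) =
          crossr p p' y * (\<Prod>m\<in>mids. 1 - q / (a y * t y p' * t y m)) * (J3 * J4)"
        using E unfolding J A dt ds ss pr .
      have "K y * (1 - P y) = crossl p y * ((1 - P y) * (\<Prod>m\<in>mids - {w}. 1 - a y * t y p * t y m)) * (J1 * J2) * (R * (1 - P y))
         - crossr p p' y * (\<Prod>m\<in>mids. 1 - q / (a y * t y p' * t y m)) * (J3 * J4) * (R * (1 - P y))"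
        unfolding K_def R_def cl_gen[OF g(1) le(4) V(1)] cl_gen[OF g(2) le(4) V(1)]
          cl_gen[OF g(3) le(8) V(3)] cl_gen[OF g(4) le(8) V(3)] J[symmetric] d left_diff_distrib[of _ _ "1 - P y"]
        by (simp only: mult_ac)
      also have "\<dots> = 0" unfolding E' by simp
      finally show False using y P by simp
    qed
  qed
qed

text \<open>
  Here the dual difference has poles at both \<open>m\<close> and \<open>p\<close> after the shift, so that its cleared form vanishes
  at the special point; the other product survives.
\<close>

lemma cross_clash:
  assumes pp: "movers p p'" and m: "m \<in> mids"
  shows "gentorus (indep True m p' False m p)"
proof -
  obtain w where w: "w \<in> mids" "w \<notin> {m}" using fresh_mid[of "[m]"] by auto
  obtain U where U: "U \<in> mids" "U \<notin> {m, w}" using fresh_mid[of "[m, w]"] by auto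
  \<comment> \<open>Two partners for \<open>m\<close>: \<open>U\<close> provides its pole in the
    octet and \<open>U'\<close> its pole in the dual. All three are fixed, so both poles are present
    before and after the shift.\<close>
  obtain U' where U': "U' \<in> mids" "U' \<notin> {m, w, U}" using fresh_mid[of "[m, w, U]"] by auto
  note mo = movers_octet[OF pp]
  have le: "w < 8" "m < 8" "U < 8" "U' < 8" "p < 8" "p' < 8"
    using w U U' mo mids_less m by auto
  have ne: "w \<noteq> p" "m \<noteq> p" "U \<noteq> p" "U' \<noteq> p" "w \<noteq> p'" "m \<noteq> p'" "U \<noteq> p'" "U' \<noteq> p'" "p \<noteq> p'" using w m U U' mo by auto
  have mU: "w \<noteq> m" "w \<noteq> U" "m \<noteq> U" "m \<noteq> U'" "U \<noteq> U'" "w \<noteq> U'" using w U U' by auto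
  have dist: "distinct [w, m, U, U']" using mU by simp
  define t s dt ds where "t = tx True" and "s = (\<lambda>x. shift p p' 1 (tx True x))"
    and "dt = tx False" and "ds = (\<lambda>x. shift p' p 1 (tx False x))"
  define a A where "a = ax True" and "A = ax False"
  have nvs: "nvT (\<lambda>x. s x B)" "nvT (\<lambda>x. ds x B)" if "B < 8" for B
    unfolding s_def ds_def by (rule nvT_shift_tx[OF that pp], rule nvT_shift_tx[OF that movers_commute[OF pp]])
  have nv: "nvT a" "nvT A" "\<And>B. B < 8 \<Longrightarrow> nvT (\<lambda>x. t x B)" "\<And>B. B < 8 \<Longrightarrow> nvT (\<lambda>x. dt x B)"
    unfolding a_def A_def t_def dt_def by (rule nvT_ax nvT_tx, assumption?)+
  have A: "A x = q / a x" and dt: "dt x = dual (t x)" and ds: "ds x = dual (s x)" for x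
    unfolding A_def a_def dt_def t_def ds_def s_def by (simp_all add: ax_False tx_dual dual_shift[OF pp])
  define P where "P = (\<lambda>x. pairing (a x) (t x) p w)"
  have nvP: "nvT P" unfolding P_def pairing_def by (intro nvT_mult nv le)
  \<comment> \<open>The denominators by which each product is multiplied, without the factors common
    to both: those of \<open>m\<close> with \<open>U\<close> and with \<open>U'\<close>, and, in
    \<open>M1\<close>, the factor \<open>1 - 1 / P\<close> of the dual denominator of
    \<open>p\<close>.\<close>
  define M1 where "M1 = (\<lambda>x. denx (a x) (t x) m U * den (a x) (t x) p' *
      (qi (q / P x) * (denx (A x) (ds x) m U' * denx (A x) (ds x) p w)))"
  define M2 where "M2 = (\<lambda>x. denx (a x) (s x) m U * den (a x) (s x) p' *
      (denx (A x) (dt x) m U' * den (A x) (dt x) p))"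
  \<comment> \<open>The plus sign and the factor \<open>P x\<close> stem from
    \<open>1 - P = - P * (1 - 1 / P)\<close>, the factor \<open>w\<close> of the product over the
    fixed coordinates.\<close>
  define K where "K = (\<lambda>x. crossr p p' x * (\<Prod>B\<in>mids. 1 - q / (a x * t x p' * t x B)) *
       (cl (a x) (s x) m p' * cl (A x) (dt x) m p) * M1 x
     + P x * (crossl p x * (\<Prod>B\<in>mids - {w}. 1 - a x * t x p * t x B) *
       (cl (a x) (t x) m p' * cl (A x) (ds x) m p) * M2 x))"
  have hol: "holomorphic_on_torus K"
  proof -
    have "holomorphic_on_torus (\<lambda>x. \<Prod>B\<in>mids - {w}. 1 - a x * t x p * t x B)"
      "holomorphic_on_torus (\<lambda>x. \<Prod>B\<in>mids. 1 - q / (a x * t x p' * t x B))"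
      unfolding a_def t_def by (rule holT_prod_mids(1)[OF le(5)], simp) (rule holT_prod_mids(2)[OF le(6)], simp)
    moreover have "holomorphic_on_torus (\<lambda>x. q / P x)"
      by (rule nvT_hol, rule nvT_divide[OF _ nvP]) (use q_nz in \<open>simp add: nvT_const\<close>)
    ultimately show ?thesis unfolding K_def M1_def M2_def
      by (intro holT_add holT_mult holT_cl holT_den holT_denx holT_qi nv nvs le nvT_hol[OF nvP]
        nvT_hol[OF nvT_cross(1)[OF pp]] nvT_hol[OF nvT_cross(2)[OF pp]])
  qed
  from special_point'[OF pp w(1) m U(1) U'(1) dist, of True] obtain x where x: "x \<in> torus"
    "pairing (a x) (t x) p w = 1" "pairing (a x) (t x) m U = 1" "pairing (a x) (t x) m U' = q"
    "\<And>B C. B < 8 \<Longrightarrow> C < 8 \<Longrightarrow> B \<noteq> C \<Longrightarrow> {B, C} \<noteq> {U, U'} \<Longrightarrow> free_ratio (t x) B C"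
    "\<And>B C. B < 8 \<Longrightarrow> C < 8 \<Longrightarrow> {B, C} \<noteq> {p, w} \<Longrightarrow> {B, C} \<noteq> {m, U} \<Longrightarrow> {B, C} \<noteq> {m, U'} \<Longrightarrow> free_pairing (a x) (t x) B C"
    unfolding a_def t_def by (elim bexE conjE) simp
  have rat: "free_ratio (s x) m C" "free_ratio (dt x) m C" if "C < 8" "C \<noteq> m" for C
  proof -
    have "{m, C} \<noteq> {U, U'}" "{C, m} \<noteq> {U, U'}" using mU by (auto simp: doubleton_eq_iff)
    note r = x(5)[OF le(2) that(1) _ this(1)] x(5)[OF that(1) le(2) _ this(2)]
    show "free_ratio (s x) m C" unfolding s_def by (rule free_ratio_shift, rule r(1)[unfolded t_def]) (use that in auto)
    show "free_ratio (dt x) m C" unfolding dt by (rule free_ratio_dual, rule r(2)) (use that in auto)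
  qed
  have free: "free_pairing (a x) (s x) B C" "free_pairing (A x) (dt x) B C" "free_pairing (A x) (ds x) B C"
    if "B < 8" "C < 8" "{B, C} \<noteq> {p, w}" "{B, C} \<noteq> {m, U}" "{B, C} \<noteq> {m, U'}" for B C
  proof -
    have f: "free_pairing (a x) (s x) B C" unfolding s_def by (rule free_pairing_shift, rule x(6)[OF that, unfolded t_def])
    thus "free_pairing (a x) (s x) B C" "free_pairing (A x) (dt x) B C" "free_pairing (A x) (ds x) B C"
      unfolding A dt ds using free_pairing_dual[OF f] free_pairing_dual[OF x(6)[OF that]] by simp_all
  qed
  have ps: "pairing (a x) (s x) p w = q" "pairing (a x) (s x) m U = 1" "pairing (a x) (s x) m U' = q"
    using x(2-4) ne by (auto simp: pairing_def s_def t_def mult_ac)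
  have pd: "pairing (A x) (dt x) p w = q" "pairing (A x) (ds x) p w = 1" "pairing (A x) (dt x) m U' = 1"
     "pairing (A x) (ds x) m U' = 1" "pairing (A x) (ds x) m U = q"
    unfolding A dt ds pairing_dual x(2-4) ps using q_nz by simp_all
  have np: "{p', C} \<noteq> {p, w}" "{p', C} \<noteq> {m, U}" "{p', C} \<noteq> {m, U'}" for C using ne by (auto simp: doubleton_eq_iff)
  have npp: "{p, C} \<noteq> {m, U}" "{p, C} \<noteq> {m, U'}" for C using ne by (auto simp: doubleton_eq_iff)
  have npw: "{p, C} \<noteq> {p, w}" if "C \<noteq> w" for C using ne that by (auto simp: doubleton_eq_iff)
  have nm: "{m, C} \<noteq> {p, w}" for C using ne mU by (auto simp: doubleton_eq_iff)
  have nmU: "{m, C} \<noteq> {m, U}" if "C \<noteq> U" for C using mU that by (auto simp: doubleton_eq_iff)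
  have nmU': "{m, C} \<noteq> {m, U'}" if "C \<noteq> U'" for C using mU that by (auto simp: doubleton_eq_iff)
  have denp': "den (a x) (t x) p' \<noteq> 0" "den (a x) (s x) p' \<noteq> 0"
    using den_ne_0[OF qi_free[OF x(6)[OF le(6) _ np]]] den_ne_0[OF qi_free[OF free(1)[OF le(6) _ np]]] by blast+
  have denp: "den (A x) (dt x) p \<noteq> 0"
  proof (rule den_ne_0)
    fix B :: nat assume B: "B < 8"
    show "qi (pairing (A x) (dt x) p B) \<noteq> 0"
      using pd(1) qi_q qi_free[OF free(2)[OF le(5) B npw npp]] by (cases "B = w") auto
  qed
  have "cl (a x) (s x) m p' \<noteq> 0"
    by (rule cl_ne_0[OF le(2,3) ps(2) free(1)[OF le(2,2) nm nmU nmU'] rat(1) denp'(2)]) (use mU in auto)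
  moreover have "cl (A x) (dt x) m p \<noteq> 0"
    by (rule cl_ne_0[OF le(2,4) pd(3) free(2)[OF le(2,2) nm nmU nmU'] rat(2) denp]) (use mU in auto)
  moreover have "denx (a x) (t x) m U \<noteq> 0"
  proof (rule denx_ne_0)
    fix B :: nat assume B: "B < 8" "B \<noteq> U"
    show "qi (pairing (a x) (t x) m B) \<noteq> 0"
      using x(4) qi_q qi_free[OF x(6)[OF le(2) B(1) nm nmU[OF B(2)] nmU']] by (cases "B = U'") auto
  qed
  moreover have "denx (A x) (ds x) m U' \<noteq> 0"
  proof (rule denx_ne_0)
    fix B :: nat assume B: "B < 8" "B \<noteq> U'"
    show "qi (pairing (A x) (ds x) m B) \<noteq> 0"
      using pd(5) qi_q qi_free[OF free(3)[OF le(2) B(1) nm nmU nmU'[OF B(2)]]] by (cases "B = U") auto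
  qed
  moreover have "denx (A x) (ds x) p w \<noteq> 0"
    by (rule denx_ne_0, rule qi_free, rule free(3)[OF le(5) _ npw npp])
  moreover have "qi (q / P x) \<noteq> 0" using x(2) qi_q by (simp add: P_def)
  moreover have "(\<Prod>B\<in>mids. 1 - q / (a x * t x p' * t x B)) \<noteq> 0"
  proof -
    have "1 - q / (a x * t x p' * t x B) \<noteq> 0" if "B \<in> mids" for B
    proof -
      have "pairing (a x) (t x) p' B \<noteq> q powi 1"
        using x(6)[OF le(6) mids_less[OF that] np] unfolding free_pairing_def by blast
      thus ?thesis using nvT_nz[OF nv(1) x(1)] nvT_nz[OF nv(3) x(1)] le(6) mids_less[OF that] by (simp add: pairing_def)
    qed
    thus ?thesis unfolding prod_zero_iff[OF finite_mids] by blast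
  qed
  moreover have "crossr p p' x \<noteq> 0" by (rule nvT_nz[OF nvT_cross(2)[OF pp] x(1)])
  \<comment> \<open>Each summand of the cleared difference contains one of the two denominators, and
    after the shift both are zero.\<close>
  moreover have "cl (A x) (ds x) m p = 0"
    by (simp add: cl_def den_eq_0[OF pd(2) le(1)] den_eq_0[OF pd(4) le(4)])
  moreover note denp'(1)
  ultimately have "K x \<noteq> 0" unfolding K_def M1_def by simp
  from gentorus_conj[OF gentorus_gen[of True] gentorus_ne_0[OF hol x(1) this]] show ?thesis
  proof (rule gentorus_mono)
    fix y assume yt: "y \<in> torus" and y: "gen (ax True y) (tx True y) \<and> K y \<noteq> 0"
    have g: "gen (a y) (t y)" "gen (a y) (s y)" "gen (A y) (dt y)" "gen (A y) (ds y)"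
      using y gen_dual unfolding A dt ds by (auto simp: a_def t_def s_def intro: gen_shift)
    have P0: "P y \<noteq> 0" by (rule nvT_nz[OF nvP yt])
    have P: "1 - 1 / P y \<noteq> 0" using genD(3)[OF g(1) le(5,1), of 0] P0 by (simp add: P_def pairing_def)
    have psy: "pairing (a y) (s y) m U = pairing (a y) (t y) m U" "pairing (a y) (s y) m U' = pairing (a y) (t y) m U'"
      "pairing (a y) (s y) p w = q * P y"
      using ne by (simp_all add: pairing_def s_def t_def P_def)
    define X Y where "X = qi (pairing (a y) (t y) m U)" and "Y = qi (q / pairing (a y) (t y) m U')"
    have "X \<noteq> 0" unfolding X_def pairing_def by (rule qi_nz, rule genD(3)[OF g(1) le(2,3)])
    moreover have "Y \<noteq> 0"
    proof -
      have "qi (pairing (A y) (dt y) m U') \<noteq> 0"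
        unfolding pairing_def by (rule qi_nz, rule genD(3)[OF g(3) le(2,4)])
      thus ?thesis unfolding Y_def A dt pairing_dual .
    qed
    ultimately have XY: "X \<noteq> 0" "Y \<noteq> 0" by blast+
    have d: "den (a y) (t y) m = denx (a y) (t y) m U * X" "den (a y) (s y) m = denx (a y) (s y) m U * X"
      "den (A y) (dt y) m = denx (A y) (dt y) m U' * Y" "den (A y) (ds y) m = denx (A y) (ds y) m U' * Y"
      using den_split[OF le(3), of "a y" "t y" m] den_split[OF le(3), of "a y" "s y" m]
        den_split[OF le(4), of "A y" "dt y" m] den_split[OF le(4), of "A y" "ds y" m]
      unfolding X_def Y_def A dt ds pairing_dual psy by simp_all
    have d': "den (A y) (ds y) p = denx (A y) (ds y) p w * ((1 - 1 / P y) * qi (q / P y))"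
    proof -
      have "pairing (A y) (ds y) p w = 1 / P y" unfolding A ds pairing_dual psy using q_nz by simp
      thus ?thesis using den_split[OF le(1), of "A y" "ds y" p] qi_step[of "1 / P y"] by simp
    qed
    have pr: "(\<Prod>B\<in>mids. 1 - a y * t y p * t y B) = - P y * (1 - 1 / P y) * (\<Prod>B\<in>mids - {w}. 1 - a y * t y p * t y B)"
    proof -
      have "1 - a y * t y p * t y w = - P y * (1 - 1 / P y)" using P0 by (simp add: P_def pairing_def field_simps)
      thus ?thesis using w by (subst prod.remove[of mids w]) simp_all
    qed
    show "indep True m p' False m p y"
    proof (rule cross_criterion[OF pp conjunct1[OF y]], fold a_def t_def, rule notI)
      let ?s = "shift p p' 1 (t y)"
      assume E: "crossl p y * (\<Prod>B\<in>mids. 1 - a y * t y p * t y B) *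
        ((fsum (a y) (t y) m - fsum (a y) (t y) p') * (fsum (q / a y) (dual ?s) m - fsum (q / a y) (dual ?s) p)) =
       crossr p p' y * (\<Prod>B\<in>mids. 1 - q / (a y * t y p' * t y B)) *
        ((fsum (a y) ?s m - fsum (a y) ?s p') * (fsum (q / a y) (dual (t y)) m - fsum (q / a y) (dual (t y)) p))"
      have ss: "?s = s y" by (simp add: s_def t_def)
      define J1 J2 J3 J4 where J: "J1 = fsum (a y) (t y) m - fsum (a y) (t y) p'" "J2 = fsum (A y) (ds y) m - fsum (A y) (ds y) p"
        "J3 = fsum (a y) (s y) m - fsum (a y) (s y) p'" "J4 = fsum (A y) (dt y) m - fsum (A y) (dt y) p"
      define L where "L = crossl p y * (\<Prod>B\<in>mids - {w}. 1 - a y * t y p * t y B)"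
      define R where "R = crossr p p' y * (\<Prod>B\<in>mids. 1 - q / (a y * t y p' * t y B))"
      define \<epsilon> where "\<epsilon> = 1 - 1 / P y"
      have E': "- P y * \<epsilon> * L * (J1 * J2) = R * (J3 * J4)"
        using E unfolding J A dt ds ss pr L_def R_def \<epsilon>_def by (simp only: mult_ac)
      define Z where "Z = X * Y * (X * Y * M1 y * M2 y)"
      have 1: "R * (cl (a y) (s y) m p' * cl (A y) (dt y) m p) * M1 y = R * (J3 * J4) * (X * Y * M1 y * M2 y)"
        unfolding cl_gen[OF g(2) le(2,6)] cl_gen[OF g(3) le(2,5)] J[symmetric] d M2_def by (simp only: mult_ac)
      have 2: "L * (cl (a y) (t y) m p' * cl (A y) (ds y) m p) * M2 y = L * (J1 * J2) * (\<epsilon> * (X * Y * M1 y * M2 y))"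
        unfolding cl_gen[OF g(1) le(2,6)] cl_gen[OF g(4) le(2,5)] J[symmetric] d d' M1_def \<epsilon>_def by (simp only: mult_ac)
      have "K y = R * (J3 * J4) * (X * Y * M1 y * M2 y) + P y * (L * (J1 * J2) * (\<epsilon> * (X * Y * M1 y * M2 y)))"
        unfolding K_def L_def[symmetric] R_def[symmetric] 1 2 ..
      also have "\<dots> = 0" unfolding E'[symmetric] by simp
      finally show False using y by simp
    qed
  qed
qed

text \<open>\<open>cross_pole\<close> applies once some mover \<open>p\<close> and fixed
  \<open>w\<close> are such that each pair contains exactly one of them. No such choice exists only
  for pairs \<open>{m, p}\<close> and \<open>{m, p'}\<close>, settled by \<open>cross_clash\<close>,
  and for disjoint pairs of fixed coordinates, settled by \<open>cross_mids\<close>.\<close>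

lemma cross_independent:
  assumes 8: "T < 8" "V < 8" "T' < 8" "V' < 8" and ne: "T \<noteq> V" "T' \<noteq> V'"
  shows "gentorus (indep True T V False T' V')"
proof -
  have pole: "gentorus (indep True T V False T' V')"
    if pw: "movers p p'" "w \<in> mids" "(w \<in> {T, V}) \<noteq> (p \<in> {T, V})" "(w \<in> {T', V'}) \<noteq> (p \<in> {T', V'})" for p p' w
  proof -
    have c: "(T = w \<or> T = p) \<and> V \<notin> {w, p} \<or> (V = w \<or> V = p) \<and> T \<notin> {w, p}"
      "(T' = w \<or> T' = p) \<and> V' \<notin> {w, p} \<or> (V' = w \<or> V' = p) \<and> T' \<notin> {w, p}"
      using pw(3,4) ne by auto
    note cp = cross_pole[OF pw(1,2)]
    from c show ?thesis
    proof (elim disjE conjE)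
    qed (use cp[of T T' V V'] cp[of T V' V T'] cp[of V T' T V'] cp[of V V' T T'] 8 in \<open>simp_all add: indep_swap\<close>)
  qed
  show ?thesis
  proof (cases "\<exists>p p'. movers p p' \<and> p \<in> {T, V}")
    case True
    then obtain p p' where p: "movers p p'" "p \<in> {T, V}" by blast
    note mo = movers_octet[OF p(1)]
    show ?thesis
    proof (cases "p \<in> {T', V'}")
      case True
      obtain w where "w \<in> mids" "w \<notin> {T, V, T', V'}" using fresh_mid[of "[T, V, T', V']"] by auto
      thus ?thesis by (intro pole[OF p(1)]) (use True p(2) in auto)
    next
      case pn: False
      show ?thesis
      proof (cases "\<exists>w\<in>mids. w \<in> {T', V'} \<and> w \<notin> {T, V}")
        case True
        then obtain w where "w \<in> mids" "w \<in> {T', V'}" "w \<notin> {T, V}" by blast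
        thus ?thesis by (intro pole[OF p(1), of w]) (use pn p(2) in auto)
      next
        case False
        define m where "m = (if T = p then V else T)"
        have TV: "T = m \<and> V = p \<or> T = p \<and> V = m" using p(2) by (auto simp: m_def)
        have c: "B = m \<and> m \<in> mids \<or> B = p'" if "B < 8" "B \<in> {T', V'}" for B
        proof -
          have "B = p \<or> B = p' \<or> B \<in> mids" using mo(1) that(1) by blast
          moreover have "B \<noteq> p" using that(2) pn by blast
          moreover have "B = m" if "B \<in> mids" "B \<noteq> p" using False that \<open>B \<in> {T', V'}\<close> TV by blast
          ultimately show ?thesis by blast
        qed
        have TV': "T' = m \<and> V' = p' \<or> T' = p' \<and> V' = m" and m: "m \<in> mids"
          using c[OF 8(3)] c[OF 8(4)] ne(2) by blast+
        have "indep True T V False T' V' = indep True m p False m p'"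
          using TV TV' by (elim disjE conjE) (simp_all add: indep_swap)
        thus ?thesis using cross_clash[OF movers_commute[OF p(1)] m] by simp
      qed
    qed
  next
    case nm: False
    hence TV: "T \<in> mids" "V \<in> mids" using octet_cases[OF 8(1)] octet_cases[OF 8(2)] movers_56 movers_commute[OF movers_56] by blast+
    show ?thesis
    proof (cases "\<exists>p p'. movers p p' \<and> p \<in> {T', V'}")
      case True
      then obtain p p' where p: "movers p p'" "p \<in> {T', V'}" by blast
      have "\<exists>w. w \<in> {T, V} \<and> w \<notin> {T', V'}"
        using p movers_octet(2)[OF p(1)] TV ne by blast
      then obtain w where w: "w \<in> {T, V}" "w \<notin> {T', V'}" by blast
      thus ?thesis by (intro pole[OF p(1), of w]) (use p nm TV in blast)+
    next
      case nm': False
      hence TV': "T' \<in> mids" "V' \<in> mids" using octet_cases[OF 8(3)] octet_cases[OF 8(4)] movers_56 movers_commute[OF movers_56] by blast+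
      show ?thesis
      proof (cases "{T, V} \<inter> {T', V'} = {}")
        case True
        thus ?thesis by (rule cross_mids[OF TV TV' ne])
      next
        case False
        then obtain w where w: "w \<in> {T, V}" "w \<in> {T', V'}" by blast
        thus ?thesis by (intro pole[OF movers_56, of w]) (use nm nm' movers_56 TV in blast)+
      qed
    qed
  qed
qed

end

section \<open>The fifty-six solutions\<close>

text \<open>One orientation for each of the 28 unordered pairs, counted as 7 + 6 + 5 + 10 like the
  choices in \<open>fifty_six\<close>. Different members of a class thus belong to different
  pairs.\<close>

definition oriented :: "nat \<Rightarrow> nat \<Rightarrow> bool" where
  "oriented T V \<longleftrightarrow> T = 7 \<and> V < 7 \<or> T = 5 \<and> (V = 6 \<or> V < 5) \<or> T = 6 \<and> V < 5 \<or> T < V \<and> V < 5"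

lemma oriented_unique: "oriented T V \<Longrightarrow> oriented T' V' \<Longrightarrow> {T, V} = {T', V'} \<Longrightarrow> T = T' \<and> V = V'"
  unfolding oriented_def doubleton_eq_iff by linarith

lemma oriented_less: "oriented T V \<Longrightarrow> T < 8 \<and> V < 8 \<and> T \<noteq> V"
  unfolding oriented_def by linarith

lemma fifty_six_oriented:
  assumes "(S, i) \<in> fifty_six"
  shows "\<exists>c T. S = fam c T \<and> i < 7 \<and> oriented T (fidx T ! i)"
proof -
  have 7: "fidx 7 ! i = i" if "i < 7" using that by (auto simp: fidx_def less_Suc_eq numeral_eq_Suc)
  have 5: "fidx 5 ! i = 6 \<or> fidx 5 ! i < 5" if "i < 6" using that by (auto simp: fidx_def less_Suc_eq numeral_eq_Suc)
  have 6: "fidx 6 ! i < 5" if "i \<in> {1..5}"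
  proof -
    have "i = 1 \<or> i = 2 \<or> i = 3 \<or> i = 4 \<or> i = 5" using that by auto
    thus ?thesis by (elim disjE) (simp_all add: fidx_def)
  qed
  have l: "fidx T ! i = i" if "T < i" "i < 5" for T
  proof -
    have "i = 1 \<or> i = 2 \<or> i = 3 \<or> i = 4" "T = 0 \<or> T = 1 \<or> T = 2 \<or> T = 3" using that by auto
    thus ?thesis using that by (elim disjE) (simp_all add: fidx_def)
  qed
  from assms consider "S = X1" "i < 7" | "S = X2" "i < 7" | "S = X3" "i < 6" | "S = X4" "i < 6"
    | "S = X5" "i \<in> {1..5}" | "S = X6" "i \<in> {1..5}" | T where "S = X7 T" "T < i" "i < 5" | T where "S = X8 T" "T < i" "i < 5"
    unfolding fifty_six_def by blast
  thus ?thesis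
  proof cases
    case 1
    thus ?thesis using 7 by (intro exI[of _ True] exI[of _ 7]) (simp add: fam_def oriented_def)
  next
    case 2
    thus ?thesis using 7 by (intro exI[of _ False] exI[of _ 7]) (simp add: fam_def oriented_def)
  next
    case 3
    thus ?thesis using 5 by (intro exI[of _ True] exI[of _ 5]) (simp add: fam_def oriented_def)
  next
    case 4
    thus ?thesis using 5 by (intro exI[of _ False] exI[of _ 5]) (simp add: fam_def oriented_def)
  next
    case 5
    thus ?thesis using 6 by (intro exI[of _ False] exI[of _ 6]) (simp add: fam_def oriented_def)
  next
    case 6
    thus ?thesis using \<open>i \<in> {1..5} \<Longrightarrow> fidx 6 ! i < 5\<close> by (intro exI[of _ True] exI[of _ 6]) (simp add: fam_def oriented_def)
  next
    case (7 T)
    thus ?thesis using l[of T] by (intro exI[of _ True] exI[of _ T]) (simp add: fam_def oriented_def)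
  next
    case (8 T)
    thus ?thesis using l[of T] by (intro exI[of _ False] exI[of _ T]) (simp add: fam_def oriented_def)
  qed
qed

lemma finite_fifty_six: "finite fifty_six"
proof -
  have "finite {(X i, j) |i j. i < j \<and> j < 5}" for X :: "nat \<Rightarrow> family"
    by (rule finite_subset[of _ "(X ` {..<5}) \<times> {..<5}"]) auto
  thus ?thesis unfolding fifty_six_def by simp
qed

lemma lin_indep2I:
  fixes X Y :: "int \<Rightarrow> complex"
  assumes "K \<noteq> 0" "L \<noteq> 0" "\<And>n. X n = K * x n" "\<And>n. Y n = L * y n" "x 0 * y n \<noteq> x n * y 0"
  shows "lin_indep2 X Y"
  unfolding lin_indep2_def
proof (intro allI impI)
  fix \<alpha> \<beta> assume "\<forall>n. \<alpha> * X n + \<beta> * Y n = 0"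
  hence e: "\<alpha> * K * x k = - (\<beta> * L * y k)" for k using assms(3,4) by (simp add: eq_neg_iff_add_eq_0 mult.assoc)
  have "\<alpha> * K * (x 0 * y n - x n * y 0) = (\<alpha> * K * x 0) * y n - (\<alpha> * K * x n) * y 0" by (simp add: algebra_simps)
  also have "\<dots> = 0" unfolding e by simp
  finally have \<alpha>: "\<alpha> = 0" using assms(1,5) by simp
  have "y 0 \<noteq> 0 \<or> y n \<noteq> 0" using assms(5) by auto
  thus "\<alpha> = 0 \<and> \<beta> = 0" using e[of 0] e[of n] \<alpha> assms(2) by auto
qed

context q_base
begin

lemma all_independent:
  assumes "T < 8" "V < 8" "T' < 8" "V' < 8" "T \<noteq> V" "T' \<noteq> V'" "c = c' \<Longrightarrow> {T, V} \<noteq> {T', V'}"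
  shows "gentorus (indep c T V c' T' V')"
proof (cases "c = c'")
  case True
  thus ?thesis using class_independent[of T V T' V' c] assms by simp
next
  case False
  hence "c \<and> \<not> c' \<or> \<not> c \<and> c'" by blast
  thus ?thesis
    using cross_independent[of T V T' V'] cross_independent[of T' V' T V] assms(1-6)
    by (elim disjE) (simp_all add: indep_commute[of False])
qed

lemma X_seq_sol:
  assumes x: "x \<in> torus" and g: "gen (ax True x) (tx True x)" and T: "T < 8" "i < 7"
  shows "\<exists>K. K \<noteq> 0 \<and> (\<forall>n. X_seq q (x $ 1) (bx x) (x $ 7) (fam c T) i n = K * sol c T (fidx T ! i) x n)"
proof -
  have nz: "x $ j \<noteq> 0" for j using x by (simp add: torus_def)
  have "gen (x $ 1) (oct (x $ 1) (bx x) (x $ 7) 0)" using g by (simp add: ax_def base_def tx_def octc_def)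
  from X_seq_octet[OF nz nz nz nz nz nz nz this[unfolded bx_def] T(1), of c]
  show ?thesis using T(2) unfolding sol_def sx_def tx_def ax_def bx_def by blast
qed

lemma generically_eq: "generically P \<longleftrightarrow> gentorus (\<lambda>x. P (x $ 1) (x $ 2) (x $ 3) (x $ 4) (x $ 5) (x $ 6) (x $ 7))"
  unfolding generically_def gentorus_def ..

text \<open>Generic properties are stable under finite intersections, so the finitely many pairs of
  solutions are treated one at a time. Intersecting with \<open>gen\<close> ensures nonsingularity
  and the passage from \<open>sol\<close> to the given sequences.\<close>

lemma fifty_six_independent:
  "generically (\<lambda>a b c d e f h. nonsingular q a [b, c, d, e, f] h \<and>
     pairwise (\<lambda>(S, i) (T, j). lin_indep2 (X_seq q a [b, c, d, e, f] h S i)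
                                          (X_seq q a [b, c, d, e, f] h T j)) fifty_six)"
proof -
  let ?L = "\<lambda>u x. lin_indep2 (X_seq q (x $ 1) (bx x) (x $ 7) (fst (fst u)) (snd (fst u)))
                            (X_seq q (x $ 1) (bx x) (x $ 7) (fst (snd u)) (snd (snd u)))"
  have L: "gentorus (?L ((S, i), (S', i')))" if uu: "(S, i) \<in> fifty_six" "(S', i') \<in> fifty_six" "(S, i) \<noteq> (S', i')" for S i S' i'
  proof -
    obtain c T where S: "S = fam c T" "i < 7" "oriented T (fidx T ! i)" using fifty_six_oriented[OF uu(1)] by blast
    obtain c' T' where S': "S' = fam c' T'" "i' < 7" "oriented T' (fidx T' ! i')" using fifty_six_oriented[OF uu(2)] by blast
    define V V' where "V = fidx T ! i" and "V' = fidx T' ! i'"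
    have o: "T < 8" "V < 8" "T' < 8" "V' < 8" "T \<noteq> V" "T' \<noteq> V'"
      using oriented_less[OF S(3)] oriented_less[OF S'(3)] by (simp_all add: V_def V'_def)
    have ne: "{T, V} \<noteq> {T', V'}" if "c = c'"
    proof
      assume "{T, V} = {T', V'}"
      hence "T = T' \<and> V = V'" unfolding V_def V'_def by (rule oriented_unique[OF S(3) S'(3)])
      hence e: "T = T'" "V = V'" by blast+
      have "distinct (fidx T)" "length (fidx T) = 7" using is_idx_fidx[OF o(1)] is_idx_length by (simp_all add: is_idx_def)
      hence "i = i'" using e S(2) S'(2) nth_eq_iff_index_eq[of "fidx T" i i'] by (simp add: V_def V'_def)
      thus False using uu(3) S(1) S'(1) e(1) that by simp
    qed
    have "gentorus (indep c T V c' T' V')" by (rule all_independent[OF o ne])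
    from gentorus_conj[OF gentorus_gen[of True] this] show ?thesis
    proof (rule gentorus_mono)
      fix x assume x: "x \<in> torus" "gen (ax True x) (tx True x) \<and> indep c T V c' T' V' x"
      obtain K where K: "K \<noteq> 0" "\<And>n. X_seq q (x $ 1) (bx x) (x $ 7) (fam c T) i n = K * sol c T V x n"
        using X_seq_sol[OF x(1) conjunct1[OF x(2)] o(1) S(2), of c] unfolding V_def by blast
      obtain L where L: "L \<noteq> 0" "\<And>n. X_seq q (x $ 1) (bx x) (x $ 7) (fam c' T') i' n = L * sol c' T' V' x n"
        using X_seq_sol[OF x(1) conjunct1[OF x(2)] o(3) S'(2), of c'] unfolding V'_def by blast
      from x(2) obtain n where "sol c T V x 0 * sol c' T' V' x n \<noteq> sol c T V x n * sol c' T' V' x 0"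
        unfolding indep_def by blast
      from lin_indep2I[OF K(1) L(1) K(2) L(2) this]
      show "?L ((S, i), (S', i')) x" unfolding S(1) S'(1) by (simp only: fst_conv snd_conv)
    qed
  qed
  have "gentorus (?L u)" if "u \<in> (fifty_six \<times> fifty_six) - Id" for u
    using L[of "fst (fst u)" "snd (fst u)" "fst (snd u)" "snd (snd u)"] that by (cases u) simp
  hence "gentorus (\<lambda>x. \<forall>u\<in>(fifty_six \<times> fifty_six) - Id. ?L u x)"
    by (intro gentorus_ball) (auto simp: finite_fifty_six)
  from gentorus_conj[OF gentorus_gen[of True] this] show ?thesis
    unfolding generically_eq
  proof (rule gentorus_mono)
    fix x assume x: "x \<in> torus" "gen (ax True x) (tx True x) \<and> (\<forall>u\<in>(fifty_six \<times> fifty_six) - Id. ?L u x)"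
    have nz: "x $ j \<noteq> 0" for j using x by (simp add: torus_def)
    have "gen (x $ 1) (oct (x $ 1) (bx x) (x $ 7) 0)" using x(2) by (simp add: ax_def base_def tx_def octc_def)
    from gen_imp_nonsingular[OF nz nz nz nz nz nz nz this[unfolded bx_def]]
    have "nonsingular q (x $ 1) (bx x) (x $ 7)" by (simp add: bx_def)
    moreover have "pairwise (\<lambda>(S, i) (T, j). lin_indep2 (X_seq q (x $ 1) (bx x) (x $ 7) S i) (X_seq q (x $ 1) (bx x) (x $ 7) T j)) fifty_six"
      unfolding pairwise_def
    proof (intro ballI impI)
      fix u v :: "family \<times> nat" assume "u \<in> fifty_six" "v \<in> fifty_six" "u \<noteq> v"
      hence "?L (u, v) x" using x(2) by blast
      thus "(\<lambda>(S, i) (T, j). lin_indep2 (X_seq q (x $ 1) (bx x) (x $ 7) S i) (X_seq q (x $ 1) (bx x) (x $ 7) T j)) u v"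
        by (simp add: case_prod_unfold)
    qed
    ultimately show "nonsingular q (x $ 1) [x $ 2, x $ 3, x $ 4, x $ 5, x $ 6] (x $ 7) \<and>
      pairwise (\<lambda>(S, i) (T, j). lin_indep2 (X_seq q (x $ 1) [x $ 2, x $ 3, x $ 4, x $ 5, x $ 6] (x $ 7) S i)
        (X_seq q (x $ 1) [x $ 2, x $ 3, x $ 4, x $ 5, x $ 6] (x $ 7) T j)) fifty_six"
      unfolding bx_def by (rule conjI)
  qed
qed

lemma families_solve:
  assumes nz: "a \<noteq> 0" "b \<noteq> 0" "c \<noteq> 0" "d \<noteq> 0" "e \<noteq> 0" "f \<noteq> 0" "h \<noteq> 0" and ns: "nonsingular q a [b, c, d, e, f] h"
  shows "\<forall>S\<in>families. \<forall>i<7. solves_recurrence q a [b, c, d, e, f] h (X_seq q a [b, c, d, e, f] h S i)"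
    and "\<forall>X\<in>{X7, X8}. \<forall>i<5. \<forall>j<5. i \<noteq> j \<longrightarrow> (\<exists>C. C \<noteq> 0 \<and>
      (\<forall>n. X_seq q a [b, c, d, e, f] h (X i) j n = C * X_seq q a [b, c, d, e, f] h (X j) i n))"
proof -
  note g = nonsingular_imp_gen[OF nz ns]
  show "\<forall>S\<in>families. \<forall>i<7. solves_recurrence q a [b, c, d, e, f] h (X_seq q a [b, c, d, e, f] h S i)"
    unfolding families_eq using family_solves[OF nz g] by blast
  have fam: "X7 i = fam True i" "X8 i = fam False i" if "i < 5" for i using that by (simp_all add: fam_def)
  show "\<forall>X\<in>{X7, X8}. \<forall>i<5. \<forall>j<5. i \<noteq> j \<longrightarrow> (\<exists>C. C \<noteq> 0 \<and>
      (\<forall>n. X_seq q a [b, c, d, e, f] h (X i) j n = C * X_seq q a [b, c, d, e, f] h (X j) i n))"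
  proof (intro ballI allI impI)
    fix X and i j :: nat assume X: "X \<in> {X7, X8}" and ij: "i < 5" "j < 5" "i \<noteq> j"
    from X obtain k where "X i = fam k i" "X j = fam k j" using fam ij by blast
    thus "\<exists>C. C \<noteq> 0 \<and> (\<forall>n. X_seq q a [b, c, d, e, f] h (X i) j n = C * X_seq q a [b, c, d, e, f] h (X j) i n)"
      using family_swap[OF nz g ij] by simp
  qed
qed

end

theorem mainTheorem3:
  fixes q :: complex
  assumes "0 < norm q" and "norm q < 1"
  shows
    "(\<forall>a b c d e f h.
        a \<noteq> 0 \<and> b \<noteq> 0 \<and> c \<noteq> 0 \<and> d \<noteq> 0 \<and> e \<noteq> 0 \<and> f \<noteq> 0 \<and> h \<noteq> 0 \<and>
        nonsingular q a [b, c, d, e, f] h \<longrightarrow>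
          (\<forall>S\<in>families. \<forall>i<7.
             solves_recurrence q a [b, c, d, e, f] h (X_seq q a [b, c, d, e, f] h S i)) \<and>
          (\<forall>X\<in>{X7, X8}. \<forall>i<5. \<forall>j<5. i \<noteq> j \<longrightarrow>
             (\<exists>C. C \<noteq> 0 \<and> (\<forall>n. X_seq q a [b, c, d, e, f] h (X i) j n =
                               C * X_seq q a [b, c, d, e, f] h (X j) i n)))) \<and>
     generically (\<lambda>a b c d e f h.
        nonsingular q a [b, c, d, e, f] h \<and>
        pairwise (\<lambda>(S, i) (T, j). lin_indep2 (X_seq q a [b, c, d, e, f] h S i)
                                             (X_seq q a [b, c, d, e, f] h T j)) fifty_six)"
proof -
  interpret q_base q using assms by unfold_locales auto
  show ?thesis
  proof (rule conjI[OF _ fifty_six_independent], intro allI impI)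
    fix a b c d e f h :: complex
    assume "a \<noteq> 0 \<and> b \<noteq> 0 \<and> c \<noteq> 0 \<and> d \<noteq> 0 \<and> e \<noteq> 0 \<and> f \<noteq> 0 \<and> h \<noteq> 0 \<and> nonsingular q a [b, c, d, e, f] h"
    hence n: "a \<noteq> 0" "b \<noteq> 0" "c \<noteq> 0" "d \<noteq> 0" "e \<noteq> 0" "f \<noteq> 0" "h \<noteq> 0" "nonsingular q a [b, c, d, e, f] h"
      by blast+
    show "(\<forall>S\<in>families. \<forall>i<7. solves_recurrence q a [b, c, d, e, f] h (X_seq q a [b, c, d, e, f] h S i)) \<and>
      (\<forall>X\<in>{X7, X8}. \<forall>i<5. \<forall>j<5. i \<noteq> j \<longrightarrow> (\<exists>C. C \<noteq> 0 \<and>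
        (\<forall>n. X_seq q a [b, c, d, e, f] h (X i) j n = C * X_seq q a [b, c, d, e, f] h (X j) i n)))"
      by (rule conjI[OF families_solve[OF n]])
  qed
qed

end
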